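(* Let $d\ge1$, $X=\mathbb{R}^d/\mathbb{Z}^d$, $\alpha\in\mathbb{R}^d$. Let $(f_\alpha,A_s)$ be a one-parameter analytic family of analytic premonotonic cocycles; that is, $s$ ranges over an open interval of $\mathbb{R}$, $(s,x)\mapsto A_s(x)\in\mathrm{SL}(2,\mathbb{R})$ is real-analytic, and $(f_\alpha,A_s)$ is premonotonic for every $s$. Then $s\mapsto L(f_\alpha,A_s)$ is real-analytic.
   Context: $f_\alpha:X\to X$ is $f_\alpha(x)=x+\alpha$. For $A:X\to\mathrm{SL}(2,\mathbb{R})$, the cocycle $(f_\alpha,A)$ is the skew-product $(x,w)\mapsto(x+\alpha,A(x)\cdot w)$ on $X\times\mathbb{R}^2$; put $A_n(x)=A(x+(n-1)\alpha)\cdots A(x)$ for $n\ge1$ (the $n$-th iterate products). The Lyapunov exponent is $L(f_\alpha,A)=\lim_{n\to\infty}\frac1n\int_X\ln\|A_n(x)\|\,dx$. $A\in C^1(X,\mathrm{SL}(2,\mathbb{R}))$ is called monotonic if there is $w\in\mathbb{R}^d$ such that for every $x\in X$ and $y\in\mathbb{R}^2\setminus\{0\}$, (any continuous determination of) the argument of $A(x+tw)\cdot y$, $t\in\mathbb{R}$, has positive derivative with respect to $t$. The cocycle $(f_\alpha,A)$ with $A\in C^1$ is premonotonic if there are $n\ge1$ and $B\in C^1(X,\mathrm{SL}(2,\mathbb{R}))$ such that $x\mapsto B(x+n\alpha)A_n(x)B(x)^{-1}$ is monotonic. *)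

theory Defs
  imports "HOL-Analysis.Analysis"
begin

text \<open>
  A function on the torus \<open>X = \<real>\<^sup>d / \<int>\<^sup>d\<close> is represented by its \<open>\<int>\<^sup>d\<close>-periodic lift to \<open>\<real>\<^sup>d\<close>, with
  \<open>d = CARD('n) \<ge> 1\<close>; regularity on \<open>X\<close> is regularity of the lift, and the integral over \<open>X\<close>
  (normalized Haar measure) is the Lebesgue integral of the lift over the unit cube.
\<close>

definition torus_periodic :: "(real ^ 'n \<Rightarrow> 'b) \<Rightarrow> bool" where
  "torus_periodic f \<longleftrightarrow> (\<forall>x k. (\<forall>i. k $ i \<in> \<int>) \<longrightarrow> f (x + k) = f x)"

definition torus_SL2 :: "(real ^ 'n \<Rightarrow> real ^ 2 ^ 2) \<Rightarrow> bool" where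
  "torus_SL2 A \<longleftrightarrow> torus_periodic A \<and> (\<forall>x. det (A x) = 1)"

definition torus_C1_SL2 :: "(real ^ 'n \<Rightarrow> real ^ 2 ^ 2) \<Rightarrow> bool" where
  "torus_C1_SL2 A \<longleftrightarrow> torus_SL2 A \<and>
     (\<exists>A' :: real ^ 'n \<Rightarrow> (real ^ 'n) \<Rightarrow>\<^sub>L (real ^ 2 ^ 2).
        (\<forall>x. (A has_derivative blinfun_apply (A' x)) (at x)) \<and> continuous_on UNIV A')"

text \<open>
  Real analyticity on an open set: near every point the function is the sum of a power series in
  the coordinates. The coefficients are indexed by multi-indices \<open>k\<close>, which are functions from the
  standard basis to the naturals; the sum over multi-indices is unconditional.
\<close>

definition real_analytic_on ::
    "('a::euclidean_space \<Rightarrow> 'b::real_normed_vector) \<Rightarrow> 'a set \<Rightarrow> bool"  (infix \<open>real'_analytic'_on\<close> 50) where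
  "f real_analytic_on S \<longleftrightarrow>
     (\<forall>p\<in>S. \<exists>r>0. \<exists>c :: ('a \<Rightarrow> nat) \<Rightarrow> 'b. \<forall>x\<in>ball p r.
        ((\<lambda>k. (\<Prod>b\<in>Basis. ((x - p) \<bullet> b) ^ k b) *\<^sub>R c k) has_sum f x) (Basis \<rightarrow>\<^sub>E UNIV))"

primrec cocycle_iter ::
    "real ^ 'n \<Rightarrow> (real ^ 'n \<Rightarrow> real ^ 2 ^ 2) \<Rightarrow> nat \<Rightarrow> real ^ 'n \<Rightarrow> real ^ 2 ^ 2" where
  "cocycle_iter \<alpha> A 0 x = mat 1"
| "cocycle_iter \<alpha> A (Suc n) x = A (x + real n *\<^sub>R \<alpha>) ** cocycle_iter \<alpha> A n x"

definition lyapunov_exponent :: "real ^ 'n \<Rightarrow> (real ^ 'n \<Rightarrow> real ^ 2 ^ 2) \<Rightarrow> real" where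
  "lyapunov_exponent \<alpha> A =
     lim (\<lambda>n. 1 / real n * (LINT x:cbox 0 1|lborel. ln (onorm (\<lambda>v. cocycle_iter \<alpha> A n x *v v))))"

definition is_continuous_argument :: "(real \<Rightarrow> real) \<Rightarrow> (real \<Rightarrow> real ^ 2) \<Rightarrow> bool" where
  "is_continuous_argument \<theta> v \<longleftrightarrow> continuous_on UNIV \<theta> \<and>
     (\<forall>t. v t $ 1 = norm (v t) * cos (\<theta> t) \<and> v t $ 2 = norm (v t) * sin (\<theta> t))"

definition monotonic :: "(real ^ 'n \<Rightarrow> real ^ 2 ^ 2) \<Rightarrow> bool" where
  "monotonic A \<longleftrightarrow> torus_C1_SL2 A \<and>
     (\<exists>w. \<forall>x y. y \<noteq> 0 \<longrightarrow>
        (\<forall>\<theta>. is_continuous_argument \<theta> (\<lambda>t. A (x + t *\<^sub>R w) *v y) \<longrightarrow>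
           (\<forall>t. \<exists>D>0. (\<theta> has_real_derivative D) (at t))))"

definition premonotonic :: "real ^ 'n \<Rightarrow> (real ^ 'n \<Rightarrow> real ^ 2 ^ 2) \<Rightarrow> bool" where
  "premonotonic \<alpha> A \<longleftrightarrow> torus_C1_SL2 A \<and>
     (\<exists>n\<ge>1. \<exists>B. torus_C1_SL2 B \<and>
        monotonic (\<lambda>x. B (x + real n *\<^sub>R \<alpha>) ** cocycle_iter \<alpha> A n x ** matrix_inv (B x)))"

end

theory Submission
  imports Defs "HOL-Complex_Analysis.Complex_Analysis"
begin

text \<open>
Fix \<open>s\<^sub>0\<close>, let \<open>w\<close> be the direction in which the twisted \<open>n\<close>-step cocycle of \<open>A\<^sub>s\<^sub>0\<close> is monotonic, and
extend \<open>A\<^sub>s(x + t w)\<close> holomorphically to complex \<open>s\<close> near \<open>s\<^sub>0\<close> and complex time \<open>z\<close> near \<open>0\<close>. Write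
\<open>L(s, z)\<close> for the Lyapunov exponent of the complex cocycle \<open>x \<mapsto> A\<^sub>s(x + z w)\<close>. Since Lebesgue measure on the
torus is translation invariant, \<open>L(s, z)\<close> depends on \<open>z\<close> only through its imaginary part.

Monotonicity says that the real cocycle turns every real direction to the left as \<open>t\<close> grows. Hence
for small \<open>e > 0\<close> the cocycle at \<open>z = i e\<close> maps the upper half plane of the complex projective line
strictly into itself, up to the change of coordinates \<open>B + i e \<partial>\<^sub>w B\<close>; here \<open>B\<close> is the conjugacy of
the premonotonic cocycle, which enters only through this first-order extension, so class \<open>C\<^sup>1\<close> is enough
for it. In terms of the Hermitian form \<open>Q(v) = Im (cnj v\<^sub>1 v\<^sub>2)\<close>, \<open>cone_form\<close> below, this
is the inequality of \<open>uniform_cone_contraction\<close>, and it holds for all \<open>s\<close> near \<open>s\<^sub>0\<close> and all small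
\<open>e > 0\<close>. It is an open condition, so it persists when \<open>s\<close> and \<open>z\<close> become complex.

Where the cone \<open>Q \<ge> 0\<close> is invariant, the functional \<open>l(v) = v\<^sub>1 - i v\<^sub>2\<close> has no zero on it, and the norm
of a long product \<open>M\<close> is comparable to \<open>|l(M y)|\<close> for any fixed interior vector \<open>y\<close> of the cone. But
\<open>ln |l(M y)|\<close> is the real part of a holomorphic function of the parameters. Averaging over the torus
and passing to the limit (Montel) shows that \<open>L\<close> is the real part of a holomorphic function of \<open>s\<close>, and
also of \<open>z\<close>, wherever the cone is contracted (\<open>lyapunov_harmonic_near_cone_contraction\<close>). As \<open>L\<close>
depends only on \<open>Im z = e\<close>, it follows that \<open>L = a(s) + c(s) e\<close> for small \<open>e > 0\<close>.

It remains to reach \<open>e = 0\<close> (\<open>lyapunov_at_boundary\<close>). By subadditivity the exponent is an infimum of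
functions that are continuous in \<open>z\<close>, so \<open>a(s) \<le> L(s, 0)\<close>. The logarithm of the norm of a holomorphic
matrix function has the sub-mean value property, and \<open>L\<close> is even in \<open>e\<close>, so \<open>L(s, 0)\<close> is at most the
mean of \<open>a(s) + c(s) |e|\<close> over small circles, whence \<open>L(s, 0) \<le> a(s)\<close>. Therefore
\<open>L(s, 0) = 2 L(s, i e) - L(s, 2 i e)\<close> for one fixed \<open>e > 0\<close>, and the right-hand side is real-analytic
in \<open>s\<close>.
\<close>

no_notation fps_nth (infixl \<open>$\<close> 75)

section \<open>Subadditive sequences and integrals over the torus\<close>

text \<open>
Fekete's lemma, for nonnegative sequences.
\<close>

lemma subadditive_mean_converges:
  fixes a :: "nat \<Rightarrow> real"
  assumes sub: "\<And>m n. a (m + n) \<le> a m + a n" and nonneg: "\<And>n. 0 \<le> a n"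
  shows "\<exists>L. (\<lambda>n. a n / real n) \<longlonglongrightarrow> L \<and> (\<forall>n\<ge>1. L \<le> a n / real n)"
proof -
  define S where "S = (\<lambda>n. a n / real n) ` {1..}"
  define L where "L = Inf S"
  have bdd: "bdd_below S" unfolding S_def by (rule bdd_belowI[of _ 0]) (auto simp: nonneg)
  have S_ne: "S \<noteq> {}" by (auto simp: S_def)
  have le: "L \<le> a n / real n" if "n \<ge> 1" for n
    unfolding L_def using bdd that by (intro cInf_lower) (auto simp: S_def)
  have mult: "a (q * m) \<le> real q * a m" if "q \<ge> 1" for q m
    using that
  proof (induction q rule: dec_induct)
    case (step q)
    have "a (Suc q * m) \<le> a m + a (q * m)" using sub[of m "q * m"] by simp
    then show ?case using step by (simp add: algebra_simps)
  qed simp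
  have "(\<lambda>n. a n / real n) \<longlonglongrightarrow> L"
  proof (rule LIMSEQ_I)
    fix e :: real assume "e > 0"
    then have "Inf S < L + e / 2" by (simp add: L_def)
    then obtain y where y: "y \<in> S" "y < L + e / 2" using cInf_lessD[OF S_ne] by blast
    then obtain m where m: "m \<ge> 1" "a m / real m < L + e / 2" by (auto simp: S_def)
    define C where "C = a m + (\<Sum>r<m. a r)"
    have C0: "C \<ge> 0" unfolding C_def by (intro add_nonneg_nonneg sum_nonneg nonneg)
    obtain N where N: "real N > 2 * C / e" using reals_Archimedean2 by blast
    show "\<exists>no. \<forall>n\<ge>no. norm (a n / real n - L) < e"
    proof (intro exI[of _ "max N 1"] allI impI)
      fix n assume n: "max N 1 \<le> n"
      define q where "q = n div m"
      define r where "r = n mod m"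
      have nqr: "n = q * m + r" by (simp add: q_def r_def)
      have rm: "r < m" using m by (simp add: r_def)
      have ar: "a r \<le> (\<Sum>r<m. a r)" using rm nonneg by (intro member_le_sum) auto
      have "a n \<le> real q * a m + C"
      proof (cases "q = 0")
        case True
        then show ?thesis using nqr ar nonneg[of m] by (simp add: C_def)
      next
        case False
        then show ?thesis using sub[of "q * m" r] mult[of q m] ar nonneg[of m] nqr by (simp add: C_def)
      qed
      also have "real q * a m = real (q * m) * (a m / real m)" using m by simp
      also have "\<dots> \<le> real n * (a m / real m)"
        using nqr nonneg m by (intro mult_right_mono) auto
      finally have "a n / real n \<le> a m / real m + C / real n"
        using n by (simp add: field_simps)
      moreover have "C / real n < e / 2"
      proof -
        have "2 * C / e < real n" using N n by linarith
        then show ?thesis using \<open>e > 0\<close> n by (simp add: field_simps)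
      qed
      ultimately have "a n / real n < L + e" using m(2) by linarith
      moreover have "L \<le> a n / real n" using le n by simp
      ultimately show "norm (a n / real n - L) < e" by simp
    qed
  qed
  with le show ?thesis by blast
qed

lemma countable_integer_vectors: "countable {k :: real ^ 'n. \<forall>i. k $ i \<in> \<int>}"
proof -
  have "{k :: real ^ 'n. \<forall>i. k $ i \<in> \<int>} \<subseteq> vec_lambda ` {f. \<forall>i. f i \<in> \<int>}"
    by (auto intro!: image_eqI[where x="vec_nth _"])
  moreover have "countable {f :: 'n \<Rightarrow> real. \<forall>i. f i \<in> \<int>}"
  proof -
    have "countable (PiE (UNIV :: 'n set) (\<lambda>_. \<int> :: real set))"
      by (intro countable_PiE) (auto simp: countable_int)
    then show ?thesis by (simp add: PiE_UNIV_domain Pi_def)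
  qed
  ultimately show ?thesis using countable_subset by blast
qed

text \<open>
The integer translates of the half-open unit cube tile the space. Splitting the integral over the
cube according to the tile that contains \<open>x + v\<close>, translating each piece back, and summing over the tiles
gives the integral of \<open>f\<close> itself, by periodicity.
\<close>

lemma torus_integral_translate:
  fixes f :: "real ^ 'n \<Rightarrow> real"
  assumes cont: "continuous_on UNIV f" and per: "torus_periodic f" and nonneg: "\<And>x. 0 \<le> f x"
  shows "integral (cbox 0 1) (\<lambda>x. f (x + v)) = integral (cbox 0 1) f"
proof -
  define H :: "(real ^ 'n) set" where "H = {x. \<forall>i. 0 \<le> x $ i \<and> x $ i < 1}"
  define Z where "Z = {k :: real ^ 'n. \<forall>i. k $ i \<in> \<int>}"
  have Zc: "countable Z" unfolding Z_def by (rule countable_integer_vectors)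
  have Hm [measurable]: "H \<in> sets borel" unfolding H_def by measurable
  have fm [measurable]: "f \<in> borel_measurable borel" using cont by (rule borel_measurable_continuous_onI)
  have tile: "\<exists>!k. k \<in> Z \<and> y + k \<in> H" for y :: "real ^ 'n"
  proof (rule ex1I[of _ "\<chi> i. - real_of_int \<lfloor>y $ i\<rfloor>"])
    show "(\<chi> i. - real_of_int \<lfloor>y $ i\<rfloor>) \<in> Z \<and> y + (\<chi> i. - real_of_int \<lfloor>y $ i\<rfloor>) \<in> H"
      by (auto simp: Z_def H_def) linarith
  next
    fix k assume k: "k \<in> Z \<and> y + k \<in> H"
    have "k $ i = - real_of_int \<lfloor>y $ i\<rfloor>" for i
    proof -
      obtain j where j: "k $ i = real_of_int j" using k by (auto simp: Z_def elim: Ints_cases)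
      have "0 \<le> y $ i + real_of_int j" "y $ i + real_of_int j < 1"
        using k unfolding H_def j[symmetric] by auto
      then have "\<lfloor>y $ i\<rfloor> = - j" by linarith
      then show ?thesis using j by simp
    qed
    then show "k = (\<chi> i. - real_of_int \<lfloor>y $ i\<rfloor>)" by (simp add: vec_eq_iff)
  qed
  have one: "(\<integral>\<^sup>+k. indicator H (y + k) \<partial>count_space Z) = (1 :: ennreal)" for y :: "real ^ 'n"
  proof -
    obtain k where k: "k \<in> Z" "y + k \<in> H" and uniq: "\<And>k'. k' \<in> Z \<Longrightarrow> y + k' \<in> H \<Longrightarrow> k' = k"
      using tile[of y] by blast
    have iff: "y + k' \<in> H \<longleftrightarrow> k' = k" if "k' \<in> Z" for k' using k uniq that by blast
    have "(\<integral>\<^sup>+k'. indicator H (y + k') \<partial>count_space Z) = (\<integral>\<^sup>+k'. indicator {k} k' \<partial>count_space Z)"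
      by (intro nn_integral_cong) (simp add: indicator_def iff)
    also have "\<dots> = 1" using k by simp
    finally show ?thesis .
  qed
  have Zneg: "- k \<in> Z" if "k \<in> Z" for k using that by (auto simp: Z_def)
  \<comment> \<open>insert the sum over all tiles, substitute \<open>y = x + v + k\<close> in each term, and collapse the sum again\<close>
  have inv: "(\<integral>\<^sup>+x. indicator H x * ennreal (f (x + v)) \<partial>lborel) =
        (\<integral>\<^sup>+x. indicator H x * ennreal (f x) \<partial>lborel)"
  proof -
    have "(\<integral>\<^sup>+x. indicator H x * ennreal (f (x + v)) \<partial>lborel) =
       (\<integral>\<^sup>+x. (\<integral>\<^sup>+k. indicator H x * ennreal (f (x + v)) * indicator H (x + v + k) \<partial>count_space Z) \<partial>lborel)"
      by (simp add: nn_integral_cmult one)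
    also have "\<dots> = (\<integral>\<^sup>+k. (\<integral>\<^sup>+x. indicator H x * ennreal (f (x + v)) * indicator H (x + v + k) \<partial>lborel) \<partial>count_space Z)"
      by (rule nn_integral_count_space_nn_integral[OF Zc]) measurable
    also have "\<dots> = (\<integral>\<^sup>+k. (\<integral>\<^sup>+y. indicator H y * ennreal (f y) * indicator H (y + - v - k) \<partial>lborel) \<partial>count_space Z)"
    proof (rule nn_integral_cong)
      fix k assume "k \<in> space (count_space Z)"
      then have k: "k \<in> Z" by simp
      have "(\<integral>\<^sup>+y. indicator H y * ennreal (f y) * indicator H (y + - v - k) \<partial>lborel) =
         (\<integral>\<^sup>+y. indicator H y * ennreal (f y) * indicator H (y + - v - k) \<partial>distr lborel borel ((+) (v + k)))"
        by (simp add: lborel_distr_plus)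
      also have "\<dots> = (\<integral>\<^sup>+x. indicator H (v + k + x) * ennreal (f (v + k + x)) * indicator H (v + k + x + - v - k) \<partial>lborel)"
        by (subst nn_integral_distr) auto
      also have "\<dots> = (\<integral>\<^sup>+x. indicator H x * ennreal (f (x + v)) * indicator H (x + v + k) \<partial>lborel)"
      proof (rule nn_integral_cong)
        fix x :: "real ^ 'n"
        have e: "v + k + x = x + v + k" "x + v + k + - v - k = x" by (simp_all add: algebra_simps)
        have "f (x + v + k) = f (x + v)" using per k unfolding torus_periodic_def Z_def by blast
        then show "indicator H (v + k + x) * ennreal (f (v + k + x)) * indicator H (v + k + x + - v - k) =
          indicator H x * ennreal (f (x + v)) * indicator H (x + v + k)"
          unfolding e by (simp add: mult_ac)
      qed
      finally show "(\<integral>\<^sup>+x. indicator H x * ennreal (f (x + v)) * indicator H (x + v + k) \<partial>lborel) =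
        (\<integral>\<^sup>+y. indicator H y * ennreal (f y) * indicator H (y + - v - k) \<partial>lborel)" by simp
    qed
    also have "\<dots> = (\<integral>\<^sup>+y. (\<integral>\<^sup>+k. indicator H y * ennreal (f y) * indicator H (y + - v - k) \<partial>count_space Z) \<partial>lborel)"
      by (rule nn_integral_count_space_nn_integral[OF Zc, symmetric]) measurable
    also have "\<dots> = (\<integral>\<^sup>+y. indicator H y * ennreal (f y) \<partial>lborel)"
    proof (rule nn_integral_cong)
      fix y :: "real ^ 'n"
      have bij: "bij_betw uminus Z Z"
        by (rule bij_betwI[where g=uminus]) (auto simp: Zneg)
      have "(\<integral>\<^sup>+k. indicator H (y + - v - k) \<partial>count_space Z) = (\<integral>\<^sup>+k. indicator H (y + - v + k) \<partial>count_space Z)"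
        using nn_integral_bij_count_space[OF bij, of "\<lambda>k. indicator H (y + - v + k)"] by simp
      also have "\<dots> = 1" using one[of "y + - v"] by simp
      finally show "(\<integral>\<^sup>+k. indicator H y * ennreal (f y) * indicator H (y + - v - k) \<partial>count_space Z) = indicator H y * ennreal (f y)"
        by (simp add: nn_integral_cmult)
    qed
    finally show ?thesis .
  qed
  have HK: "integral (cbox 0 1) g = enn2real (\<integral>\<^sup>+x. indicator H x * ennreal (g x) \<partial>lborel)"
    if g: "continuous_on UNIV g" and g0: "\<And>x. 0 \<le> g x" for g :: "real ^ 'n \<Rightarrow> real"
  proof -
    have [measurable]: "g \<in> borel_measurable borel" using g by (rule borel_measurable_continuous_onI)
    have "g integrable_on cbox 0 1"
      using g by (intro integrable_continuous continuous_on_subset[OF g]) auto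
    then have hi: "(g has_integral integral (cbox 0 1) g) (cbox 0 1)" by (rule integrable_integral)
    have boxH: "box 0 1 \<subseteq> H" "H \<subseteq> cbox 0 1"
      by (auto simp: H_def mem_box_cart less_imp_le)
    have neg: "negligible (cbox 0 (1 :: real ^ 'n) - box 0 1)" by (rule negligible_frontier_interval)
    have "(g has_integral integral (cbox 0 1) g) H"
    proof (rule has_integral_spike_set_eq[THEN iffD1, OF _ _ hi])
      show "negligible {x \<in> cbox 0 1 - H. g x \<noteq> 0}"
        by (rule negligible_subset[OF neg]) (use boxH in auto)
      show "negligible {x \<in> H - cbox 0 1. g x \<noteq> 0}"
        by (rule negligible_subset[OF neg]) (use boxH in auto)
    qed
    then have "((\<lambda>x. if x \<in> H then g x else 0) has_integral integral (cbox 0 1) g) UNIV"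
      by (simp only: has_integral_restrict_UNIV)
    then have 1: "((\<lambda>x. indicator H x * g x) has_integral integral (cbox 0 1) g) UNIV"
      by (rule has_integral_eq[rotated]) (auto simp: indicator_def)
    have 0: "0 \<le> integral (cbox 0 1) g" by (rule integral_nonneg) (use g0 in \<open>auto intro: \<open>g integrable_on cbox 0 1\<close>\<close>)
    have "(\<integral>\<^sup>+x. ennreal (indicator H x * g x) \<partial>lborel) = ennreal (integral (cbox 0 1) g)"
      by (rule nn_integral_has_integral_lborel[OF _ _ 1]) (use g0 in \<open>auto simp: indicator_def\<close>)
    moreover have "(\<integral>\<^sup>+x. ennreal (indicator H x * g x) \<partial>lborel) = (\<integral>\<^sup>+x. indicator H x * ennreal (g x) \<partial>lborel)"
      by (intro nn_integral_cong) (auto simp: indicator_def)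
    ultimately show ?thesis using 0 by simp
  qed
  have "continuous_on UNIV (\<lambda>x. f (x + v))"
    by (rule continuous_on_compose2[OF cont]) (auto intro!: continuous_intros)
  then show ?thesis using HK[of "\<lambda>x. f (x + v)"] HK[of f] cont nonneg inv by simp
qed

section \<open>Complex cocycles and their Lyapunov exponent\<close>

lemma norm_complex_vec2: "(norm (v :: complex ^ 2))\<^sup>2 = (cmod (v $ 1))\<^sup>2 + (cmod (v $ 2))\<^sup>2"
  by (simp add: norm_vec_def L2_set_def sum_2)

lemma norm_complex_mat2:
  "(norm (M :: complex ^ 2 ^ 2))\<^sup>2 =
     (cmod (M $ 1 $ 1))\<^sup>2 + (cmod (M $ 1 $ 2))\<^sup>2 + (cmod (M $ 2 $ 1))\<^sup>2 + (cmod (M $ 2 $ 2))\<^sup>2"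
proof -
  have "(norm M)\<^sup>2 = (norm (M $ 1))\<^sup>2 + (norm (M $ 2))\<^sup>2"
    by (simp add: norm_vec_def[of M] L2_set_def sum_2)
  then show ?thesis by (simp add: norm_complex_vec2)
qed

lemma matrix_mult_entry2: "((A :: 'a::semiring_1 ^ 2 ^ 2) ** (B :: 'a ^ 2 ^ 2)) $ i $ j = A $ i $ 1 * B $ 1 $ j + A $ i $ 2 * B $ 2 $ j"
  by (simp add: matrix_matrix_mult_def sum_2)

lemma matrix_vector_entry2: "((A :: 'a::semiring_1 ^ 2 ^ 2) *v v) $ i = A $ i $ 1 * v $ 1 + A $ i $ 2 * v $ 2"
  by (simp add: matrix_vector_mult_def sum_2)

lemma cmod_dot2_le:
  "(cmod (a * c + b * d))\<^sup>2 \<le> ((cmod a)\<^sup>2 + (cmod b)\<^sup>2) * ((cmod c)\<^sup>2 + (cmod d)\<^sup>2)"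
proof -
  have "(cmod (a * c + b * d))\<^sup>2 \<le> (cmod a * cmod c + cmod b * cmod d)\<^sup>2"
    by (intro power_mono) (auto intro!: norm_triangle_le simp: norm_mult)
  also have "\<dots> \<le> ((cmod a)\<^sup>2 + (cmod b)\<^sup>2) * ((cmod c)\<^sup>2 + (cmod d)\<^sup>2)"
    using zero_le_power2[of "cmod a * cmod d - cmod b * cmod c"]
    by (simp add: power2_eq_square algebra_simps)
  finally show ?thesis .
qed

text \<open>
The norm on the type of matrices is the Frobenius norm. It is submultiplicative by the Cauchy-Schwarz
inequality; exponential growth rates do not depend on the choice of norm.
\<close>

lemma norm_matrix_mult_le: "norm ((A :: complex ^ 2 ^ 2) ** (B :: complex ^ 2 ^ 2)) \<le> norm A * norm B"
proof -
  have "(norm (A ** B))\<^sup>2 \<le> (norm A * norm B)\<^sup>2"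
    unfolding power_mult_distrib norm_complex_mat2 matrix_mult_entry2
    using cmod_dot2_le[of "A$1$1" "B$1$1" "A$1$2" "B$2$1"] cmod_dot2_le[of "A$1$1" "B$1$2" "A$1$2" "B$2$2"]
      cmod_dot2_le[of "A$2$1" "B$1$1" "A$2$2" "B$2$1"] cmod_dot2_le[of "A$2$1" "B$1$2" "A$2$2" "B$2$2"]
    by (simp add: algebra_simps)
  then show ?thesis by (rule power2_le_imp_le) auto
qed

lemma norm_matrix_vector_le: "norm ((A :: complex ^ 2 ^ 2) *v v) \<le> norm A * norm v"
proof -
  have "(norm (A *v v))\<^sup>2 \<le> (norm A * norm v)\<^sup>2"
    unfolding power_mult_distrib norm_complex_mat2 norm_complex_vec2 matrix_vector_entry2
    using cmod_dot2_le[of "A$1$1" "v$1" "A$1$2" "v$2"] cmod_dot2_le[of "A$2$1" "v$1" "A$2$2" "v$2"]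
    by (simp add: algebra_simps)
  then show ?thesis by (rule power2_le_imp_le) auto
qed

lemma norm_ge_1_if_det_1:
  assumes "det (M :: complex ^ 2 ^ 2) = 1"
  shows "1 \<le> norm M"
proof -
  have "1 = cmod (M$1$1 * M$2$2 - M$1$2 * M$2$1)" using assms by (simp add: det_2)
  also have "\<dots> \<le> cmod (M$1$1) * cmod (M$2$2) + cmod (M$1$2) * cmod (M$2$1)"
    using norm_triangle_ineq4[of "M$1$1 * M$2$2" "M$1$2 * M$2$1"] by (simp add: norm_mult)
  also have "\<dots> \<le> (norm M)\<^sup>2"
  proof -
    have "x * y \<le> x\<^sup>2 + y\<^sup>2" if "0 \<le> x" "0 \<le> y" for x y :: real
      using sum_squares_bound[of x y] mult_nonneg_nonneg[OF that] by linarith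
    from this[of "cmod (M$1$1)" "cmod (M$2$2)"] this[of "cmod (M$1$2)" "cmod (M$2$1)"]
    show ?thesis unfolding norm_complex_mat2 by simp
  qed
  finally have "1\<^sup>2 \<le> (norm M)\<^sup>2" by simp
  then show ?thesis by (rule power2_le_imp_le) simp
qed

lemma continuous_on_matrix_mult2 [continuous_intros]:
  fixes f g :: "'a::topological_space \<Rightarrow> 'b::real_normed_algebra_1 ^ 2 ^ 2"
  assumes "continuous_on S f" "continuous_on S g"
  shows "continuous_on S (\<lambda>x. f x ** g x)"
  unfolding matrix_matrix_mult_def sum_2
  by (intro continuous_on_vec_lambda continuous_intros assms)

lemma continuous_on_matrix_vector2 [continuous_intros]:
  fixes f :: "'a::topological_space \<Rightarrow> 'b::real_normed_algebra_1 ^ 2 ^ 2"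
  assumes "continuous_on S f" "continuous_on S g"
  shows "continuous_on S (\<lambda>x. f x *v g x)"
  unfolding matrix_vector_mult_def sum_2
  by (intro continuous_on_vec_lambda continuous_intros assms)

primrec complex_iter ::
    "real ^ 'n \<Rightarrow> (real ^ 'n \<Rightarrow> complex ^ 2 ^ 2) \<Rightarrow> nat \<Rightarrow> real ^ 'n \<Rightarrow> complex ^ 2 ^ 2" where
  "complex_iter \<alpha> F 0 x = mat 1"
| "complex_iter \<alpha> F (Suc n) x = F (x + real n *\<^sub>R \<alpha>) ** complex_iter \<alpha> F n x"

definition mean_log_norm :: "real ^ 'n \<Rightarrow> (real ^ 'n \<Rightarrow> complex ^ 2 ^ 2) \<Rightarrow> nat \<Rightarrow> real" where
  "mean_log_norm \<alpha> F N = integral (cbox 0 1) (\<lambda>x. ln (norm (complex_iter \<alpha> F N x))) / real N"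

definition complex_lyapunov :: "real ^ 'n \<Rightarrow> (real ^ 'n \<Rightarrow> complex ^ 2 ^ 2) \<Rightarrow> real" where
  "complex_lyapunov \<alpha> F = lim (mean_log_norm \<alpha> F)"

text \<open>
The base point stays real throughout; analyticity enters through parameters on which the cocycle depends.
\<close>

definition torus_cocycle :: "(real ^ 'n \<Rightarrow> complex ^ 2 ^ 2) \<Rightarrow> bool" where
  "torus_cocycle F \<longleftrightarrow> continuous_on UNIV F \<and> torus_periodic F \<and> (\<forall>x. det (F x) = 1)"

lemma complex_iter_add:
  "complex_iter \<alpha> F (m + n) x = complex_iter \<alpha> F m (x + real n *\<^sub>R \<alpha>) ** complex_iter \<alpha> F n x"
  by (induction m) (auto simp: matrix_mul_assoc algebra_simps)

lemma complex_iter_translate: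
  "complex_iter \<alpha> F n (x + v) = complex_iter \<alpha> (\<lambda>x. F (x + v)) n x"
  by (induction n) (auto simp: algebra_simps)

lemma complex_iter_continuous:
  assumes "continuous_on (S \<times> UNIV) (\<lambda>(p, x). F p x)"
  shows "continuous_on (S \<times> UNIV) (\<lambda>(p, x). complex_iter \<alpha> (F p) n x)"
proof (induction n)
  case 0
  then show ?case by (simp add: case_prod_beta)
next
  case (Suc n)
  have "continuous_on (S \<times> UNIV) (\<lambda>q. (\<lambda>(p, x). F p x) (fst q, snd q + real n *\<^sub>R \<alpha>))"
    by (rule continuous_on_compose2[OF assms]) (auto intro!: continuous_intros)
  then show ?case using Suc by (auto simp: case_prod_beta intro!: continuous_intros)
qed

lemma torus_cocycle_iter:
  assumes F: "torus_cocycle F"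
  shows "torus_cocycle (complex_iter \<alpha> F n)"
proof -
  have per: "F (x + k) = F x" if "\<forall>i. k $ i \<in> \<int>" for x k
    using F that by (auto simp: torus_cocycle_def torus_periodic_def)
  have "continuous_on (UNIV \<times> UNIV) (\<lambda>(p :: real, x). F x)"
    unfolding case_prod_beta
    by (rule continuous_on_compose2[of UNIV F]) (use F in \<open>auto simp: torus_cocycle_def intro!: continuous_intros\<close>)
  then have "continuous_on (UNIV \<times> UNIV) (\<lambda>(p :: real, x). complex_iter \<alpha> F n x)"
    by (rule complex_iter_continuous)
  then have "continuous_on UNIV (\<lambda>x. (\<lambda>(p :: real, x). complex_iter \<alpha> F n x) (0, x))"
    by (rule continuous_on_compose2) (auto intro!: continuous_intros)
  then have cont: "continuous_on UNIV (complex_iter \<alpha> F n)" by simp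
  have "complex_iter \<alpha> F n (x + k) = complex_iter \<alpha> F n x" if k: "\<forall>i. k $ i \<in> \<int>" for x k
  proof (induction n)
    case (Suc n)
    have "F (x + k + real n *\<^sub>R \<alpha>) = F (x + real n *\<^sub>R \<alpha>)"
      using per[OF k, of "x + real n *\<^sub>R \<alpha>"] by (simp add: algebra_simps)
    then show ?case using Suc by simp
  qed simp
  moreover have "det (complex_iter \<alpha> F n x) = 1" for x
    using F by (induction n) (auto simp: det_mul torus_cocycle_def)
  ultimately show ?thesis using cont by (simp add: torus_cocycle_def torus_periodic_def)
qed

lemma torus_cocycle_norm_ge_1: "torus_cocycle F \<Longrightarrow> 1 \<le> norm (complex_iter \<alpha> F n x)"
  using torus_cocycle_iter[of F \<alpha> n] norm_ge_1_if_det_1 by (auto simp: torus_cocycle_def)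

lemma continuous_log_norm_iter:
  assumes "torus_cocycle F"
  shows "continuous_on S (\<lambda>x. ln (norm (complex_iter \<alpha> F n x)))"
proof -
  have "continuous_on S (complex_iter \<alpha> F n)"
    using torus_cocycle_iter[OF assms, of \<alpha> n] by (auto simp: torus_cocycle_def intro: continuous_on_subset)
  moreover have "norm (complex_iter \<alpha> F n x) \<noteq> 0" for x
    using torus_cocycle_norm_ge_1[OF assms, of \<alpha> n x] by linarith
  ultimately show ?thesis by (auto intro!: continuous_intros)
qed

lemma mean_log_norm_nonneg:
  assumes "torus_cocycle F"
  shows "0 \<le> mean_log_norm \<alpha> F n"
  unfolding mean_log_norm_def
  by (intro divide_nonneg_nonneg Henstock_Kurzweil_Integration.integral_nonneg integrable_continuous
        continuous_log_norm_iter assms)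
     (use torus_cocycle_norm_ge_1[OF assms] in auto)

text \<open>
The logarithms of the norms of the iterates, integrated over the torus, are subadditive because the
norm is submultiplicative and the integral is invariant under translation. The second part, that the
exponent is a lower bound of every finite mean, is what makes it upper semicontinuous in parameters.
\<close>

lemma complex_lyapunov_limit:
  assumes F: "torus_cocycle F"
  shows "mean_log_norm \<alpha> F \<longlonglongrightarrow> complex_lyapunov \<alpha> F"
    and "\<And>N. N \<ge> 1 \<Longrightarrow> complex_lyapunov \<alpha> F \<le> mean_log_norm \<alpha> F N"
proof -
  define a where "a = (\<lambda>n. integral (cbox 0 1) (\<lambda>x. ln (norm (complex_iter \<alpha> F n x))))"
  have mln: "mean_log_norm \<alpha> F = (\<lambda>n. a n / real n)" by (simp add: mean_log_norm_def a_def fun_eq_iff)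
  note ge1 = torus_cocycle_norm_ge_1[OF F, of \<alpha>]
  note cont = continuous_log_norm_iter[OF F, of _ \<alpha>]
  have "\<exists>L. (\<lambda>n. a n / real n) \<longlonglongrightarrow> L \<and> (\<forall>n\<ge>1. L \<le> a n / real n)"
  proof (rule subadditive_mean_converges)
    fix m n
    have shift: "integral (cbox 0 1) (\<lambda>x. ln (norm (complex_iter \<alpha> F m (x + real n *\<^sub>R \<alpha>)))) = a m"
      unfolding a_def
      using torus_cocycle_iter[OF F, of \<alpha> m] ge1
      by (intro torus_integral_translate cont) (auto simp: torus_cocycle_def torus_periodic_def)
    have cont_shift: "continuous_on (cbox 0 1) (\<lambda>x. ln (norm (complex_iter \<alpha> F m (x + real n *\<^sub>R \<alpha>))))"
      by (rule continuous_on_compose2[OF cont[where S=UNIV and n=m]]) (auto intro!: continuous_intros)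
    have "a (m + n) \<le> integral (cbox 0 1) (\<lambda>x. ln (norm (complex_iter \<alpha> F m (x + real n *\<^sub>R \<alpha>))) + ln (norm (complex_iter \<alpha> F n x)))"
      unfolding a_def
    proof (rule integral_le)
      fix x
      have pos: "0 < norm (complex_iter \<alpha> F k y)" for k y using ge1[of k y] by linarith
      have "ln (norm (complex_iter \<alpha> F (m + n) x)) \<le> ln (norm (complex_iter \<alpha> F m (x + real n *\<^sub>R \<alpha>)) * norm (complex_iter \<alpha> F n x))"
        using pos[of "m + n" x] pos[of m] pos[of n x] norm_matrix_mult_le unfolding complex_iter_add
        by (intro ln_mono) (auto intro!: mult_pos_pos)
      then show "ln (norm (complex_iter \<alpha> F (m + n) x)) \<le> ln (norm (complex_iter \<alpha> F m (x + real n *\<^sub>R \<alpha>))) + ln (norm (complex_iter \<alpha> F n x))"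
        using pos by (simp add: ln_mult less_imp_neq[symmetric])
    qed (auto intro!: integrable_continuous cont cont_shift continuous_on_add)
    also have "\<dots> = a m + a n"
      using integral_add[OF integrable_continuous[OF cont_shift] integrable_continuous[OF cont[where n=n]]] shift
      by (simp add: a_def)
    finally show "a (m + n) \<le> a m + a n" .
  next
    show "0 \<le> a n" for n
      unfolding a_def
      by (intro Henstock_Kurzweil_Integration.integral_nonneg integrable_continuous cont) (use ge1 in auto)
  qed
  then obtain L where L: "(\<lambda>n. a n / real n) \<longlonglongrightarrow> L" "\<forall>n\<ge>1. L \<le> a n / real n" by blast
  then have "complex_lyapunov \<alpha> F = L" by (simp add: complex_lyapunov_def mln limI)
  then show "mean_log_norm \<alpha> F \<longlonglongrightarrow> complex_lyapunov \<alpha> F"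
    "\<And>N. N \<ge> 1 \<Longrightarrow> complex_lyapunov \<alpha> F \<le> mean_log_norm \<alpha> F N"
    using L by (auto simp: mln)
qed

lemma complex_lyapunov_translate:
  assumes F: "torus_cocycle F"
  shows "mean_log_norm \<alpha> (\<lambda>x. F (x + v)) = mean_log_norm \<alpha> F"
    and "complex_lyapunov \<alpha> (\<lambda>x. F (x + v)) = complex_lyapunov \<alpha> F"
proof -
  have "integral (cbox 0 1) (\<lambda>x. ln (norm (complex_iter \<alpha> F N (x + v)))) = integral (cbox 0 1) (\<lambda>x. ln (norm (complex_iter \<alpha> F N x)))" for N
    using torus_cocycle_iter[OF F, of \<alpha> N] torus_cocycle_norm_ge_1[OF F, of \<alpha> N]
    by (intro torus_integral_translate continuous_log_norm_iter F) (auto simp: torus_cocycle_def torus_periodic_def)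
  then show *: "mean_log_norm \<alpha> (\<lambda>x. F (x + v)) = mean_log_norm \<alpha> F"
    unfolding mean_log_norm_def complex_iter_translate[symmetric] by simp
  then show "complex_lyapunov \<alpha> (\<lambda>x. F (x + v)) = complex_lyapunov \<alpha> F"
    by (simp add: complex_lyapunov_def)
qed

section \<open>Averages and limits of real parts of holomorphic functions\<close>

text \<open>
The map \<open>u \<mapsto> u / (2 M - u)\<close> sends the half plane \<open>Re u < M\<close> into the unit disc and fixes \<open>0\<close>, so
Schwarz's lemma applies to its composition with the rescaled \<open>f\<close>.
\<close>

lemma Borel_Caratheodory_at_zero:
  fixes f :: "complex \<Rightarrow> complex"
  assumes hol: "f holomorphic_on ball 0 R" and f0: "f 0 = 0"
    and Re_less: "\<And>z. z \<in> ball 0 R \<Longrightarrow> Re (f z) < M"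
    and z: "norm z \<le> r" and r: "0 < r" "r < R"
  shows "norm (f z) \<le> 2 * M * r / (R - r)"
proof -
  have R: "R > 0" using r by simp
  have M: "M > 0" using Re_less[of 0] f0 R by simp
  define g where "g = (\<lambda>w. f (of_real R * w))"
  define h where "h = (\<lambda>w. g w / (2 * of_real M - g w))"
  have inR: "of_real R * w \<in> ball (0 :: complex) R" if "norm w < 1" for w :: complex
    using that R by (simp add: norm_mult)
  have Reg: "Re (g w) < M" if "norm w < 1" for w using Re_less inR[OF that] by (simp add: g_def)
  have nz: "2 * of_real M - g w \<noteq> 0" if "norm w < 1" for w
  proof
    assume "2 * of_real M - g w = 0"
    then have "Re (g w) = 2 * M" by (simp add: complex_eq_iff)
    then show False using Reg[OF that] M by simp
  qed
  have holg: "g holomorphic_on ball 0 1"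
    unfolding g_def
    by (rule holomorphic_on_compose_gen[OF _ hol, unfolded o_def])
       (auto intro!: holomorphic_intros simp: inR[unfolded mem_ball dist_norm, simplified])
  have holh: "h holomorphic_on ball 0 1"
    unfolding h_def using nz by (intro holomorphic_intros holg) auto
  have small: "norm (h w) < 1" if "norm w < 1" for w
  proof -
    have "(norm (2 * of_real M - g w))\<^sup>2 - (norm (g w))\<^sup>2 = 4 * M * (M - Re (g w))"
      unfolding cmod_power2 by (simp add: power2_eq_square algebra_simps)
    then have "(norm (g w))\<^sup>2 < (norm (2 * of_real M - g w))\<^sup>2"
      using M Reg[OF that] by (smt (verit) mult_pos_pos)
    then have "norm (g w) < norm (2 * of_real M - g w)"
      using power_less_imp_less_base norm_ge_zero by blast
    then show ?thesis using nz[OF that] by (simp add: h_def norm_divide)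
  qed
  define w where "w = z / of_real R"
  have nw: "norm w \<le> r / R" using z R by (simp add: w_def norm_divide divide_right_mono)
  have rR: "r / R < 1" using r by simp
  have w1: "norm w < 1" using nw rR by simp
  have "norm (h w) \<le> norm w"
    by (rule Schwarz_Lemma(1)[OF holh _ small w1]) (auto simp: h_def g_def f0)
  then have hw: "norm (h w) \<le> r / R" using nw by simp
  have gz: "g w = f z" using R by (simp add: g_def w_def)
  have "g w * (1 + h w) = 2 * of_real M * h w"
    using nz[OF w1] by (simp add: h_def field_simps)
  moreover have "1 - r / R \<le> norm (1 + h w)"
    using norm_triangle_ineq4[of "1 + h w" "h w"] hw by simp
  ultimately have "norm (g w) * (1 - r / R) \<le> 2 * M * (r / R)"
  proof -
    have "norm (g w) * (1 - r / R) \<le> norm (g w) * norm (1 + h w)"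
      using \<open>1 - r / R \<le> norm (1 + h w)\<close> by (intro mult_left_mono) auto
    also have "\<dots> = 2 * M * norm (h w)"
      using \<open>g w * (1 + h w) = 2 * of_real M * h w\<close> M
      by (metis norm_mult norm_of_real norm_numeral abs_of_pos)
    also have "\<dots> \<le> 2 * M * (r / R)" using hw M by (intro mult_left_mono) auto
    finally show ?thesis .
  qed
  then have "(norm (f z) * (R - r)) / R \<le> (2 * M * r) / R"
    using R gz by (simp add: diff_divide_distrib right_diff_distrib)
  then have "norm (f z) * (R - r) \<le> 2 * M * r" using R by (simp add: divide_le_cancel)
  then show ?thesis using r by (simp add: pos_le_divide_eq)
qed

text \<open>
The Borel-Caratheodory inequality for \<open>g - g z0\<close>. The imaginary constant has to be removed because a bound on
the real part says nothing about it.
\<close>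

lemma bounded_Re_normalized_bound:
  fixes g :: "complex \<Rightarrow> complex"
  assumes hol: "g holomorphic_on ball z0 R"
    and Re_le: "\<And>z. z \<in> ball z0 R \<Longrightarrow> \<bar>Re (g z)\<bar> \<le> M"
    and z: "norm (z - z0) \<le> r" and r: "0 < r" "r < R"
  shows "norm (g z - \<i> * of_real (Im (g z0))) \<le> M + 2 * (2 * M + 1) * r / (R - r)"
proof -
  define f where "f = (\<lambda>w. g (z0 + w) - g z0)"
  have shift: "z0 + w \<in> ball z0 R" if "w \<in> ball 0 R" for w
    using that by (simp add: dist_norm)
  have "f holomorphic_on ball 0 R"
    unfolding f_def
    by (intro holomorphic_intros holomorphic_on_compose_gen[OF _ hol, unfolded o_def])
       (use shift in auto)
  moreover have "Re (f w) < 2 * M + 1" if "w \<in> ball 0 R" for w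
    using Re_le[OF shift[OF that]] Re_le[of z0] r by (simp add: f_def)
  ultimately have "norm (f (z - z0)) \<le> 2 * (2 * M + 1) * r / (R - r)"
    by (intro Borel_Caratheodory_at_zero[where f=f]) (use z r in \<open>auto simp: f_def\<close>)
  then have "norm (g z - g z0) \<le> 2 * (2 * M + 1) * r / (R - r)" by (simp add: f_def)
  moreover have "norm (of_real (Re (g z0)) :: complex) \<le> M" using Re_le[of z0] r by simp
  moreover have "g z - \<i> * of_real (Im (g z0)) = (g z - g z0) + of_real (Re (g z0))"
    by (simp add: complex_eq_iff)
  ultimately show ?thesis by (smt (verit) norm_triangle_ineq)
qed

text \<open>
After normalising imaginary parts the family is locally bounded, so Montel's theorem gives a
subsequence that converges to a holomorphic function; its real part must be the given pointwise limit.
\<close>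

lemma Re_holomorphic_pointwise_limit:
  fixes G :: "nat \<Rightarrow> complex \<Rightarrow> complex"
  assumes hol: "\<And>N. G N holomorphic_on ball z0 R"
    and Re_le: "\<And>N z. z \<in> ball z0 R \<Longrightarrow> \<bar>Re (G N z)\<bar> \<le> M"
    and lim: "\<And>z. z \<in> T \<Longrightarrow> (\<lambda>N. Re (G N z)) \<longlonglongrightarrow> u z"
    and T: "T \<subseteq> ball z0 R"
  shows "\<exists>g. g holomorphic_on ball z0 R \<and> (\<forall>z\<in>T. Re (g z) = u z)"
proof (cases "R > 0")
  case False
  then show ?thesis using T by (intro exI[of _ "\<lambda>_. 0"]) (auto simp: ball_empty)
next
  case R: True
  define F where "F = (\<lambda>N z. G N z - \<i> * of_real (Im (G N z0)))"
  obtain g r where g: "g holomorphic_on ball z0 R" and r: "strict_mono (r :: nat \<Rightarrow> nat)"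
    and conv: "\<And>x. x \<in> ball z0 R \<Longrightarrow> ((\<lambda>n. F (r n) x) \<longlongrightarrow> g x) sequentially"
  proof (rule Montel[of "ball z0 R" "range F" F])
    show "h holomorphic_on ball z0 R" if "h \<in> range F" for h
      using that by (auto simp: F_def intro!: holomorphic_intros hol)
    show "\<exists>B. \<forall>h\<in>range F. \<forall>z\<in>K. norm (h z) \<le> B" if K: "compact K" "K \<subseteq> ball z0 R" for K
    proof -
      obtain r where r: "0 < r" "r < R" "K \<subseteq> cball z0 r"
      proof (cases "K = {}")
        case True
        then show ?thesis using that[of "R / 2"] R by auto
      next
        case False
        obtain y where y: "y \<in> K" "\<And>z. z \<in> K \<Longrightarrow> dist z0 z \<le> dist z0 y"
          using distance_attains_sup[OF K(1) False, of z0] by blast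
        then have "dist z0 y < R" using K by auto
        have "2 * dist z0 z \<le> R + dist z0 y" if "z \<in> K" for z
          using y(2)[OF that] \<open>dist z0 y < R\<close> by linarith
        moreover have "0 < R + dist z0 y" using R zero_le_dist[of z0 y] by linarith
        ultimately show ?thesis using \<open>dist z0 y < R\<close>
          by (intro that[of "(dist z0 y + R) / 2"]) (auto simp: field_simps)
      qed
      show ?thesis
      proof (intro exI ballI)
        fix h z assume "h \<in> range F" "z \<in> K"
        then obtain N where "h = F N" by auto
        then show "norm (h z) \<le> M + 2 * (2 * M + 1) * r / (R - r)"
          using bounded_Re_normalized_bound[OF hol[of N] Re_le[of _ N] _ r(1,2), of z] r(3) \<open>z \<in> K\<close>
          by (auto simp: F_def dist_norm norm_minus_commute)
      qed
    qed
  qed auto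
  have "Re (g z) = u z" if z: "z \<in> T" for z
  proof (rule LIMSEQ_unique)
    have "(\<lambda>n. Re (F (r n) z)) \<longlonglongrightarrow> Re (g z)"
      using conv z T by (intro tendsto_Re) auto
    then show "(\<lambda>n. Re (G (r n) z)) \<longlonglongrightarrow> Re (g z)" by (simp add: F_def)
    show "(\<lambda>n. Re (G (r n) z)) \<longlonglongrightarrow> u z"
      using LIMSEQ_subseq_LIMSEQ[OF lim[OF z] r] by (simp add: o_def)
  qed
  then show ?thesis using g by blast
qed

lemma deriv_difference_quotient_sequence:
  fixes f :: "complex \<Rightarrow> complex"
  assumes "f holomorphic_on S" "open S" "z \<in> S" and d: "d \<noteq> 0"
  shows "(\<lambda>n. (f (z + d / of_nat (Suc n)) - f z) * of_nat (Suc n)) \<longlonglongrightarrow> d * deriv f z"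
proof -
  have "(f has_field_derivative deriv f z) (at z)"
    using assms holomorphic_derivI by blast
  then have lim: "((\<lambda>h. (f (z + h) - f z) / h) \<longlongrightarrow> deriv f z) (at 0)" by (simp add: DERIV_def)
  have "filterlim (\<lambda>n. d / of_nat (Suc n)) (at (0 :: complex)) sequentially"
  proof (rule filterlim_atI)
    have "(\<lambda>n. of_real (inverse (real (Suc n))) :: complex) \<longlonglongrightarrow> of_real 0"
      by (intro tendsto_of_real LIMSEQ_inverse_real_of_nat)
    then have "(\<lambda>n. d * inverse (of_nat (Suc n))) \<longlonglongrightarrow> d * 0"
      by (intro tendsto_mult tendsto_const) (simp del: of_nat_Suc)
    then show "(\<lambda>n. d / of_nat (Suc n)) \<longlonglongrightarrow> 0" by (simp add: divide_inverse)
  qed (use d in \<open>auto simp del: of_nat_Suc\<close>)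
  from filterlim_compose[OF lim this]
  have "(\<lambda>n. d * ((f (z + d / of_nat (Suc n)) - f z) / (d / of_nat (Suc n)))) \<longlonglongrightarrow> d * deriv f z"
    by (intro tendsto_mult tendsto_const) (simp add: o_def)
  moreover have "d * (w / (d / of_nat (Suc n))) = w * of_nat (Suc n)" for w n
    using d by simp
  ultimately show ?thesis by (simp only:)
qed

text \<open>
By the Cauchy-Riemann equations the derivative is determined by the real part alone: difference
quotients in the directions \<open>1\<close> and \<open>- i\<close> recover its real and its imaginary part.
\<close>

lemma deriv_in_parameter_measurable:
  fixes f :: "'a \<Rightarrow> complex \<Rightarrow> complex"
  assumes hol: "\<And>x. x \<in> space \<mu> \<Longrightarrow> f x holomorphic_on S" and S: "open S"
    and Re_meas: "\<And>z. z \<in> S \<Longrightarrow> (\<lambda>x. Re (f x z)) \<in> borel_measurable \<mu>"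
    and z: "z \<in> S"
  shows "(\<lambda>x. deriv (f x) z) \<in> borel_measurable \<mu>"
proof -
  have quot: "(\<lambda>x. Re (d * deriv (f x) z)) \<in> borel_measurable \<mu>" if d: "norm d = 1" for d
  proof -
    obtain e where e: "e > 0" "ball z e \<subseteq> S" using S z openE by blast
    define d' where "d' = of_real (e / 2) * d"
    have d': "d' \<noteq> 0" using e d by (auto simp: d'_def)
    have inS: "z + d' / of_nat (Suc n) \<in> S" for n
    proof -
      have "norm (d' / of_nat (Suc n)) = (e / 2) / real (Suc n)"
        using e d by (simp add: d'_def norm_divide norm_mult del: of_nat_Suc)
      also have "\<dots> \<le> e / 2" using e by (simp add: field_simps)
      finally have "norm (d' / of_nat (Suc n)) < e" using e by simp
      then show ?thesis using e(2) by (auto simp: dist_norm simp del: of_nat_Suc)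
    qed
    have "(\<lambda>x. Re (d' * deriv (f x) z)) \<in> borel_measurable \<mu>"
    proof (rule borel_measurable_LIMSEQ_real)
      show "(\<lambda>n. Re ((f x (z + d' / of_nat (Suc n)) - f x z) * of_nat (Suc n))) \<longlonglongrightarrow> Re (d' * deriv (f x) z)"
        if "x \<in> space \<mu>" for x
        by (intro tendsto_Re deriv_difference_quotient_sequence[OF hol[OF that] S z d'])
      show "(\<lambda>x. Re ((f x (z + d' / of_nat (Suc n)) - f x z) * of_nat (Suc n))) \<in> borel_measurable \<mu>" for n
      proof -
        have "Re (w * of_nat (Suc n)) = Re w * real (Suc n)" for w :: complex
          by (simp del: of_nat_Suc)
        then show ?thesis using Re_meas[OF inS[of n]] Re_meas[OF z] by (simp del: of_nat_Suc)
      qed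
    qed
    then have "(\<lambda>x. (2 / e) * Re (d' * deriv (f x) z)) \<in> borel_measurable \<mu>"
      by (rule borel_measurable_times[OF borel_measurable_const])
    moreover have "(2 / e) * Re (d' * w) = Re (d * w)" for w
      using e by (simp add: d'_def field_simps)
    ultimately show ?thesis by (simp only:)
  qed
  have "(\<lambda>x. Re (1 * deriv (f x) z)) \<in> borel_measurable \<mu>" by (rule quot) simp
  moreover have "(\<lambda>x. Re (- \<i> * deriv (f x) z)) \<in> borel_measurable \<mu>" by (rule quot) simp
  ultimately show ?thesis by (simp add: borel_measurable_complex_iff)
qed

text \<open>
The Taylor coefficients at the centre (the constant one normalised to be real) depend measurably on
\<open>x\<close> and satisfy Cauchy bounds that are uniform in \<open>x\<close>, so the power series may be integrated term by term.
Measurability is assumed of the real parts because the \<open>g x\<close> will be logarithms, chosen separately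
for each \<open>x\<close>.
\<close>

lemma Re_holomorphic_average:
  fixes g :: "'a \<Rightarrow> complex \<Rightarrow> complex"
  assumes fin: "finite_measure \<mu>"
    and hol: "\<And>x. x \<in> space \<mu> \<Longrightarrow> g x holomorphic_on ball z0 R"
    and Re_le: "\<And>x z. x \<in> space \<mu> \<Longrightarrow> z \<in> ball z0 R \<Longrightarrow> \<bar>Re (g x z)\<bar> \<le> M"
    and meas: "\<And>z. z \<in> ball z0 R \<Longrightarrow> (\<lambda>x. Re (g x z)) \<in> borel_measurable \<mu>"
  shows "\<exists>G. G holomorphic_on ball z0 R \<and> (\<forall>z\<in>ball z0 R. Re (G z) = (\<integral>x. Re (g x z) \<partial>\<mu>))"
proof -
  interpret finite_measure \<mu> by (rule fin)
  define h where "h = (\<lambda>x z. g x z - \<i> * of_real (Im (g x z0)))"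
  have holh: "h x holomorphic_on ball z0 R" if "x \<in> space \<mu>" for x
    unfolding h_def by (intro holomorphic_intros hol that)
  have Reh: "Re (h x z) = Re (g x z)" for x z by (simp add: h_def)
  define a where "a = (\<lambda>k x. (deriv ^^ k) (h x) z0 / fact k)"
  have meas_higher: "(\<lambda>x. (deriv ^^ Suc k) (h x) z) \<in> borel_measurable \<mu>" if "z \<in> ball z0 R" for k z
    using that
  proof (induction k arbitrary: z)
    case 0
    then show ?case
      using deriv_in_parameter_measurable[of \<mu> h "ball z0 R" z] holh meas by (simp add: Reh)
  next
    case (Suc k)
    have "(\<lambda>x. deriv ((deriv ^^ Suc k) (h x)) z) \<in> borel_measurable \<mu>"
    proof (rule deriv_in_parameter_measurable[where S="ball z0 R"])
      show "(deriv ^^ Suc k) (h x) holomorphic_on ball z0 R" if "x \<in> space \<mu>" for x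
        by (rule holomorphic_higher_deriv[OF holh[OF that]]) auto
      show "(\<lambda>x. Re ((deriv ^^ Suc k) (h x) z)) \<in> borel_measurable \<mu>" if "z \<in> ball z0 R" for z
        using Suc.IH[OF that] by (rule measurable_compose[OF _ borel_measurable_Re])
    qed (use Suc.prems in auto)
    then show ?case by simp
  qed
  have meas_a [measurable]: "a k \<in> borel_measurable \<mu>" if R: "R > 0" for k
  proof (cases k)
    case 0
    have "a k x = of_real (Re (g x z0))" for x by (simp add: a_def 0 h_def complex_eq_iff)
    then have "a k = (\<lambda>x. of_real (Re (g x z0)))" by blast
    then show ?thesis using meas[of z0] R by simp
  next
    case (Suc j)
    then show ?thesis using meas_higher[of z0 j] R unfolding a_def by simp
  qed
  have sums_h: "(\<lambda>k. a k x * (z - z0) ^ k) sums h x z" if "x \<in> space \<mu>" "z \<in> ball z0 R" for x z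
    unfolding a_def by (rule holomorphic_power_series[OF holh]) (use that in auto)
  have a_bound: "norm (a k x) \<le> (M + 2 * (2 * M + 1) * r / (R - r)) / r ^ k"
    if "x \<in> space \<mu>" "0 < r" "r < R" for x k r
  proof -
    have "norm ((deriv ^^ k) (h x) z0) \<le> fact k * (M + 2 * (2 * M + 1) * r / (R - r)) / r ^ k"
    proof (rule Cauchy_inequality)
      show "h x holomorphic_on ball z0 r"
        by (rule holomorphic_on_subset[OF holh[OF that(1)]]) (use that in auto)
      show "continuous_on (cball z0 r) (h x)"
        by (rule continuous_on_subset[OF holomorphic_on_imp_continuous_on[OF holh[OF that(1)]]]) (use that in auto)
      show "norm (h x z) \<le> M + 2 * (2 * M + 1) * r / (R - r)" if "norm (z0 - z) = r" for z
        unfolding h_def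
        by (rule bounded_Re_normalized_bound[OF hol Re_le])
           (use \<open>x \<in> space \<mu>\<close> \<open>0 < r\<close> \<open>r < R\<close> that in \<open>auto simp: norm_minus_commute\<close>)
    qed (use that in auto)
    then show ?thesis by (simp add: a_def norm_divide field_simps)
  qed
  have key: "integrable \<mu> (\<lambda>x. h x z)"
     "(\<lambda>k. (\<integral>x. a k x \<partial>\<mu>) * (z - z0) ^ k) sums (\<integral>x. h x z \<partial>\<mu>)" if z: "z \<in> ball z0 R" for z
  proof -
    have R: "R > 0" using z by (metis ball_empty empty_iff not_le)
    define r where "r = (norm (z - z0) + R) / 2"
    have nz: "norm (z - z0) < R" using z by (simp add: dist_norm norm_minus_commute)
    then have r: "0 < r" "r < R" "norm (z - z0) < r"
      using norm_ge_zero[of "z - z0"] R by (auto simp: r_def intro: add_nonneg_pos)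
    define K where "K = M + 2 * (2 * M + 1) * r / (R - r)"
    define q where "q = norm (z - z0) / r"
    have q: "0 \<le> q" "q < 1" using r by (auto simp: q_def)
    have term_bound: "norm (a k x * (z - z0) ^ k) \<le> K * q ^ k" if "x \<in> space \<mu>" for k x
    proof -
      have "norm (a k x * (z - z0) ^ k) \<le> (K / r ^ k) * norm (z - z0) ^ k"
        unfolding norm_mult norm_power K_def
        by (intro mult_right_mono a_bound that r) auto
      then show ?thesis by (simp add: q_def power_divide)
    qed
    have geo: "summable (\<lambda>k. C * q ^ k)" for C using q by (intro summable_mult summable_geometric) simp
    have int_term: "integrable \<mu> (\<lambda>x. a k x * (z - z0) ^ k)" for k
      by (rule integrable_const_bound[where B="K * q ^ k"])
         (use term_bound meas_a[OF R] in auto)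
    have "integrable \<mu> (\<lambda>x. \<Sum>k. a k x * (z - z0) ^ k) \<and>
      (\<lambda>k. \<integral>x. a k x * (z - z0) ^ k \<partial>\<mu>) sums (\<integral>x. (\<Sum>k. a k x * (z - z0) ^ k) \<partial>\<mu>)"
    proof -
      have 1: "AE x in \<mu>. summable (\<lambda>k. norm (a k x * (z - z0) ^ k))"
        by (rule AE_I2, rule summable_comparison_test[OF _ geo[of K]]) (use term_bound in auto)
      have 2: "summable (\<lambda>k. \<integral>x. norm (a k x * (z - z0) ^ k) \<partial>\<mu>)"
      proof (rule summable_comparison_test[OF _ geo[of "K * measure \<mu> (space \<mu>)"]], intro exI allI impI)
        fix k
        have "(\<integral>x. norm (a k x * (z - z0) ^ k) \<partial>\<mu>) \<le> (\<integral>x. K * q ^ k \<partial>\<mu>)"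
          by (rule integral_mono) (use int_term term_bound in auto)
        then show "norm (\<integral>x. norm (a k x * (z - z0) ^ k) \<partial>\<mu>) \<le> K * measure \<mu> (space \<mu>) * q ^ k"
          by (simp add: mult_ac)
      qed
      show ?thesis using integrable_suminf[OF int_term 1 2] sums_integral[OF int_term 1 2] by simp
    qed
    moreover have "(\<Sum>k. a k x * (z - z0) ^ k) = h x z" if "x \<in> space \<mu>" for x
      using sums_h[OF that z] by (rule sums_unique[symmetric])
    ultimately show "integrable \<mu> (\<lambda>x. h x z)"
       "(\<lambda>k. (\<integral>x. a k x \<partial>\<mu>) * (z - z0) ^ k) sums (\<integral>x. h x z \<partial>\<mu>)"
      by (auto cong: Bochner_Integration.integrable_cong Bochner_Integration.integral_cong)
  qed
  define G where "G = (\<lambda>z. \<integral>x. h x z \<partial>\<mu>)"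
  have "G holomorphic_on ball z0 R"
    unfolding G_def by (rule power_series_holomorphic) (rule key)
  moreover have "Re (G z) = (\<integral>x. Re (g x z) \<partial>\<mu>)" if "z \<in> ball z0 R" for z
    using integral_Re[OF key(1)[OF that]] by (simp add: G_def Reh)
  ultimately show ?thesis by blast
qed

section \<open>The invariant cone\<close>

text \<open>
Up to a positive factor this Hermitian form is \<open>Im (v\<^sub>2 / v\<^sub>1)\<close>: the cone \<open>cone_form v \<ge> 0\<close> consists
of the vectors whose direction lies in the closed upper half plane of the projective line.
\<close>

definition cone_form :: "complex ^ 2 \<Rightarrow> real" where
  "cone_form v = Im (cnj (v $ 1) * v $ 2)"

text \<open>
The kernel of this functional is spanned by \<open>(1, - i)\<close>, the centre of the lower half plane.
\<close>

definition cone_coord :: "complex ^ 2 \<Rightarrow> complex" where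
  "cone_coord v = v $ 1 - \<i> * v $ 2"

lemma cone_coord_norm: "(cmod (cone_coord v))\<^sup>2 = (norm v)\<^sup>2 + 2 * cone_form v"
  unfolding cone_coord_def cone_form_def norm_complex_vec2 cmod_power2
  by (simp add: power2_eq_square algebra_simps)

lemma cone_coord_add: "cone_coord (u + v) = cone_coord u + cone_coord v"
  and cone_coord_scale: "cone_coord (c *s v) = c * cone_coord v"
  by (simp_all add: cone_coord_def algebra_simps)

lemma norm_complex_vec2_component_le:
  "cmod ((v :: complex ^ 2) $ 1) \<le> norm v" "cmod ((v :: complex ^ 2) $ 2) \<le> norm v"
  by (simp_all add: Finite_Cartesian_Product.norm_nth_le)

lemma cmod_cone_coord_le: "cmod (cone_coord v) \<le> 2 * norm v"
  unfolding cone_coord_def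
  using norm_triangle_ineq4[of "v $ 1" "\<i> * v $ 2"] norm_complex_vec2_component_le[of v]
  by (simp add: norm_mult)

lemma norm_le_cone_coord: "0 \<le> cone_form v \<Longrightarrow> norm v \<le> cmod (cone_coord v)"
  using cone_coord_norm[of v] power2_le_imp_le[of "norm v" "cmod (cone_coord v)"] by simp

lemma cone_form_perturb: "\<bar>cone_form (u + r) - cone_form u\<bar> \<le> 2 * norm u * norm r + (norm r)\<^sup>2"
proof -
  have "cone_form (u + r) - cone_form u = Im (cnj (u $ 1) * r $ 2 + cnj (r $ 1) * u $ 2 + cnj (r $ 1) * r $ 2)"
    by (simp add: cone_form_def algebra_simps)
  also have "\<bar>\<dots>\<bar> \<le> cmod (cnj (u $ 1) * r $ 2 + cnj (r $ 1) * u $ 2 + cnj (r $ 1) * r $ 2)"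
    by (rule abs_Im_le_cmod)
  also have "\<dots> \<le> cmod (u $ 1) * cmod (r $ 2) + cmod (r $ 1) * cmod (u $ 2) + cmod (r $ 1) * cmod (r $ 2)"
    by (intro norm_triangle_le add_mono) (auto simp: norm_mult)
  also have "\<dots> \<le> norm u * norm r + norm r * norm u + norm r * norm r"
    by (intro add_mono mult_mono norm_complex_vec2_component_le) auto
  finally show ?thesis by (simp add: power2_eq_square algebra_simps)
qed

lemma cone_form_scale: "cone_form (c *s v) = (cmod c)\<^sup>2 * cone_form v"
  unfolding cmod_power2 by (simp add: cone_form_def power2_eq_square algebra_simps)

lemma norm_complex_vec2_scale: "norm (c *s (v :: complex ^ 2)) = cmod c * norm v"
proof -
  have "(norm (c *s v))\<^sup>2 = (cmod c * norm v)\<^sup>2"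
    unfolding power_mult_distrib norm_complex_vec2
    by (simp add: norm_mult power_mult_distrib algebra_simps)
  then show ?thesis by (simp add: power2_eq_iff_nonneg)
qed

lemma norm_mat2_le_columns:
  "norm (M :: complex ^ 2 ^ 2) \<le> norm (M *v axis 1 1) + norm (M *v axis 2 1)"
proof -
  have "(norm M)\<^sup>2 = (norm (M *v axis 1 1))\<^sup>2 + (norm (M *v axis 2 1))\<^sup>2"
    unfolding norm_complex_mat2 norm_complex_vec2 matrix_vector_entry2 by (simp add: axis_def)
  also have "\<dots> \<le> (norm (M *v axis 1 1) + norm (M *v axis 2 1))\<^sup>2"
    by (simp add: power2_sum)
  finally show ?thesis by (rule power2_le_imp_le) auto
qed

text \<open>
The functional \<open>cone_coord\<close> does not vanish on the image under \<open>T\<close> of a ball around \<open>y\<close>. On each complex line through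
\<open>y\<close> it is affine, and an affine function without zeros in a disc has a linear part dominated by its
value at the centre. Thus one value controls the whole matrix.
\<close>

lemma norm_le_if_cone_contains_ball:
  fixes T :: "complex ^ 2 ^ 2"
  assumes t: "t > 0" and pos: "\<And>v. norm v \<le> t \<Longrightarrow> 0 < cone_form (T *v (y + v))"
  shows "norm T \<le> 6 / t * cmod (cone_coord (T *v y))"
proof -
  define \<psi> where "\<psi> = cone_coord (T *v y)"
  have coord_le: "cmod (cone_coord (T *v v)) \<le> cmod \<psi>" if v: "norm v \<le> t" for v
  proof (rule ccontr)
    define c where "c = cone_coord (T *v v)"
    assume "\<not> cmod (cone_coord (T *v v)) \<le> cmod \<psi>"
    then have less: "cmod \<psi> < cmod c" by (simp add: c_def)
    then have "c \<noteq> 0" by auto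
    define u where "u = (- \<psi> / c) *s v"
    have "cmod (- \<psi> / c) \<le> 1" using less by (auto simp: norm_divide divide_le_eq_1)
    then have "norm u \<le> 1 * norm v"
    proof -
      have "norm u = cmod (- \<psi> / c) * norm v" unfolding u_def by (rule norm_complex_vec2_scale)
      then show ?thesis using \<open>cmod (- \<psi> / c) \<le> 1\<close> by (simp only: mult_right_mono norm_ge_zero)
    qed
    then have "0 < cone_form (T *v (y + u))" using v by (intro pos) simp
    moreover have "cone_coord (T *v (y + u)) = 0"
    proof -
      have "T *v (y + u) = T *v y + (- \<psi> / c) *s (T *v v)"
        unfolding u_def by (simp only: matrix_vector_right_distrib vector_scalar_commute)
      then have "cone_coord (T *v (y + u)) = \<psi> + (- \<psi> / c) * c"
        by (simp only: cone_coord_add cone_coord_scale \<psi>_def c_def)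
      then show ?thesis using \<open>c \<noteq> 0\<close> by simp
    qed
    ultimately show False
      using cone_coord_norm[of "T *v (y + u)"] zero_le_power2[of "norm (T *v (y + u))"] by simp
  qed
  have bound: "norm (T *v v) \<le> 3 * cmod \<psi>" if v: "norm v \<le> t" for v
  proof -
    have "T *v v = T *v (y + v) - T *v (y + 0)" by (simp add: matrix_vector_right_distrib)
    then have "norm (T *v v) \<le> norm (T *v (y + v)) + norm (T *v (y + 0))" by (metis norm_triangle_ineq4)
    also have "\<dots> \<le> cmod (cone_coord (T *v (y + v))) + cmod (cone_coord (T *v (y + 0)))"
      using pos[OF v] pos[of 0] t by (intro add_mono norm_le_cone_coord) auto
    also have "\<dots> \<le> (cmod \<psi> + cmod \<psi>) + cmod \<psi>"
      using coord_le[OF v]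
      by (intro add_mono) (auto simp: \<psi>_def matrix_vector_right_distrib cone_coord_add intro: order_trans[OF norm_triangle_ineq])
    finally show ?thesis by simp
  qed
  have col: "norm (T *v axis i 1) \<le> 3 / t * cmod \<psi>" for i :: 2
  proof -
    have "norm (of_real t *s axis i (1 :: complex)) = t"
    proof -
      have "(norm (axis i (1 :: complex)))\<^sup>2 = 1"
        unfolding norm_complex_vec2 using exhaust_2[of i] by (auto simp: axis_def)
      then have "norm (axis i (1 :: complex)) = 1" by (simp add: power2_eq_1_iff)
      then show ?thesis using t by (simp add: norm_complex_vec2_scale)
    qed
    then have "norm (T *v (of_real t *s axis i 1)) \<le> 3 * cmod \<psi>" by (intro bound) simp
    then have "t * norm (T *v axis i 1) \<le> 3 * cmod \<psi>"
      using t by (simp only: vector_scalar_commute norm_complex_vec2_scale) simp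
    then show ?thesis using t by (simp add: field_simps)
  qed
  show ?thesis using norm_mat2_le_columns[of T] col[of 1] col[of 2] by (simp add: \<psi>_def)
qed

definition adjugate2 :: "'a::comm_ring_1 ^ 2 ^ 2 \<Rightarrow> 'a ^ 2 ^ 2" where
  "adjugate2 M = vector [vector [M $ 2 $ 2, - M $ 1 $ 2], vector [- M $ 2 $ 1, M $ 1 $ 1]]"

lemma adjugate2_entries [simp]:
  "adjugate2 M $ 1 $ 1 = M $ 2 $ 2" "adjugate2 M $ 1 $ 2 = - M $ 1 $ 2"
  "adjugate2 M $ 2 $ 1 = - M $ 2 $ 1" "adjugate2 M $ 2 $ 2 = M $ 1 $ 1"
  by (simp_all add: adjugate2_def)

lemma matrix_mult_adjugate2_vector: "M *v (adjugate2 M *v v) = det M *s v"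
proof -
  have "(M *v (adjugate2 M *v v)) $ i = (det M *s v) $ i" for i
    using exhaust_2[of i]
    by (auto simp only: matrix_vector_entry2 adjugate2_entries vector_smult_component det_2)
       (simp_all add: algebra_simps)
  then show ?thesis unfolding vec_eq_iff by blast
qed

lemma adjugate2_mult_matrix_vector: "adjugate2 M *v (M *v v) = det M *s v"
proof -
  have "(adjugate2 M *v (M *v v)) $ i = (det M *s v) $ i" for i
    using exhaust_2[of i]
    by (auto simp only: matrix_vector_entry2 adjugate2_entries vector_smult_component det_2)
       (simp_all add: algebra_simps)
  then show ?thesis unfolding vec_eq_iff by blast
qed

lemma norm_adjugate2: "norm (adjugate2 (M :: complex ^ 2 ^ 2)) = norm M"
proof -
  have "(norm (adjugate2 M))\<^sup>2 = (norm M)\<^sup>2" unfolding norm_complex_mat2 by simp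
  then show ?thesis by (simp add: power2_eq_iff_nonneg)
qed

text \<open>
The adjugate of \<open>M\<close> cancels \<open>M\<close> up to the factor \<open>det M\<close>, and it has the same norm as \<open>M\<close>.
\<close>

lemma norm_right_factor_le:
  "cmod (det M) * norm N \<le> norm M * norm (M ** (N :: complex ^ 2 ^ 2))"
proof -
  have "(norm (adjugate2 M ** (M ** N)))\<^sup>2 = (cmod (det M) * norm N)\<^sup>2"
  proof -
    have "(adjugate2 M ** (M ** N)) $ i $ j = det M * N $ i $ j" for i j :: 2
      using exhaust_2[of i] by (auto simp: matrix_mult_entry2 det_2 algebra_simps)
    then show ?thesis unfolding norm_complex_mat2 power_mult_distrib
      by (simp add: norm_mult power_mult_distrib algebra_simps)
  qed
  then have "norm (adjugate2 M ** (M ** N)) = cmod (det M) * norm N"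
    by (simp add: power2_eq_iff_nonneg)
  then show ?thesis using norm_matrix_mult_le[of "adjugate2 M" "M ** N"] by (simp add: norm_adjugate2)
qed

lemma integer_translate_into_cube:
  obtains k where "\<forall>i. k $ i \<in> \<int>" "(x :: real ^ 'n) + k \<in> cbox 0 1"
proof (rule that[of "\<chi> i. - real_of_int \<lfloor>x $ i\<rfloor>"])
  show "x + (\<chi> i. - real_of_int \<lfloor>x $ i\<rfloor>) \<in> cbox 0 1"
    by (auto simp: mem_box_cart) linarith
qed auto

lemma torus_periodic_bounded:
  fixes f :: "real ^ 'n \<Rightarrow> 'b::real_normed_vector"
  assumes "continuous_on UNIV f" "torus_periodic f"
  obtains B where "B > 0" "\<And>x. norm (f x) \<le> B"
proof -
  have "compact (f ` cbox 0 1)"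
    by (intro compact_continuous_image continuous_on_subset[OF assms(1)]) auto
  then obtain B where B: "B > 0" "\<And>y. y \<in> f ` cbox 0 1 \<Longrightarrow> norm y \<le> B"
    using compact_imp_bounded bounded_pos by metis
  have "norm (f x) \<le> B" for x
  proof -
    obtain k where "\<forall>i. k $ i \<in> \<int>" "x + k \<in> cbox 0 1" by (rule integer_translate_into_cube)
    then show ?thesis using B(2)[of "f (x + k)"] assms(2) by (auto simp: torus_periodic_def)
  qed
  then show ?thesis using that B(1) by blast
qed

text \<open>
In the moving frame \<open>b\<close> the \<open>n\<close>-step cocycle increases the form by a definite amount, so it maps the closed cone, apart
from \<open>0\<close>, into the open cone.
\<close>

definition contracts_cone ::
    "real ^ 'n \<Rightarrow> (real ^ 'n \<Rightarrow> complex ^ 2 ^ 2) \<Rightarrow> nat \<Rightarrow> (real ^ 'n \<Rightarrow> complex ^ 2 ^ 2) \<Rightarrow> bool" where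
  "contracts_cone \<alpha> F n b \<longleftrightarrow> (\<exists>\<delta>>0. \<forall>x v. cone_form (b x *v v) + \<delta> * (norm v)\<^sup>2
     \<le> cone_form (b (x + real n *\<^sub>R \<alpha>) *v (complex_iter \<alpha> F n x *v v)))"

lemma torus_periodic_family_bounded:
  fixes f :: "'p::topological_space \<Rightarrow> real ^ 'n \<Rightarrow> 'b::real_normed_vector"
  assumes P: "compact P" and cont: "continuous_on (P \<times> UNIV) (\<lambda>(p, x). f p x)"
    and per: "\<And>p. p \<in> P \<Longrightarrow> torus_periodic (f p)"
  shows "\<exists>B>0. \<forall>p\<in>P. \<forall>x. norm (f p x) \<le> B"
proof -
  have "compact ((\<lambda>(p, x). f p x) ` (P \<times> cbox 0 1))"
    by (intro compact_continuous_image continuous_on_subset[OF cont]) (auto intro: compact_Times P)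
  then obtain B where B: "B > 0" "\<And>y. y \<in> (\<lambda>(p, x). f p x) ` (P \<times> cbox 0 1) \<Longrightarrow> norm y \<le> B"
    using compact_imp_bounded bounded_pos by metis
  have "norm (f p x) \<le> B" if "p \<in> P" for p x
  proof -
    obtain k where k: "\<forall>i. k $ i \<in> \<int>" "x + k \<in> cbox 0 1" by (rule integer_translate_into_cube)
    have "f p (x + k) \<in> (\<lambda>(p, x). f p x) ` (P \<times> cbox 0 1)"
      using that k(2) by (intro image_eqI[where x="(p, x + k)"]) auto
    then show ?thesis using B(2)[of "f p (x + k)"] per[OF that] k(1) by (auto simp: torus_periodic_def)
  qed
  then show ?thesis using B(1) by blast
qed

lemma cone_form_iterate:
  assumes "\<And>x v. cone_form (b x *v v) \<le> cone_form (b (x + real n *\<^sub>R \<alpha>) *v (complex_iter \<alpha> F n x *v v))"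
  shows "cone_form (b x *v v) \<le> cone_form (b (x + real (k * n) *\<^sub>R \<alpha>) *v (complex_iter \<alpha> F (k * n) x *v v))"
proof (induction k)
  case 0
  show ?case by simp
next
  case (Suc k)
  have "x + real (k * n) *\<^sub>R \<alpha> + real n *\<^sub>R \<alpha> = x + real (Suc k * n) *\<^sub>R \<alpha>" by (simp add: algebra_simps)
  moreover have "complex_iter \<alpha> F n (x + real (k * n) *\<^sub>R \<alpha>) *v (complex_iter \<alpha> F (k * n) x *v v)
      = complex_iter \<alpha> F (Suc k * n) x *v v"
    using complex_iter_add[of \<alpha> F n "k * n" x] by (simp add: matrix_vector_mul_assoc)
  ultimately have "cone_form (b (x + real (k * n) *\<^sub>R \<alpha>) *v (complex_iter \<alpha> F (k * n) x *v v))
      \<le> cone_form (b (x + real (Suc k * n) *\<^sub>R \<alpha>) *v (complex_iter \<alpha> F (Suc k * n) x *v v))"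
    using assms[of "x + real (k * n) *\<^sub>R \<alpha>" "complex_iter \<alpha> F (k * n) x *v v"] by (simp only:)
  with Suc show ?case by (rule order_trans)
qed

section \<open>The Lyapunov exponent is harmonic where a cone is contracted\<close>

text \<open>
Uniform continuity over the compact unit cube, carried to all base points by periodicity.
\<close>

lemma torus_periodic_uniformly_close:
  fixes f :: "complex \<Rightarrow> real ^ 'n \<Rightarrow> 'b::real_normed_vector"
  assumes cont: "continuous_on (cball z0 r \<times> UNIV) (\<lambda>(z, x). f z x)"
    and per: "\<And>z. z \<in> cball z0 r \<Longrightarrow> torus_periodic (f z)"
    and r: "r > 0" and e: "e > 0"
  obtains d where "0 < d" "d \<le> r" "\<And>z x. dist z z0 < d \<Longrightarrow> norm (f z x - f z0 x) < e"
proof -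
  have "uniformly_continuous_on (cball z0 r \<times> cbox 0 1) (\<lambda>(z, x). f z x)"
    by (rule compact_uniformly_continuous[OF continuous_on_subset[OF cont]]) (auto intro: compact_Times)
  then obtain d where d: "d > 0"
    and close: "\<And>p q. p \<in> cball z0 r \<times> cbox 0 1 \<Longrightarrow> q \<in> cball z0 r \<times> cbox 0 1 \<Longrightarrow> dist q p < d \<Longrightarrow>
        dist ((\<lambda>(z, x). f z x) q) ((\<lambda>(z, x). f z x) p) < e"
    using e unfolding uniformly_continuous_on_def by metis
  have "norm (f z x - f z0 x) < e" if z: "dist z z0 < min d r" for z x
  proof -
    obtain k where k: "\<forall>i. k $ i \<in> \<int>" "x + k \<in> cbox 0 1" by (rule integer_translate_into_cube)
    have "dist (f z (x + k)) (f z0 (x + k)) < e"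
      using close[of "(z0, x + k)" "(z, x + k)"] z k(2) r by (simp add: dist_Pair_Pair dist_commute)
    moreover have "f z (x + k) = f z x" "f z0 (x + k) = f z0 x"
      using per[of z] per[of z0] z r k(1) by (auto simp: torus_periodic_def dist_commute)
    ultimately show ?thesis by (simp add: dist_norm)
  qed
  then show ?thesis using that[of "min d r"] d r by auto
qed

lemma complex_iter_norm_le:
  assumes "\<And>x. norm (F x) \<le> B" "1 \<le> B"
  shows "norm (complex_iter \<alpha> F N x) \<le> 2 * B ^ N"
proof (induction N)
  case 0
  have "(norm (mat 1 :: complex ^ 2 ^ 2))\<^sup>2 \<le> 2\<^sup>2"
    unfolding norm_complex_mat2 by (simp add: mat_def)
  then show ?case using power2_le_imp_le[of "norm (mat 1 :: complex ^ 2 ^ 2)" 2] by simp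
next
  case (Suc N)
  have "norm (complex_iter \<alpha> F (Suc N) x) \<le> norm (F (x + real N *\<^sub>R \<alpha>)) * norm (complex_iter \<alpha> F N x)"
    using norm_matrix_mult_le by simp
  also have "\<dots> \<le> B * (2 * B ^ N)" using assms Suc by (intro mult_mono) auto
  finally show ?case by simp
qed

lemma complex_iter_entry_holomorphic:
  assumes "\<And>x i j. (\<lambda>z. F z x $ i $ j) holomorphic_on S"
  shows "(\<lambda>z. complex_iter \<alpha> (F z) n x $ i $ j) holomorphic_on S"
proof (induction n arbitrary: i j)
  case (Suc n)
  then show ?case by (simp add: matrix_mult_entry2 assms holomorphic_on_add holomorphic_on_mult)
qed simp

lemma torus_integral_abs_le:
  fixes f :: "real ^ 'n \<Rightarrow> real"
  assumes "continuous_on (cbox 0 1) f" "\<And>x. \<bar>f x\<bar> \<le> K"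
  shows "\<bar>integral (cbox 0 1) f\<bar> \<le> K"
proof -
  have "0 \<le> K" using assms(2)[of 0] abs_ge_zero[of "f 0"] by linarith
  then have "norm (integral (cbox 0 1) f) \<le> K * measure lborel (cbox 0 (1 :: real ^ 'n))"
    using assms by (intro integrable_bound integrable_continuous) auto
  moreover have "measure lborel (cbox 0 (1 :: real ^ 'n)) = 1"
  proof (subst content_cbox_cart)
    have "(0 :: real ^ 'n) \<in> cbox 0 1" by (simp add: mem_box_cart)
    then show "cbox 0 (1 :: real ^ 'n) \<noteq> {}" by blast
  qed simp
  ultimately show ?thesis by simp
qed

text \<open>
The definite gain of the form at \<open>z0\<close> leaves room for a perturbation, so for \<open>z\<close> near \<open>z0\<close> the form
does not decrease. Choosing \<open>y x\<close> so that \<open>b x\<close> maps it to a multiple of \<open>(1, i)\<close>, the centre of the cone,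
the functions \<open>\<psi> k\<close> below are holomorphic in \<open>z\<close>, have no zeros, and agree with the norms of the iterates up to
a constant factor. Their logarithms therefore yield the exponent as a limit of averages of real parts
of holomorphic functions.
\<close>

theorem lyapunov_harmonic_near_cone_contraction:
  fixes F :: "complex \<Rightarrow> real ^ 'n \<Rightarrow> complex ^ 2 ^ 2"
  assumes R: "0 < R" and cont: "continuous_on (ball z0 R \<times> UNIV) (\<lambda>(z, x). F z x)"
    and hol: "\<And>x i j. (\<lambda>z. F z x $ i $ j) holomorphic_on ball z0 R"
    and coc: "\<And>z. z \<in> ball z0 R \<Longrightarrow> torus_cocycle (F z)"
    and n: "n \<ge> 1" and b_cont: "continuous_on UNIV b" and b_per: "torus_periodic b"
    and b_det: "\<And>x. det (b x) \<noteq> 0" and contracts: "contracts_cone \<alpha> (F z0) n b"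
  shows "\<exists>\<rho>>0. \<rho> \<le> R \<and> (\<exists>G. G holomorphic_on ball z0 \<rho> \<and>
            (\<forall>z\<in>ball z0 \<rho>. Re (G z) = complex_lyapunov \<alpha> (F z)))"
proof -
  obtain \<delta> where \<delta>: "\<delta> > 0" and cone: "\<And>x v. cone_form (b x *v v) + \<delta> * (norm v)\<^sup>2
      \<le> cone_form (b (x + real n *\<^sub>R \<alpha>) *v (complex_iter \<alpha> (F z0) n x *v v))"
    using contracts unfolding contracts_cone_def by blast
  define T where "T = (\<lambda>z x. b (x + real n *\<^sub>R \<alpha>) ** complex_iter \<alpha> (F z) n x)"
  have half: "cball z0 (R / 2) \<subseteq> ball z0 R" using R by auto
  have bshift_cont: "continuous_on UNIV (\<lambda>x. b (x + v))" for v
    by (rule continuous_on_compose2[OF b_cont]) (auto intro!: continuous_intros)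
  have bshift_per: "b (x + k + v) = b (x + v)" if "\<forall>i. k $ i \<in> \<int>" for x k v
    using b_per that unfolding torus_periodic_def by (metis add.commute add.left_commute)
  have iter_cont: "continuous_on (ball z0 R \<times> UNIV) (\<lambda>(z, x). complex_iter \<alpha> (F z) N x)" for N
    by (rule complex_iter_continuous[OF cont])
  have iter_coc: "torus_cocycle (complex_iter \<alpha> (F z) N)" if "z \<in> ball z0 R" for z N
    using torus_cocycle_iter[OF coc[OF that]] .
  have T_cont: "continuous_on (ball z0 R \<times> UNIV) (\<lambda>(z, x). T z x)"
    unfolding T_def case_prod_beta
    by (intro continuous_intros iter_cont[unfolded case_prod_beta] continuous_on_compose2[OF b_cont]) auto
  have T_per: "torus_periodic (T z)" if "z \<in> ball z0 R" for z
    using iter_coc[OF that, of n] bshift_per by (auto simp: T_def torus_periodic_def torus_cocycle_def)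
  obtain \<beta> where \<beta>: "\<beta> > 0" "\<And>x. norm (b x) \<le> \<beta>"
    using torus_periodic_bounded[OF b_cont b_per] by blast
  obtain \<mu> where \<mu>: "\<mu> > 0" "\<And>x. \<mu> \<le> cmod (det (b x))"
  proof -
    have "continuous_on UNIV (\<lambda>x. inverse (det (b x)))"
      unfolding det_2 using b_det by (auto intro!: continuous_intros b_cont simp: det_2)
    moreover have "torus_periodic (\<lambda>x. inverse (det (b x)))"
      using b_per by (auto simp: torus_periodic_def)
    ultimately obtain B where B: "B > 0" "\<And>x. norm (inverse (det (b x))) \<le> B"
      by (rule torus_periodic_bounded) blast
    have "1 / B \<le> cmod (det (b x))" for x
      using B(1) B(2)[of x] b_det[of x] by (simp add: norm_inverse norm_divide field_simps)
    then show ?thesis using that[of "1 / B"] B(1) by simp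
  qed
  obtain \<Gamma> where \<Gamma>: "\<Gamma> \<ge> 1" "\<And>z x. z \<in> cball z0 (R / 2) \<Longrightarrow> norm (F z x) \<le> \<Gamma>"
  proof -
    have per: "torus_periodic (F z)" if "z \<in> cball z0 (R / 2)" for z
      using coc[of z] that half by (auto simp: torus_cocycle_def)
    have c: "continuous_on (cball z0 (R / 2) \<times> UNIV) (\<lambda>(z, x). F z x)"
      by (rule continuous_on_subset[OF cont]) (use half in auto)
    obtain B where B: "B > 0" "\<And>z x. z \<in> cball z0 (R / 2) \<Longrightarrow> norm (F z x) \<le> B"
      using torus_periodic_family_bounded[OF compact_cball c per] by blast
    show ?thesis
    proof (rule that[of "max 1 B"])
      show "norm (F z x) \<le> max 1 B" if "z \<in> cball z0 (R / 2)" for z x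
        using B(2)[OF that, of x] by linarith
    qed simp
  qed
  obtain \<rho> where \<rho>: "0 < \<rho>" "\<rho> \<le> R / 2"
    and cone_near: "\<And>z x v. z \<in> ball z0 \<rho> \<Longrightarrow> cone_form (b x *v v)
        \<le> cone_form (b (x + real n *\<^sub>R \<alpha>) *v (complex_iter \<alpha> (F z) n x *v v))"
  proof -
    have c: "continuous_on (cball z0 (R / 2) \<times> UNIV) (\<lambda>(z, x). T z x)"
      by (rule continuous_on_subset[OF T_cont]) (use half in auto)
    have p: "torus_periodic (T z)" if "z \<in> cball z0 (R / 2)" for z using T_per that half by blast
    obtain B where B: "B > 0" "\<And>z x. z \<in> cball z0 (R / 2) \<Longrightarrow> norm (T z x) \<le> B"
      using torus_periodic_family_bounded[OF compact_cball c p] by blast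
    define \<eta> where "\<eta> = min 1 (\<delta> / (2 * B + 1))"
    have \<eta>: "\<eta> > 0" "\<eta> \<le> 1" "\<eta> * (2 * B + 1) \<le> \<delta>"
    proof -
      show "\<eta> > 0" "\<eta> \<le> 1" using \<delta> B by (auto simp: \<eta>_def)
      have "\<eta> * (2 * B + 1) \<le> \<delta> / (2 * B + 1) * (2 * B + 1)"
        using B by (intro mult_right_mono) (auto simp: \<eta>_def)
      then show "\<eta> * (2 * B + 1) \<le> \<delta>" using B by simp
    qed
    obtain d where d: "0 < d" "d \<le> R / 2" "\<And>z x. dist z z0 < d \<Longrightarrow> norm (T z x - T z0 x) < \<eta>"
      using torus_periodic_uniformly_close[OF c p _ \<eta>(1)] R by auto
    have "cone_form (b x *v v) \<le> cone_form (T z x *v v)" if z: "z \<in> ball z0 d" for z x v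
    proof -
      define u where "u = T z0 x *v v"
      define r where "r = (T z x - T z0 x) *v v"
      have Tz: "T z x *v v = u + r" by (simp add: u_def r_def matrix_vector_mult_diff_rdistrib)
      have nu: "norm u \<le> B * norm v"
        unfolding u_def
        using order_trans[OF norm_matrix_vector_le mult_right_mono[OF B(2)[of z0 x] norm_ge_zero]] R by simp
      have nr: "norm r \<le> \<eta> * norm v"
        unfolding r_def
        using order_trans[OF norm_matrix_vector_le mult_right_mono[OF less_imp_le[OF d(3)[of z x]] norm_ge_zero]] z
        by (simp add: dist_commute)
      have "2 * norm u * norm r + (norm r)\<^sup>2 \<le> 2 * (B * norm v) * (\<eta> * norm v) + (\<eta> * norm v) * (\<eta> * norm v)"
        unfolding power2_eq_square using B(1) \<eta>(1) nu nr by (intro add_mono mult_mono) auto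
      also have "\<dots> = (2 * B * \<eta> + \<eta> * \<eta>) * (norm v)\<^sup>2" by (simp add: power2_eq_square algebra_simps)
      also have "\<dots> \<le> \<delta> * (norm v)\<^sup>2"
      proof (rule mult_right_mono)
        have "\<eta> * \<eta> \<le> \<eta> * 1" using \<eta> by (intro mult_left_mono) auto
        then show "2 * B * \<eta> + \<eta> * \<eta> \<le> \<delta>" using \<eta>(3) by (simp add: algebra_simps)
      qed simp
      finally have "cone_form u - \<delta> * (norm v)\<^sup>2 \<le> cone_form (u + r)"
        using cone_form_perturb[of u r] by linarith
      moreover have "cone_form (b x *v v) + \<delta> * (norm v)\<^sup>2 \<le> cone_form u"
        using cone[of x v] by (simp add: u_def T_def matrix_vector_mul_assoc)
      ultimately show ?thesis using Tz by simp
    qed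
    then show ?thesis using that[of d] d by (simp add: T_def matrix_vector_mul_assoc)
  qed
  have sub: "ball z0 \<rho> \<subseteq> ball z0 R" "ball z0 \<rho> \<subseteq> cball z0 (R / 2)" using \<rho> R by auto
  define e :: "complex ^ 2" where "e = vector [1, \<i>]"
  have e: "norm e \<le> 2" "cone_form e = 1"
  proof -
    have "(norm e)\<^sup>2 \<le> 2\<^sup>2" by (simp add: norm_complex_vec2 e_def)
    then show "norm e \<le> 2" using power2_le_imp_le[of "norm e" 2] by simp
    show "cone_form e = 1" by (simp add: cone_form_def e_def)
  qed
  have ne: "(norm e)\<^sup>2 = 2" by (simp add: norm_complex_vec2 e_def)
  define y where "y = (\<lambda>x. adjugate2 (b x) *v e)"
  have y_norm: "norm (y x) \<le> \<beta> * 2" for x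
  proof -
    have "norm (y x) \<le> norm (adjugate2 (b x)) * norm e" unfolding y_def by (rule norm_matrix_vector_le)
    also have "\<dots> \<le> \<beta> * 2" unfolding norm_adjugate2 using \<beta>(1) \<beta>(2)[of x] e(1) by (intro mult_mono) auto
    finally show ?thesis .
  qed
  \<comment> \<open>the radius of a ball around \<open>y x\<close> inside the cone: with \<open>D = |det (b x)|\<close>, the vector \<open>b x *v y x\<close> has form
    \<open>D\<^sup>2\<close> and norm at most \<open>3 D / 2\<close>, and it is moved by at most \<open>D / 4\<close>\<close>
  define t where "t = \<mu> / (4 * \<beta>)"
  have t: "t > 0" using \<mu>(1) \<beta>(1) by (simp add: t_def)
  have y_interior: "0 < cone_form (b x *v (y x + v))" if v: "norm v \<le> t" for x v
  proof -
    define D where "D = cmod (det (b x))"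
    have D: "\<mu> \<le> D" "0 < D" using \<mu>(1) \<mu>(2)[of x] by (auto simp: D_def)
    define u where "u = b x *v y x"
    define r where "r = b x *v v"
    have ue: "u = det (b x) *s e" by (simp add: u_def y_def matrix_mult_adjugate2_vector)
    have cu: "cone_form u = D\<^sup>2" by (simp add: ue cone_form_scale e D_def)
    have nu: "norm u \<le> D * (3 / 2)"
    proof -
      have "(norm e)\<^sup>2 \<le> (3 / 2)\<^sup>2" unfolding ne by (simp add: power2_eq_square)
      then have "norm e \<le> 3 / 2" using power2_le_imp_le[of "norm e" "3 / 2"] by simp
      then show ?thesis using D unfolding ue norm_complex_vec2_scale D_def[symmetric] by (intro mult_left_mono) auto
    qed
    have nr: "norm r \<le> D / 4"
    proof -
      have "norm r \<le> norm (b x) * norm v" unfolding r_def by (rule norm_matrix_vector_le)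
      also have "\<dots> \<le> \<beta> * t" using \<beta>(1) \<beta>(2)[of x] v by (intro mult_mono) auto
      also have "\<dots> = \<mu> / 4" using \<beta>(1) by (simp add: t_def)
      finally show ?thesis using D by simp
    qed
    have "2 * norm u * norm r + (norm r)\<^sup>2 \<le> 2 * (D * (3 / 2)) * (D / 4) + (D / 4) * (D / 4)"
      unfolding power2_eq_square using D nu nr by (intro add_mono mult_mono) auto
    also have "\<dots> < D\<^sup>2" using D by (simp add: power2_eq_square field_simps)
    finally have "0 < cone_form (u + r)" using cone_form_perturb[of u r] cu by linarith
    then show ?thesis by (simp add: u_def r_def matrix_vector_right_distrib)
  qed
  define \<psi> where "\<psi> = (\<lambda>k z x. cone_coord (b (x + real (k * n) *\<^sub>R \<alpha>) *v (complex_iter \<alpha> (F z) (k * n) x *v y x)))"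
  define C where "C = max 1 (max (4 * \<beta> * \<beta>) (6 * \<beta> / (t * \<mu>)))"
  have C1: "C \<ge> 1" by (simp add: C_def)
  have \<psi>_upper: "cmod (\<psi> k z x) \<le> C * norm (complex_iter \<alpha> (F z) (k * n) x)" for k z x
  proof -
    have "cmod (\<psi> k z x) \<le> 2 * norm (b (x + real (k * n) *\<^sub>R \<alpha>) *v (complex_iter \<alpha> (F z) (k * n) x *v y x))"
      unfolding \<psi>_def by (rule cmod_cone_coord_le)
    also have "\<dots> \<le> 2 * (\<beta> * (norm (complex_iter \<alpha> (F z) (k * n) x) * (\<beta> * 2)))"
    proof -
      have "norm (complex_iter \<alpha> (F z) (k * n) x *v y x) \<le> norm (complex_iter \<alpha> (F z) (k * n) x) * (\<beta> * 2)"
        by (rule order_trans[OF norm_matrix_vector_le mult_left_mono[OF y_norm]]) simp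
      then have "norm (b (x + real (k * n) *\<^sub>R \<alpha>)) * norm (complex_iter \<alpha> (F z) (k * n) x *v y x)
          \<le> \<beta> * (norm (complex_iter \<alpha> (F z) (k * n) x) * (\<beta> * 2))"
        using \<beta> by (intro mult_mono) auto
      then show ?thesis
        using norm_matrix_vector_le[of "b (x + real (k * n) *\<^sub>R \<alpha>)" "complex_iter \<alpha> (F z) (k * n) x *v y x"] by linarith
    qed
    also have "\<dots> = (4 * \<beta> * \<beta>) * norm (complex_iter \<alpha> (F z) (k * n) x)" by simp
    also have "\<dots> \<le> C * norm (complex_iter \<alpha> (F z) (k * n) x)"
      by (intro mult_right_mono) (auto simp: C_def)
    finally show ?thesis .
  qed
  have \<psi>_lower: "norm (complex_iter \<alpha> (F z) (k * n) x) \<le> C * cmod (\<psi> k z x)" if z: "z \<in> ball z0 \<rho>" for k z x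
  proof -
    define M where "M = b (x + real (k * n) *\<^sub>R \<alpha>)"
    define N where "N = complex_iter \<alpha> (F z) (k * n) x"
    have "norm (M ** N) \<le> 6 / t * cmod (cone_coord ((M ** N) *v y x))"
    proof (rule norm_le_if_cone_contains_ball[OF t])
      fix v :: "complex ^ 2" assume "norm v \<le> t"
      then have "0 < cone_form (b x *v (y x + v))" by (rule y_interior)
      also have "\<dots> \<le> cone_form (M *v (N *v (y x + v)))"
        unfolding M_def N_def by (rule cone_form_iterate[OF cone_near[OF z]])
      finally show "0 < cone_form ((M ** N) *v (y x + v))" by (simp add: matrix_vector_mul_assoc)
    qed
    then have MN: "norm (M ** N) \<le> 6 / t * cmod (\<psi> k z x)"
      by (simp add: \<psi>_def M_def N_def matrix_vector_mul_assoc)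
    have "\<mu> * norm N \<le> cmod (det M) * norm N" using \<mu>(2) by (intro mult_right_mono) (auto simp: M_def)
    also have "\<dots> \<le> norm M * norm (M ** N)" by (rule norm_right_factor_le)
    also have "\<dots> \<le> \<beta> * (6 / t * cmod (\<psi> k z x))" using \<beta> MN by (intro mult_mono) (auto simp: M_def)
    finally have "norm N \<le> (6 * \<beta> / (t * \<mu>)) * cmod (\<psi> k z x)" using \<mu>(1) t by (simp add: field_simps)
    also have "\<dots> \<le> C * cmod (\<psi> k z x)" by (intro mult_right_mono) (auto simp: C_def)
    finally show ?thesis by (simp add: N_def)
  qed
  have iter_ge1: "1 \<le> norm (complex_iter \<alpha> (F z) N x)" if "z \<in> ball z0 \<rho>" for z N x
    using torus_cocycle_norm_ge_1[OF coc] that sub by blast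
  have \<psi>_pos: "0 < cmod (\<psi> k z x)" if "z \<in> ball z0 \<rho>" for k z x
  proof (rule ccontr)
    assume "\<not> 0 < cmod (\<psi> k z x)"
    then show False using \<psi>_lower[OF that, of k x] iter_ge1[OF that, of "k * n" x] by simp
  qed
  have log_close: "\<bar>ln (cmod (\<psi> k z x)) - ln (norm (complex_iter \<alpha> (F z) (k * n) x))\<bar> \<le> ln C"
    if z: "z \<in> ball z0 \<rho>" for k z x
  proof -
    have p: "0 < norm (complex_iter \<alpha> (F z) (k * n) x)" using iter_ge1[OF z, of "k * n" x] by linarith
    have "ln (cmod (\<psi> k z x)) \<le> ln (C * norm (complex_iter \<alpha> (F z) (k * n) x))"
      using \<psi>_upper[of k z x] \<psi>_pos[OF z, of k x] by (intro ln_mono) auto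
    moreover have "ln (norm (complex_iter \<alpha> (F z) (k * n) x)) \<le> ln (C * cmod (\<psi> k z x))"
      using \<psi>_lower[OF z, of k x] p by (intro ln_mono) auto
    ultimately show ?thesis using C1 p \<psi>_pos[OF z, of k x] by (simp add: ln_mult)
  qed
  have \<psi>_hol: "(\<lambda>z. \<psi> k z x) holomorphic_on ball z0 \<rho>" for k x
    unfolding \<psi>_def cone_coord_def matrix_vector_entry2
    by (intro holomorphic_intros complex_iter_entry_holomorphic holomorphic_on_subset[OF hol sub(1)])
  \<comment> \<open>the index is shifted to avoid division by zero\<close>
  define u where "u = (\<lambda>k z x. ln (cmod (\<psi> (Suc k) z x)) / real (Suc k * n))"
  have "\<exists>g. g holomorphic_on ball z0 \<rho> \<and> (\<forall>z\<in>ball z0 \<rho>. Re (g z) = u k z x)" for k x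
  proof -
    obtain g where g: "g holomorphic_on ball z0 \<rho>" "\<And>z. z \<in> ball z0 \<rho> \<Longrightarrow> exp (g z) = \<psi> (Suc k) z x"
      by (rule holomorphic_logarithm_exists[of "ball z0 \<rho>" "\<lambda>z. \<psi> (Suc k) z x" z0])
         (use \<psi>_hol[of "Suc k" x] \<psi>_pos[of _ "Suc k" x] \<rho>(1) in auto)
    have "Re (g z) = ln (cmod (\<psi> (Suc k) z x))" if "z \<in> ball z0 \<rho>" for z
      using g(2)[OF that, symmetric] by simp
    then have "\<forall>z\<in>ball z0 \<rho>. Re (g z / of_nat (Suc k * n)) = u k z x" by (simp add: u_def Re_divide_of_nat)
    moreover have "(\<lambda>z. g z / of_nat (Suc k * n)) holomorphic_on ball z0 \<rho>"
      using n by (intro holomorphic_intros g) (simp del: mult_Suc)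
    ultimately show ?thesis by blast
  qed
  then obtain g where g_hol: "\<And>k x. g k x holomorphic_on ball z0 \<rho>"
    and g_Re: "\<And>k x z. z \<in> ball z0 \<rho> \<Longrightarrow> Re (g k x z) = u k z x" by metis
  have kn: "1 \<le> real (Suc k * n)" for k
  proof -
    have "1 \<le> Suc k * n" using n by (simp add: Suc_le_eq)
    then show ?thesis by (metis of_nat_1 of_nat_le_iff)
  qed
  define K where "K = ln C + ln 2 + ln \<Gamma>"
  have u_bound: "\<bar>u k z x\<bar> \<le> K" if z: "z \<in> ball z0 \<rho>" for k z x
  proof -
    define N where "N = Suc k * n"
    have N: "1 \<le> real N" using kn by (simp add: N_def)
    have l0: "0 \<le> ln (norm (complex_iter \<alpha> (F z) N x))" using iter_ge1[OF z] by (rule ln_ge_zero)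
    have "norm (complex_iter \<alpha> (F z) N x) \<le> 2 * \<Gamma> ^ N"
      using z sub by (intro complex_iter_norm_le \<Gamma>) auto
    then have "ln (norm (complex_iter \<alpha> (F z) N x)) \<le> ln (2 * \<Gamma> ^ N)"
      using iter_ge1[OF z, of N x] by (intro ln_mono) auto
    also have "\<dots> = ln 2 + real N * ln \<Gamma>" using \<Gamma>(1) by (simp add: ln_mult ln_realpow)
    finally have up: "ln (norm (complex_iter \<alpha> (F z) N x)) \<le> ln 2 + real N * ln \<Gamma>" .
    have "\<bar>ln (cmod (\<psi> (Suc k) z x))\<bar> \<le> ln C + ln 2 + real N * ln \<Gamma>"
      using log_close[OF z, of "Suc k" x] l0 up by (simp add: N_def)
    also have "\<dots> \<le> real N * K"
    proof -
      have "ln C + ln 2 \<le> real N * (ln C + ln 2)" using N C1 mult_right_mono[OF N, of "ln C + ln 2"] by simp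
      then show ?thesis by (simp add: K_def algebra_simps)
    qed
    finally have "\<bar>ln (cmod (\<psi> (Suc k) z x))\<bar> \<le> real N * K" .
    moreover have "u k z x = ln (cmod (\<psi> (Suc k) z x)) / real N" by (simp only: u_def N_def)
    ultimately show ?thesis using N by (simp add: abs_divide pos_divide_le_eq mult.commute)
  qed
  have \<psi>_cont: "continuous_on UNIV (\<lambda>x. \<psi> k z x)" if z: "z \<in> ball z0 \<rho>" for k z
  proof -
    have "continuous_on UNIV (complex_iter \<alpha> (F z) (k * n))"
      using iter_coc[of z "k * n"] z sub by (auto simp: torus_cocycle_def)
    moreover have "continuous_on UNIV y"
    proof -
      have "y = (\<lambda>x. vector [b x $ 2 $ 2 - \<i> * b x $ 1 $ 2, \<i> * b x $ 1 $ 1 - b x $ 2 $ 1])"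
        unfolding y_def by (simp add: fun_eq_iff vec_eq_iff forall_2 matrix_vector_entry2 e_def)
      then have "y = (\<lambda>x. (b x $ 2 $ 2 - \<i> * b x $ 1 $ 2) *s axis 1 1 + (\<i> * b x $ 1 $ 1 - b x $ 2 $ 1) *s axis 2 1)"
        by (simp add: fun_eq_iff vec_eq_iff forall_2 axis_def)
      moreover have scale: "continuous_on UNIV (\<lambda>x. c x *s (w :: complex ^ 2))" if "continuous_on UNIV c" for c :: "real ^ 'n \<Rightarrow> complex" and w
        unfolding vector_scalar_mult_def by (intro continuous_on_vec_lambda continuous_intros that)
      ultimately show ?thesis by (simp only:) (intro scale continuous_intros b_cont)
    qed
    moreover define W where "W = (\<lambda>x. b (x + real (k * n) *\<^sub>R \<alpha>) *v (complex_iter \<alpha> (F z) (k * n) x *v y x))"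
    ultimately have "continuous_on UNIV W"
      unfolding W_def by (intro continuous_intros bshift_cont)
    then have "continuous_on UNIV (\<lambda>x. cone_coord (W x))" unfolding cone_coord_def by (intro continuous_intros)
    then show ?thesis by (simp only: \<psi>_def W_def)
  qed
  have u_cont: "continuous_on (cbox 0 1) (u k z)" if z: "z \<in> ball z0 \<rho>" for k z
  proof -
    have "\<psi> (Suc k) z x \<noteq> 0" for x using \<psi>_pos[OF z, of "Suc k" x] by auto
    then show ?thesis
      unfolding u_def using kn[of k]
      by (intro continuous_intros continuous_on_subset[OF \<psi>_cont[OF z]]) auto
  qed
  have fin: "finite_measure (lebesgue_on (cbox 0 (1 :: real ^ 'n)))" by (rule finite_measure_lebesgue_on) simp
  have "\<exists>G. G holomorphic_on ball z0 \<rho> \<and> (\<forall>z\<in>ball z0 \<rho>. Re (G z) = integral (cbox 0 1) (u k z))" for k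
  proof -
    have "\<exists>G. G holomorphic_on ball z0 \<rho> \<and> (\<forall>z\<in>ball z0 \<rho>. Re (G z) = (\<integral>x. Re (g k x z) \<partial>lebesgue_on (cbox 0 1)))"
    proof (rule Re_holomorphic_average[OF fin g_hol, where M=K])
      show "\<bar>Re (g k x z)\<bar> \<le> K" if "z \<in> ball z0 \<rho>" for x z using u_bound[OF that] g_Re[OF that] by simp
      show "(\<lambda>x. Re (g k x z)) \<in> borel_measurable (lebesgue_on (cbox 0 1))" if "z \<in> ball z0 \<rho>" for z
        using continuous_imp_integrable[OF u_cont[OF that, of k]] by (simp add: g_Re[OF that] borel_measurable_integrable)
    qed
    moreover have "(\<integral>x. Re (g k x z) \<partial>lebesgue_on (cbox 0 1)) = integral (cbox 0 1) (u k z)" if "z \<in> ball z0 \<rho>" for z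
      using lebesgue_integral_eq_integral[OF continuous_imp_integrable[OF u_cont[OF that, of k]]] by (simp add: g_Re[OF that])
    ultimately show ?thesis by auto
  qed
  then obtain G where G_hol: "\<And>k. G k holomorphic_on ball z0 \<rho>"
    and G_Re: "\<And>k z. z \<in> ball z0 \<rho> \<Longrightarrow> Re (G k z) = integral (cbox 0 1) (u k z)" by metis
  have "\<exists>H. H holomorphic_on ball z0 \<rho> \<and> (\<forall>z\<in>ball z0 \<rho>. Re (H z) = complex_lyapunov \<alpha> (F z))"
  proof (rule Re_holomorphic_pointwise_limit[OF G_hol, where M=K])
    fix z assume z: "z \<in> ball z0 \<rho>"
    then have zR: "z \<in> ball z0 R" using sub by blast
    show "\<bar>Re (G k z)\<bar> \<le> K" for k
      using torus_integral_abs_le[OF u_cont[OF z] u_bound[OF z]] by (simp add: G_Re[OF z])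
    define l where "l = (\<lambda>k. mean_log_norm \<alpha> (F z) (Suc k * n))"
    have sm: "strict_mono (\<lambda>k. Suc k * n)" using n by (intro strict_monoI) simp
    have l: "l \<longlonglongrightarrow> complex_lyapunov \<alpha> (F z)"
      unfolding l_def using LIMSEQ_subseq_LIMSEQ[OF complex_lyapunov_limit(1)[OF coc[OF zR], of \<alpha>] sm] by (simp add: o_def)
    have close: "\<bar>Re (G k z) - l k\<bar> \<le> ln C / real (Suc k)" for k
    proof -
      define N where "N = Suc k * n"
      have N: "1 \<le> real N" using kn by (simp add: N_def)
      define w where "w = (\<lambda>x. ln (norm (complex_iter \<alpha> (F z) N x)) / real N)"
      have w_cont: "continuous_on (cbox 0 1) w"
        unfolding w_def using N by (intro continuous_intros continuous_log_norm_iter coc[OF zR]) auto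
      have "l k = integral (cbox 0 1) w"
        by (simp only: l_def mean_log_norm_def w_def N_def integral_divide)
      then have "Re (G k z) - l k = integral (cbox 0 1) (\<lambda>x. u k z x - w x)"
        using integral_diff[OF integrable_continuous[OF u_cont[OF z]] integrable_continuous[OF w_cont]] by (simp add: G_Re[OF z])
      also have "\<bar>\<dots>\<bar> \<le> ln C / real (Suc k)"
      proof (intro torus_integral_abs_le continuous_intros u_cont[OF z] w_cont)
        fix x
        have "\<bar>u k z x - w x\<bar> = \<bar>ln (cmod (\<psi> (Suc k) z x)) - ln (norm (complex_iter \<alpha> (F z) N x))\<bar> / real N"
          by (simp only: u_def w_def N_def diff_divide_distrib[symmetric] abs_divide abs_of_nat)
        also have "\<dots> \<le> ln C / real N"
          using log_close[OF z, of "Suc k" x] N by (intro divide_right_mono) (auto simp: N_def)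
        also have "\<dots> \<le> ln C / real (Suc k)"
        proof (rule divide_left_mono)
          have "Suc k * 1 \<le> Suc k * n" using n by (intro mult_le_mono) auto
          then show "real (Suc k) \<le> real N" by (simp only: N_def of_nat_le_iff mult_1_right)
          show "0 < real N * real (Suc k)" using N by (intro mult_pos_pos) auto
        qed (use C1 in auto)
        finally show "\<bar>u k z x - w x\<bar> \<le> ln C / real (Suc k)" .
      qed
      finally show ?thesis .
    qed
    have "(\<lambda>k. ln C / real (Suc k)) \<longlonglongrightarrow> 0"
      using tendsto_mult[OF tendsto_const[of "ln C"] LIMSEQ_inverse_real_of_nat] by (simp add: divide_inverse)
    then have "(\<lambda>k. Re (G k z) - l k) \<longlonglongrightarrow> 0"
      by (rule Lim_null_comparison[rotated]) (use close in auto)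
    then show "(\<lambda>k. Re (G k z)) \<longlonglongrightarrow> complex_lyapunov \<alpha> (F z)"
      using tendsto_add[OF _ l] by fastforce
  qed auto
  then show ?thesis using \<rho> R by (intro exI[of _ \<rho>]) auto
qed

section \<open>The sub-mean value property of the logarithm of the norm\<close>

text \<open>
The product of the \<open>m\<close> rotated copies of \<open>f\<close> takes the value \<open>f 0 ^ m\<close> at the origin. On the circle
the logarithm of its modulus is at most a sum of \<open>\<phi>\<close> over equidistant points, so the maximum modulus principle
gives a discrete sub-mean value inequality, whether or not \<open>f\<close> has zeros.
\<close>

lemma rotation_product_bound:
  fixes f :: "complex \<Rightarrow> complex" and \<phi> :: "real \<Rightarrow> real" and \<rho> :: real
  assumes hol: "f holomorphic_on ball 0 R" and \<rho>: "0 < \<rho>" "\<rho> < R" and m: "m > 0"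
    and bound: "\<And>\<theta>. cmod (f (\<rho> * cis \<theta>)) \<le> exp (\<phi> \<theta>)"
    and sup: "\<And>\<theta>. (\<Sum>k<m. \<phi> (\<theta> + 2 * pi * real k / real m)) \<le> real m * S"
  shows "cmod (f 0) \<le> exp S"
proof -
  define h where "h = (\<lambda>z. \<Prod>k<m. f (z * cis (2 * pi * real k / real m)))"
  have inball: "z * cis t \<in> ball 0 R" if "z \<in> ball 0 R" for z t
    using that by (simp add: norm_mult)
  have holh: "h holomorphic_on ball 0 R"
    unfolding h_def
    by (intro holomorphic_on_prod holomorphic_on_compose_gen[OF _ hol, unfolded o_def] holomorphic_intros)
       (use inball in auto)
  have sub: "cball 0 \<rho> \<subseteq> ball (0 :: complex) R" using \<rho> by auto
  have "cmod (h 0) \<le> exp (real m * S)"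
  proof (rule maximum_modulus_frontier[of h "cball 0 \<rho>"])
    show "h holomorphic_on interior (cball 0 \<rho>)"
      by (rule holomorphic_on_subset[OF holh]) (use sub interior_subset in blast)
    show "continuous_on (closure (cball 0 \<rho>)) h"
      by (rule continuous_on_subset[OF holomorphic_on_imp_continuous_on[OF holh]]) (use sub in auto)
    show "cmod (h z) \<le> exp (real m * S)" if z: "z \<in> frontier (cball 0 \<rho>)" for z
    proof -
      have nz: "cmod z = \<rho>" using z \<rho> by (simp add: frontier_cball)
      define \<theta> where "\<theta> = Arg z"
      have z_eq: "z = \<rho> * cis \<theta>" using nz rcis_cmod_Arg[of z] by (simp add: rcis_def \<theta>_def)
      have "cmod (h z) = (\<Prod>k<m. cmod (f (\<rho> * cis (\<theta> + 2 * pi * real k / real m))))"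
        by (simp add: h_def prod_norm[symmetric] z_eq cis_mult mult.assoc)
      also have "\<dots> \<le> (\<Prod>k<m. exp (\<phi> (\<theta> + 2 * pi * real k / real m)))"
        by (intro prod_mono) (use bound in auto)
      also have "\<dots> = exp (\<Sum>k<m. \<phi> (\<theta> + 2 * pi * real k / real m))" by (simp add: exp_sum)
      also have "\<dots> \<le> exp (real m * S)" using sup by simp
      finally show ?thesis .
    qed
  qed (use \<rho> in auto)
  moreover have "cmod (h 0) = cmod (f 0) ^ m" by (simp add: h_def norm_power)
  ultimately have "cmod (f 0) ^ m \<le> exp S ^ m" by (simp add: exp_of_nat_mult)
  then show ?thesis using m by (simp add: power_mono_iff)
qed

text \<open>
The estimate holds for all starting points \<open>\<theta>\<close> with the same \<open>m\<close>, as the maximum modulus principle requires.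
\<close>

lemma equidistant_sum_close_to_integral:
  fixes \<phi> :: "real \<Rightarrow> real"
  assumes cont: "continuous_on UNIV \<phi>" and per: "\<And>\<theta>. \<phi> (\<theta> + 2 * pi) = \<phi> \<theta>" and e: "e > 0"
  obtains m :: nat where "m > 0"
    "\<And>\<theta>. (\<Sum>k<m. \<phi> (\<theta> + 2 * pi * real k / real m)) \<le> real m * (integral {0..2 * pi} \<phi> / (2 * pi) + e)"
proof -
  have int: "\<phi> integrable_on {a..b}" for a b
    by (rule integrable_continuous_real) (rule continuous_on_subset[OF cont], auto)
  have "uniformly_continuous_on {0..8 * pi} \<phi>"
    by (intro compact_uniformly_continuous continuous_on_subset[OF cont]) auto
  then obtain d where d: "d > 0" "\<And>x y. x \<in> {0..8 * pi} \<Longrightarrow> y \<in> {0..8 * pi} \<Longrightarrow> \<bar>y - x\<bar> < d \<Longrightarrow> \<bar>\<phi> y - \<phi> x\<bar> < e"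
    using e unfolding uniformly_continuous_on_def dist_real_def by metis
  obtain m :: nat where m: "real m > 2 * pi / d" using reals_Archimedean2 by blast
  have m0: "m > 0" using m d(1) pi_gt_zero by (intro gr0I) (auto simp: divide_less_0_iff not_less[symmetric])
  define s where "s = 2 * pi / real m"
  have s: "0 < s" "s < d" "s \<le> 2 * pi" "real m * s = 2 * pi"
    using m m0 d(1) pi_gt_zero by (auto simp: s_def field_simps)
  \<comment> \<open>the starting point of the equidistant partition may be moved into one period\<close>
  have shift: "integral {a..a + 2 * pi} \<phi> = integral {0..2 * pi} \<phi>" if a: "0 \<le> a" "a < 2 * pi" for a
  proof -
    have "integral {a..a + 2 * pi} \<phi> = integral {a..2 * pi} \<phi> + integral {2 * pi..a + 2 * pi} \<phi>"
      using a int by (intro Henstock_Kurzweil_Integration.integral_combine[symmetric]) auto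
    also have "integral {2 * pi..a + 2 * pi} \<phi> = integral {0..a} \<phi>"
    proof -
      have "integral {0 + 2 * pi..a + 2 * pi} \<phi> = integral {0..a} (\<phi> \<circ> (+) (2 * pi))"
        by (rule integral_shift_Icc_real[symmetric])
      moreover have "\<phi> \<circ> (+) (2 * pi) = \<phi>" using per by (auto simp: o_def fun_eq_iff add.commute)
      ultimately show ?thesis by simp
    qed
    also have "integral {a..2 * pi} \<phi> + integral {0..a} \<phi> = integral {0..2 * pi} \<phi>"
      using a int Henstock_Kurzweil_Integration.integral_combine[of 0 a "2 * pi" \<phi>] by simp
    finally show ?thesis .
  qed
  have main: "(\<Sum>k<m. \<phi> (a + s * real k)) * s \<le> integral {0..2 * pi} \<phi> + e * (2 * pi)" if a: "0 \<le> a" "a < 2 * pi" for a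
  proof -
    have step: "(\<Sum>k<j. \<phi> (a + s * real k)) * s \<le> integral {a..a + s * real j} \<phi> + e * (s * real j)" if "j \<le> m" for j
      using that
    proof (induction j)
      case (Suc j)
      have sj: "s * real (Suc j) \<le> 2 * pi"
        using Suc.prems s by (metis mult.commute mult_left_mono of_nat_le_iff less_imp_le)
      have "integral {a + s * real j..a + s * real (Suc j)} (\<lambda>x. \<phi> (a + s * real j) - e) \<le> integral {a + s * real j..a + s * real (Suc j)} \<phi>"
      proof (rule integral_le)
        fix x assume x: "x \<in> {a + s * real j..a + s * real (Suc j)}"
        have "\<bar>\<phi> x - \<phi> (a + s * real j)\<bar> < e"
        proof (rule d(2))
          have "0 \<le> s * real j" "s * real (Suc j) = s * real j + s" using s(1) by (auto simp: algebra_simps)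
          moreover have "a + s * real j \<le> x" "x \<le> a + s * real (Suc j)" using x by auto
          ultimately have "0 \<le> a + s * real j" "a + s * real j \<le> 8 * pi" "0 \<le> x" "x \<le> 8 * pi"
            using a sj s(1) pi_gt_zero by linarith+
          then show "a + s * real j \<in> {0..8 * pi}" "x \<in> {0..8 * pi}" by auto
          show "\<bar>x - (a + s * real j)\<bar> < d" using x s by (auto simp: algebra_simps)
        qed
        then show "\<phi> (a + s * real j) - e \<le> \<phi> x" by linarith
      qed (use int in auto)
      then have "(\<phi> (a + s * real j) - e) * s \<le> integral {a + s * real j..a + s * real (Suc j)} \<phi>"
        using s(1) by (simp add: algebra_simps)
      moreover have "integral {a..a + s * real (Suc j)} \<phi> = integral {a..a + s * real j} \<phi> + integral {a + s * real j..a + s * real (Suc j)} \<phi>"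
        using s(1) int by (intro Henstock_Kurzweil_Integration.integral_combine[symmetric]) (auto simp: algebra_simps)
      ultimately show ?case using Suc by (simp add: algebra_simps)
    qed simp
    have "(\<Sum>k<m. \<phi> (a + s * real k)) * s \<le> integral {a..a + 2 * pi} \<phi> + e * (2 * pi)"
      using step[of m] s(4) by (simp add: mult.commute)
    then show ?thesis using shift[OF a] by simp
  qed
  have per_int: "\<phi> (\<theta> + 2 * pi * of_int j) = \<phi> \<theta>" for \<theta> and j :: int
  proof (induction j rule: int_induct[of _ 0])
    case (step1 i)
    then show ?case using per[of "\<theta> + 2 * pi * of_int i"] by (simp add: algebra_simps)
  next
    case (step2 i)
    then show ?case using per[of "\<theta> + 2 * pi * of_int (i - 1)"] by (simp add: algebra_simps)
  qed simp
  have "(\<Sum>k<m. \<phi> (\<theta> + 2 * pi * real k / real m)) \<le> real m * (integral {0..2 * pi} \<phi> / (2 * pi) + e)" for \<theta>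
  proof -
    define j where "j = \<lfloor>\<theta> / (2 * pi)\<rfloor>"
    define a where "a = \<theta> - 2 * pi * of_int j"
    have "of_int j \<le> \<theta> / (2 * pi)" "\<theta> / (2 * pi) < of_int j + 1" by (auto simp: j_def)
    then have a: "0 \<le> a" "a < 2 * pi" using pi_gt_zero by (auto simp: a_def field_simps)
    have "\<phi> (\<theta> + 2 * pi * real k / real m) = \<phi> (a + s * real k)" for k
      using per_int[of "a + s * real k" j] by (simp add: a_def s_def algebra_simps)
    then have "(\<Sum>k<m. \<phi> (\<theta> + 2 * pi * real k / real m)) * s \<le> integral {0..2 * pi} \<phi> + e * (2 * pi)"
      using main[OF a] by simp
    then have "real m * ((\<Sum>k<m. \<phi> (\<theta> + 2 * pi * real k / real m)) * s) \<le> real m * (integral {0..2 * pi} \<phi> + e * (2 * pi))"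
      by (intro mult_left_mono) auto
    moreover have "real m * (c * s) = c * (2 * pi)" for c using s(4) by (simp add: mult.commute mult.left_commute)
    ultimately have "(\<Sum>k<m. \<phi> (\<theta> + 2 * pi * real k / real m)) * (2 * pi) \<le> real m * (integral {0..2 * pi} \<phi> + e * (2 * pi))"
      by simp
    then show ?thesis using pi_gt_zero by (simp add: field_simps)
  qed
  then show ?thesis using that m0 by blast
qed

text \<open>
The Frobenius norm of \<open>M z\<close> dominates the modulus of the inner product \<open>f z\<close> of \<open>M z\<close> with the unit vector
in the direction of \<open>M 0\<close>. This scalar function is holomorphic and equals the norm at \<open>z = 0\<close>.
\<close>

lemma log_norm_sub_mean_value:
  fixes M :: "complex \<Rightarrow> complex ^ 2 ^ 2" and \<rho> :: real
  assumes hol: "\<And>i j. (\<lambda>z. M z $ i $ j) holomorphic_on ball 0 R" and \<rho>: "0 < \<rho>" "\<rho> < R"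
    and nz: "\<And>z. z \<in> ball 0 R \<Longrightarrow> M z \<noteq> 0"
  shows "ln (norm (M 0)) \<le> integral {0..2 * pi} (\<lambda>\<theta>. ln (norm (M (\<rho> * cis \<theta>)))) / (2 * pi)"
proof (rule field_le_epsilon)
  fix e :: real assume e: "e > 0"
  define \<phi> where "\<phi> = (\<lambda>\<theta>. ln (norm (M (\<rho> * cis \<theta>))))"
  have in_ball: "complex_of_real \<rho> * cis \<theta> \<in> ball 0 R" for \<theta> using \<rho> by (simp add: norm_mult)
  have M_cont: "continuous_on (ball 0 R) M"
  proof -
    have "continuous_on (ball 0 R) (\<lambda>z. \<chi> i j. M z $ i $ j)"
      by (intro continuous_on_vec_lambda holomorphic_on_imp_continuous_on hol)
    then show ?thesis by simp
  qed
  have "continuous_on UNIV (\<lambda>\<theta>. M (\<rho> * cis \<theta>))"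
    by (rule continuous_on_compose2[OF M_cont]) (use in_ball in \<open>auto intro!: continuous_intros continuous_on_cis\<close>)
  then have "continuous_on UNIV \<phi>" unfolding \<phi>_def using nz[OF in_ball] by (auto intro!: continuous_intros)
  moreover have "\<phi> (\<theta> + 2 * pi) = \<phi> \<theta>" for \<theta> by (simp add: \<phi>_def cis_mult[symmetric])
  ultimately obtain m :: nat where m: "m > 0"
    "\<And>\<theta>. (\<Sum>k<m. \<phi> (\<theta> + 2 * pi * real k / real m)) \<le> real m * (integral {0..2 * pi} \<phi> / (2 * pi) + e)"
    using equidistant_sum_close_to_integral[OF _ _ e] by blast
  define c where "c = norm (M 0)"
  have c: "c > 0" using nz[of 0] \<rho> by (simp add: c_def)
  define f where "f = (\<lambda>z. (cnj (M 0 $ 1 $ 1) * M z $ 1 $ 1 + cnj (M 0 $ 1 $ 2) * M z $ 1 $ 2 +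
      (cnj (M 0 $ 2 $ 1) * M z $ 2 $ 1 + cnj (M 0 $ 2 $ 2) * M z $ 2 $ 2)) / of_real c)"
  have f_le: "cmod (f z) \<le> norm (M z)" for z
  proof -
    define a where "a = cmod (cnj (M 0 $ 1 $ 1) * M z $ 1 $ 1 + cnj (M 0 $ 1 $ 2) * M z $ 1 $ 2)"
    define b where "b = cmod (cnj (M 0 $ 2 $ 1) * M z $ 2 $ 1 + cnj (M 0 $ 2 $ 2) * M z $ 2 $ 2)"
    have row1: "a \<le> norm (M 0 $ 1) * norm (M z $ 1)"
      using cmod_dot2_le[of "cnj (M 0 $ 1 $ 1)" "M z $ 1 $ 1" "cnj (M 0 $ 1 $ 2)" "M z $ 1 $ 2"]
      by (intro power2_le_imp_le[of a]) (auto simp: a_def power_mult_distrib norm_complex_vec2)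
    have row2: "b \<le> norm (M 0 $ 2) * norm (M z $ 2)"
      using cmod_dot2_le[of "cnj (M 0 $ 2 $ 1)" "M z $ 2 $ 1" "cnj (M 0 $ 2 $ 2)" "M z $ 2 $ 2"]
      by (intro power2_le_imp_le[of b]) (auto simp: b_def power_mult_distrib norm_complex_vec2)
    have "a + b \<le> norm (M 0) * norm (M z)"
    proof (rule power2_le_imp_le)
      define p q r s where "p = norm (M 0 $ 1)" and "q = norm (M 0 $ 2)" and "r = norm (M z $ 1)" and "s = norm (M z $ 2)"
      have "(a + b)\<^sup>2 \<le> (p * r + q * s)\<^sup>2"
        using row1 row2 by (intro power_mono add_mono) (auto simp: a_def b_def p_def q_def r_def s_def)
      also have "\<dots> \<le> (p\<^sup>2 + q\<^sup>2) * (r\<^sup>2 + s\<^sup>2)"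
        using zero_le_power2[of "p * s - q * r"] by (simp add: power2_eq_square algebra_simps)
      also have "\<dots> = (norm (M 0) * norm (M z))\<^sup>2"
        unfolding p_def q_def r_def s_def power_mult_distrib norm_complex_mat2 norm_complex_vec2 by (simp add: add.assoc)
      finally show "(a + b)\<^sup>2 \<le> (norm (M 0) * norm (M z))\<^sup>2" .
    qed simp
    moreover have "cmod (f z) \<le> (a + b) / c"
      using c norm_triangle_ineq unfolding f_def a_def b_def by (auto simp: norm_divide intro!: divide_right_mono)
    ultimately have "cmod (f z) \<le> norm (M 0) * norm (M z) / c"
      using c by (meson divide_right_mono less_imp_le order_trans)
    moreover have "norm (M 0) * norm (M z) / c = norm (M z)" using c by (simp add: c_def)
    ultimately show ?thesis by simp
  qed
  have f0: "f 0 = of_real c"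
  proof -
    have "cnj w * w = of_real ((cmod w)\<^sup>2)" for w by (metis complex_norm_square mult.commute)
    then have "f 0 = of_real ((norm (M 0))\<^sup>2) / of_real c"
      unfolding f_def norm_complex_mat2 by simp
    then show ?thesis using c by (simp add: c_def power2_eq_square)
  qed
  have "cmod (f 0) \<le> exp (integral {0..2 * pi} \<phi> / (2 * pi) + e)"
  proof (rule rotation_product_bound[OF _ \<rho> m(1) _ m(2)])
    show "f holomorphic_on ball 0 R" unfolding f_def using c by (intro holomorphic_intros hol) auto
    show "cmod (f (complex_of_real \<rho> * cis \<theta>)) \<le> exp (\<phi> \<theta>)" for \<theta>
      using f_le[of "complex_of_real \<rho> * cis \<theta>"] nz[OF in_ball[of \<theta>]] by (simp add: \<phi>_def)
  qed
  then have "c \<le> exp (integral {0..2 * pi} \<phi> / (2 * pi) + e)" using c f0 by simp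
  then have "ln c \<le> integral {0..2 * pi} \<phi> / (2 * pi) + e" using c by (metis ln_exp ln_mono)
  then show "ln (norm (M 0)) \<le> integral {0..2 * pi} (\<lambda>\<theta>. ln (norm (M (\<rho> * cis \<theta>)))) / (2 * pi) + e"
    by (simp add: c_def \<phi>_def)
qed

section \<open>Complexification of an analytic family of cocycles\<close>

text \<open>
All identities for the complexified cocycle are transported from real arguments by this lemma.
\<close>

lemma holomorphic_eq_if_eq_on_reals:
  assumes "f holomorphic_on S" "g holomorphic_on S" and S: "open S" "connected S" and a: "complex_of_real a \<in> S"
    and eq: "\<And>t :: real. of_real t \<in> S \<Longrightarrow> f (of_real t) = g (of_real t)" and z: "z \<in> S"
  shows "f z = g z"
proof -
  have lim: "complex_of_real a islimpt S \<inter> \<real>"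
    unfolding islimpt_approachable
  proof (intro allI impI)
    fix e :: real assume "e > 0"
    obtain d where d: "d > 0" "ball (of_real a) d \<subseteq> S" using S(1) a openE by blast
    define t where "t = a + min d e / 2"
    have "dist (complex_of_real t) (of_real a) = min d e / 2"
      using d \<open>e > 0\<close> by (simp add: t_def dist_norm flip: of_real_diff)
    then have "dist (complex_of_real t) (of_real a) < d" "dist (complex_of_real t) (of_real a) < e" "t \<noteq> a"
      using d \<open>e > 0\<close> by (auto simp: t_def)
    then show "\<exists>x'\<in>S \<inter> \<real>. x' \<noteq> complex_of_real a \<and> dist x' (complex_of_real a) < e"
      using d(2) by (intro bexI[of _ "of_real t"]) (auto simp: dist_commute)
  qed
  have "(\<lambda>z. f z - g z) z = 0"
    by (rule analytic_continuation[of "\<lambda>z. f z - g z" S "S \<inter> \<real>"])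
       (use assms lim in \<open>auto intro!: holomorphic_intros elim!: Reals_cases\<close>)
  then show ?thesis by simp
qed

text \<open>
\<open>E s x z\<close> extends \<open>f s (x + z w)\<close> to complex \<open>s\<close> and \<open>z\<close>. The base point \<open>x\<close> stays real, and the set \<open>U\<close>
of base points is a parameter so that local extensions can be glued.
\<close>

definition complexifies ::
    "(real \<Rightarrow> real ^ 'n \<Rightarrow> real) \<Rightarrow> real ^ 'n \<Rightarrow> real \<Rightarrow> (real ^ 'n) set \<Rightarrow> real \<Rightarrow>
      (complex \<Rightarrow> real ^ 'n \<Rightarrow> complex \<Rightarrow> complex) \<Rightarrow> bool" where
  "complexifies f w s0 U R E \<longleftrightarrow>
     continuous_on (ball (of_real s0) R \<times> U \<times> ball 0 R) (\<lambda>(s, x, z). E s x z) \<and>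
     (\<forall>x\<in>U. \<forall>z\<in>ball 0 R. (\<lambda>s. E s x z) holomorphic_on ball (of_real s0) R) \<and>
     (\<forall>x\<in>U. \<forall>s\<in>ball (of_real s0) R. E s x holomorphic_on ball 0 R) \<and>
     (\<forall>x\<in>U. \<forall>s t. \<bar>s - s0\<bar> < R \<longrightarrow> \<bar>t\<bar> < R \<longrightarrow> E (of_real s) x (of_real t) = of_real (f s (x + t *\<^sub>R w)))"

text \<open>
Identity theorem, applied first in the time \<open>z\<close> for real \<open>s\<close> and then in \<open>s\<close>.
\<close>

lemma complexifies_unique:
  assumes E: "complexifies f w s0 U R E" "x \<in> U" and E': "complexifies f w s0 U' R E'" "x \<in> U'"
    and s: "s \<in> ball (of_real s0) R" and z: "z \<in> ball 0 R"
  shows "E s x z = E' s x z"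
proof -
  have R: "R > 0" using z by (metis ball_empty empty_iff not_le)
  have real_s: "E (of_real s) x z = E' (of_real s) x z" if s: "\<bar>s - s0\<bar> < R" for s
  proof (rule holomorphic_eq_if_eq_on_reals[of "E (of_real s) x" "ball 0 R" "E' (of_real s) x" 0])
    have "complex_of_real s \<in> ball (of_real s0) R"
      using s by (simp add: dist_norm abs_minus_commute flip: of_real_diff)
    then show "E (of_real s) x holomorphic_on ball 0 R" "E' (of_real s) x holomorphic_on ball 0 R"
      using E E' by (auto simp: complexifies_def)
    show "E (of_real s) x (of_real t) = E' (of_real s) x (of_real t)" if "complex_of_real t \<in> ball 0 R" for t
      using E E' s that by (simp add: complexifies_def)
  qed (use R z in auto)
  show ?thesis
  proof (rule holomorphic_eq_if_eq_on_reals[of "\<lambda>s. E s x z" "ball (of_real s0) R" "\<lambda>s. E' s x z" s0])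
    show "(\<lambda>s. E s x z) holomorphic_on ball (of_real s0) R" "(\<lambda>s. E' s x z) holomorphic_on ball (of_real s0) R"
      using E E' z by (auto simp: complexifies_def)
    show "E (of_real t) x z = E' (of_real t) x z" if "complex_of_real t \<in> ball (of_real s0) R" for t
      using that by (intro real_s) (simp add: dist_norm abs_minus_commute flip: of_real_diff)
  qed (use R s in auto)
qed

text \<open>
Convergence of the power series at the point all of whose coordinates are \<open>\<rho>0\<close> is absolute and
hence dominates the series at all complex points with coordinates of modulus at most \<open>\<rho>0\<close>. The complex
coordinates of the point \<open>(s, x + z w)\<close> relative to the centre are the \<open>\<xi> b s x z\<close> below.
\<close>

lemma power_series_complexifies:
  fixes f :: "real \<Rightarrow> real ^ 'n \<Rightarrow> real" and c :: "(real \<times> (real ^ 'n) \<Rightarrow> nat) \<Rightarrow> real"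
  assumes r: "r > 0"
    and series: "\<And>q. q \<in> ball (s0, x0) r \<Longrightarrow>
      ((\<lambda>k. (\<Prod>b\<in>Basis. ((q - (s0, x0)) \<bullet> b) ^ k b) * c k) has_sum f (fst q) (snd q)) (Basis \<rightarrow>\<^sub>E UNIV)"
  shows "\<exists>\<rho>>0. \<exists>E. complexifies f w s0 (ball x0 \<rho>) \<rho> E"
proof -
  define X :: "(real \<times> (real ^ 'n) \<Rightarrow> nat) set" where "X = Basis \<rightarrow>\<^sub>E UNIV"
  define d where "d = real DIM(real \<times> (real ^ 'n))"
  have d: "d \<ge> 1" unfolding d_def by (metis DIM_ge_Suc0 One_nat_def of_nat_1 of_nat_le_iff)
  define \<rho>0 where "\<rho>0 = r / (2 * d)"
  have \<rho>0: "0 < \<rho>0" "\<rho>0 \<le> r"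
    using r d by (auto simp: \<rho>0_def divide_le_eq)
  define q0 where "q0 = (s0, x0) + (\<Sum>b\<in>Basis. \<rho>0 *\<^sub>R b)"
  have "norm (\<Sum>b\<in>(Basis :: (real \<times> (real ^ 'n)) set). \<rho>0 *\<^sub>R b) \<le> (\<Sum>b\<in>(Basis :: (real \<times> (real ^ 'n)) set). \<rho>0)"
    by (rule sum_norm_le) (use \<rho>0 in auto)
  also have "\<dots> = d * \<rho>0" by (simp only: sum_constant d_def)
  also have "\<dots> = r / 2" using d by (simp add: \<rho>0_def)
  also have "\<dots> < r" using r by simp
  finally have "q0 \<in> ball (s0, x0) r" by (simp add: q0_def dist_norm)
  from series[OF this] have "(\<lambda>k. (\<Prod>b\<in>Basis. ((q0 - (s0, x0)) \<bullet> b) ^ k b) * c k) summable_on X"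
    unfolding X_def by (rule has_sum_imp_summable)
  moreover have "(q0 - (s0, x0)) \<bullet> b = \<rho>0" if "b \<in> Basis" for b
    using that by (simp add: q0_def inner_sum_left inner_Basis if_distrib sum.delta cong: if_cong)
  ultimately have "(\<lambda>k. (\<Prod>b\<in>Basis. \<rho>0 ^ k b) * c k) summable_on X" by simp
  then have summ: "(\<lambda>k. \<bar>(\<Prod>b\<in>Basis. \<rho>0 ^ k b) * c k\<bar>) summable_on X"
    by (rule summable_on_iff_abs_summable_on_real[THEN iffD1, unfolded real_norm_def])
  define \<xi> where "\<xi> = (\<lambda>(b :: real \<times> (real ^ 'n)) s x z. (s - of_real s0) * of_real ((1, 0) \<bullet> b)
      + of_real ((0, x - x0) \<bullet> b) + z * of_real ((0, w) \<bullet> b) :: complex)"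
  \<comment> \<open>each coordinate of the displacement is at most \<open>|s - s0| + |x - x0| + |z| |w|\<close>\<close>
  define \<rho> where "\<rho> = \<rho>0 / (2 + norm w)"
  have \<rho>: "\<rho> > 0" "\<rho> * (2 + norm w) = \<rho>0"
  proof -
    have "2 + norm w > 0" using norm_ge_zero[of w] by linarith
    then show "\<rho> > 0" "\<rho> * (2 + norm w) = \<rho>0" using \<rho>0 by (auto simp: \<rho>_def)
  qed
  define S where "S = cball (complex_of_real s0) \<rho> \<times> cball x0 \<rho> \<times> cball (0 :: complex) \<rho>"
  have \<xi>_bound: "cmod (\<xi> b s x z) \<le> \<rho>0" if "b \<in> Basis" "(s, x, z) \<in> S" for b s x z
  proof -
    have inner_le: "\<bar>v \<bullet> b\<bar> \<le> norm v" for v using Basis_le_norm[OF that(1)] .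
    have "cmod (\<xi> b s x z) \<le> cmod (s - of_real s0) * \<bar>(1, 0) \<bullet> b\<bar> + \<bar>(0, x - x0) \<bullet> b\<bar> + cmod z * \<bar>(0, w) \<bullet> b\<bar>"
      unfolding \<xi>_def by (intro norm_triangle_le add_mono) (auto simp: norm_mult)
    also have "\<dots> \<le> \<rho> * norm (1 :: real, 0 :: real ^ 'n) + norm (0 :: real, x - x0) + \<rho> * norm (0 :: real, w)"
      using that(2) \<rho>(1) by (intro add_mono mult_mono inner_le) (auto simp: S_def dist_norm norm_minus_commute)
    also have "\<dots> \<le> \<rho> * 1 + \<rho> + \<rho> * norm w"
      using that(2) by (auto simp: S_def dist_norm norm_minus_commute norm_Pair)
    also have "\<dots> = \<rho>0" using \<rho>(2) by (simp add: algebra_simps)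
    finally show ?thesis .
  qed
  define monomial where "monomial = (\<lambda>k s x z. (\<Prod>b\<in>Basis. \<xi> b s x z ^ k b) * complex_of_real (c k))"
  define E where "E = (\<lambda>s x z. \<Sum>\<^sub>\<infinity>k\<in>X. monomial k s x z)"
  have monomial_bound: "norm (monomial k s x z) \<le> \<bar>(\<Prod>b\<in>Basis. \<rho>0 ^ k b) * c k\<bar>" if "(s, x, z) \<in> S" for k s x z
  proof -
    have "norm (monomial k s x z) = (\<Prod>b\<in>Basis. cmod (\<xi> b s x z) ^ k b) * \<bar>c k\<bar>"
      by (simp add: monomial_def norm_mult prod_norm[symmetric] norm_power)
    also have "\<dots> \<le> (\<Prod>b\<in>Basis. \<rho>0 ^ k b) * \<bar>c k\<bar>"
      using \<xi>_bound[OF _ that] by (intro mult_right_mono prod_mono) (auto intro!: power_mono)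
    also have "\<dots> = \<bar>(\<Prod>b\<in>Basis. \<rho>0 ^ k b) * c k\<bar>" using \<rho>0 by (simp add: abs_mult prod_nonneg)
    finally show ?thesis .
  qed
  have unif: "uniform_limit S (\<lambda>F y. \<Sum>k\<in>F. (\<lambda>(s, x, z). monomial k s x z) y) (\<lambda>y. \<Sum>\<^sub>\<infinity>k\<in>X. (\<lambda>(s, x, z). monomial k s x z) y) (finite_subsets_at_top X)"
    by (rule Weierstrass_m_test_general[OF _ summ]) (use monomial_bound in auto)
  have ntriv: "\<not> trivial_limit (finite_subsets_at_top X)" by simp
  have cont_S: "continuous_on S (\<lambda>(s, x, z). E s x z)"
  proof -
    have "continuous_on S (\<lambda>y. \<Sum>\<^sub>\<infinity>k\<in>X. (\<lambda>(s, x, z). monomial k s x z) y)"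
    proof (rule uniform_limit_theorem[OF _ unif ntriv], intro always_eventually allI)
      show "continuous_on S (\<lambda>y. \<Sum>k\<in>F. (\<lambda>(s, x, z). monomial k s x z) y)" for F
        unfolding monomial_def \<xi>_def case_prod_beta by (intro continuous_intros)
    qed
    then show ?thesis by (simp add: E_def case_prod_beta)
  qed
  have hol_s: "(\<lambda>s. E s x z) holomorphic_on ball (of_real s0) \<rho>" if "x \<in> ball x0 \<rho>" "z \<in> ball 0 \<rho>" for x z
  proof -
    have ul: "uniform_limit (cball (of_real s0) \<rho>) (\<lambda>F s. \<Sum>k\<in>F. monomial k s x z) (\<lambda>s. E s x z) (finite_subsets_at_top X)"
      unfolding E_def by (rule Weierstrass_m_test_general[OF _ summ]) (use monomial_bound that in \<open>auto simp: S_def\<close>)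
    show ?thesis
      by (rule holomorphic_uniform_limit[OF _ ul ntriv])
         (auto intro!: always_eventually continuous_intros holomorphic_intros simp: monomial_def \<xi>_def)
  qed
  have hol_z: "E s x holomorphic_on ball 0 \<rho>" if "x \<in> ball x0 \<rho>" "s \<in> ball (of_real s0) \<rho>" for x s
  proof -
    have ul: "uniform_limit (cball 0 \<rho>) (\<lambda>F z. \<Sum>k\<in>F. monomial k s x z) (E s x) (finite_subsets_at_top X)"
      unfolding E_def by (rule Weierstrass_m_test_general[OF _ summ]) (use monomial_bound that in \<open>auto simp: S_def\<close>)
    show ?thesis
      by (rule holomorphic_uniform_limit[OF _ ul ntriv])
         (auto intro!: always_eventually continuous_intros holomorphic_intros simp: monomial_def \<xi>_def)
  qed
  have real: "E (of_real s) x (of_real t) = of_real (f s (x + t *\<^sub>R w))"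
    if x: "x \<in> ball x0 \<rho>" and s: "\<bar>s - s0\<bar> < \<rho>" and t: "\<bar>t\<bar> < \<rho>" for s x t
  proof -
    define q where "q = (s, x + t *\<^sub>R w)"
    have "norm (q - (s0, x0)) \<le> norm (s - s0) + norm (x + t *\<^sub>R w - x0)"
      unfolding q_def using norm_Pair_le[of "s - s0" "x + t *\<^sub>R w - x0"] by simp
    also have "\<dots> \<le> \<bar>s - s0\<bar> + (norm (x - x0) + \<bar>t\<bar> * norm w)"
      using norm_triangle_ineq[of "x - x0" "t *\<^sub>R w"] by (simp add: algebra_simps)
    also have "\<dots> < \<rho> + (\<rho> + \<rho> * norm w)"
      using x s t by (intro add_less_le_mono add_mono mult_right_mono) (auto simp: dist_norm norm_minus_commute)
    also have "\<dots> = \<rho>0" using \<rho>(2) by (simp add: algebra_simps)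
    finally have "q \<in> ball (s0, x0) r" using \<rho>0 by (simp add: dist_norm norm_minus_commute)
    from series[OF this] have "((\<lambda>k. of_real ((\<Prod>b\<in>Basis. ((q - (s0, x0)) \<bullet> b) ^ k b) * c k) :: complex) has_sum of_real (f s (x + t *\<^sub>R w))) X"
      unfolding X_def by (intro has_sum_of_real) (simp add: q_def)
    moreover have "of_real ((\<Prod>b\<in>Basis. ((q - (s0, x0)) \<bullet> b) ^ k b) * c k) = monomial k (of_real s) x (of_real t)" for k
    proof -
      have "\<xi> b (of_real s) x (of_real t) = of_real ((q - (s0, x0)) \<bullet> b)" for b
        unfolding \<xi>_def q_def by (cases b) (simp add: inner_add_left inner_diff_left algebra_simps)
      then show ?thesis by (simp add: monomial_def)
    qed
    ultimately show ?thesis unfolding E_def by (simp add: infsumI)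
  qed
  have "complexifies f w s0 (ball x0 \<rho>) \<rho> E"
    unfolding complexifies_def
    using continuous_on_subset[OF cont_S, of "ball (of_real s0) \<rho> \<times> ball x0 \<rho> \<times> ball 0 \<rho>"] hol_s hol_z real
    by (auto simp: S_def less_imp_le subset_iff)
  then show ?thesis using \<rho>(1) by blast
qed

lemma complexifies_subset:
  assumes E: "complexifies f w s0 U R E" and sub: "U' \<subseteq> U" "R' \<le> R"
  shows "complexifies f w s0 U' R' E"
proof -
  have balls: "ball (complex_of_real s0) R' \<subseteq> ball (of_real s0) R" "ball (0 :: complex) R' \<subseteq> ball 0 R" using sub by auto
  have "continuous_on (ball (of_real s0) R' \<times> U' \<times> ball 0 R') (\<lambda>(s, x, z). E s x z)"
    by (rule continuous_on_subset[of "ball (of_real s0) R \<times> U \<times> ball 0 R"])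
       (use E balls sub in \<open>auto simp: complexifies_def\<close>)
  moreover have "(\<lambda>s. E s x z) holomorphic_on ball (of_real s0) R'" if "x \<in> U'" "z \<in> ball 0 R'" for x z
    by (rule holomorphic_on_subset[OF _ balls(1)]) (use E that balls sub in \<open>auto simp: complexifies_def\<close>)
  moreover have "E s x holomorphic_on ball 0 R'" if "x \<in> U'" "s \<in> ball (of_real s0) R'" for x s
    by (rule holomorphic_on_subset[OF _ balls(2)]) (use E that balls sub in \<open>auto simp: complexifies_def\<close>)
  moreover have "E (of_real s) x (of_real t) = of_real (f s (x + t *\<^sub>R w))"
    if "x \<in> U'" "\<bar>s - s0\<bar> < R'" "\<bar>t\<bar> < R'" for x s t
  proof -
    have "\<bar>s - s0\<bar> < R" "\<bar>t\<bar> < R" "x \<in> U" using that sub by auto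
    then show ?thesis using E by (simp add: complexifies_def)
  qed
  ultimately show ?thesis unfolding complexifies_def by blast
qed

lemma complexifies_translate:
  assumes E: "complexifies f w s0 U R E"
    and per: "\<And>s x. \<bar>s - s0\<bar> < R \<Longrightarrow> f s (x + k) = f s x"
  shows "complexifies f w s0 ((\<lambda>x. x - k) ` U) R (\<lambda>s x. E s (x + k))"
proof -
  have "continuous_on (ball (of_real s0) R \<times> (\<lambda>x. x - k) ` U \<times> ball 0 R) (\<lambda>y. (\<lambda>(s, x, z). E s x z) (fst y, fst (snd y) + k, snd (snd y)))"
    by (rule continuous_on_compose2[of "ball (of_real s0) R \<times> U \<times> ball 0 R"])
       (use E in \<open>auto simp: complexifies_def intro!: continuous_intros\<close>)
  then have "continuous_on (ball (of_real s0) R \<times> (\<lambda>x. x - k) ` U \<times> ball 0 R) (\<lambda>(s, x, z). E s (x + k) z)"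
    by (simp add: case_prod_beta)
  moreover have "(\<lambda>s. E s (x + k) z) holomorphic_on ball (of_real s0) R" if "x \<in> (\<lambda>x. x - k) ` U" "z \<in> ball 0 R" for x z
    using that E by (auto simp: complexifies_def)
  moreover have "E s (x + k) holomorphic_on ball 0 R" if "x \<in> (\<lambda>x. x - k) ` U" "s \<in> ball (of_real s0) R" for x s
    using that E by (auto simp: complexifies_def)
  moreover have "E (of_real s) (x + k) (of_real t) = of_real (f s (x + t *\<^sub>R w))"
    if "x \<in> (\<lambda>x. x - k) ` U" "\<bar>s - s0\<bar> < R" "\<bar>t\<bar> < R" for x s t
  proof -
    have "E (of_real s) (x + k) (of_real t) = of_real (f s (x + k + t *\<^sub>R w))"
      using that E by (auto simp: complexifies_def)
    also have "x + k + t *\<^sub>R w = x + t *\<^sub>R w + k" by simp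
    finally show ?thesis using per[OF that(2)] by simp
  qed
  ultimately show ?thesis unfolding complexifies_def by blast
qed

text \<open>
Local extensions exist with a common radius by compactness of the unit cube and periodicity. They
agree where they overlap, so they glue to one extension over the whole torus.
\<close>

lemma complexifies_global:
  fixes f :: "real \<Rightarrow> real ^ 'n \<Rightarrow> real"
  assumes R0: "R0 > 0"
    and per: "\<And>s. \<bar>s - s0\<bar> < R0 \<Longrightarrow> torus_periodic (f s)"
    and loc: "\<And>x0. \<exists>\<rho>>0. \<exists>E. complexifies f w s0 (ball x0 \<rho>) \<rho> E"
  shows "\<exists>R>0. R \<le> R0 \<and> (\<exists>E. complexifies f w s0 UNIV R E)"
proof -
  obtain \<rho> where \<rho>: "\<And>x0. \<rho> x0 > 0" "\<And>x0. \<exists>E. complexifies f w s0 (ball x0 (\<rho> x0)) (\<rho> x0) E"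
    using loc by metis
  have cover: "cbox 0 (1 :: real ^ 'n) \<subseteq> (\<Union>x\<in>cbox 0 1. ball x (\<rho> x / 2))" using \<rho>(1) by auto
  obtain T where T: "T \<subseteq> cbox 0 1" "finite T" "cbox 0 (1 :: real ^ 'n) \<subseteq> (\<Union>x\<in>T. ball x (\<rho> x / 2))"
    by (rule compactE_image[of "cbox 0 (1 :: real ^ 'n)" "cbox 0 1" "\<lambda>x. ball x (\<rho> x / 2)"])
       (use cover in auto)
  have "T \<noteq> {}"
  proof -
    have "(0 :: real ^ 'n) \<in> cbox 0 1" by (simp add: mem_box_cart)
    then show ?thesis using T(3) by auto
  qed
  define R where "R = min R0 (Min (\<rho> ` T) / 2)"
  have R: "R > 0" "R \<le> R0" "\<And>x. x \<in> T \<Longrightarrow> R \<le> \<rho> x / 2"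
  proof -
    show "R > 0" "R \<le> R0" using R0 \<rho>(1) T(2) \<open>T \<noteq> {}\<close> by (auto simp: R_def)
    show "R \<le> \<rho> x / 2" if "x \<in> T" for x
    proof -
      have "Min (\<rho> ` T) \<le> \<rho> x" using that T(2) by simp
      then show ?thesis by (simp add: R_def)
    qed
  qed
  have "\<exists>E. complexifies f w s0 (ball x R) R E" for x
  proof -
    obtain k where k: "\<forall>i. k $ i \<in> \<int>" "x + k \<in> cbox 0 1" by (rule integer_translate_into_cube)
    then obtain x0 where x0: "x0 \<in> T" "x + k \<in> ball x0 (\<rho> x0 / 2)" using T(3) by blast
    obtain E where "complexifies f w s0 (ball x0 (\<rho> x0)) (\<rho> x0) E" using \<rho>(2) by blast
    moreover have "ball (x + k) R \<subseteq> ball x0 (\<rho> x0)"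
    proof
      fix y assume "y \<in> ball (x + k) R"
      then show "y \<in> ball x0 (\<rho> x0)"
        using x0 R(3)[OF x0(1)] dist_triangle[of x0 y "x + k"] by simp
    qed
    moreover have "R \<le> \<rho> x0" using R(3)[OF x0(1)] \<rho>(1)[of x0] by linarith
    ultimately have "complexifies f w s0 (ball (x + k) R) R E" by (rule complexifies_subset)
    then have "complexifies f w s0 ((\<lambda>x. x - k) ` ball (x + k) R) R (\<lambda>s x. E s (x + k))"
      by (rule complexifies_translate) (use per R k in \<open>auto simp: torus_periodic_def\<close>)
    moreover have "ball x R \<subseteq> (\<lambda>x. x - k) ` ball (x + k) R"
    proof
      fix y assume "y \<in> ball x R"
      then show "y \<in> (\<lambda>x. x - k) ` ball (x + k) R"
        by (intro image_eqI[of _ _ "y + k"]) (auto simp: dist_norm)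
    qed
    ultimately show ?thesis using complexifies_subset by blast
  qed
  then obtain E where E: "\<And>x. complexifies f w s0 (ball x R) R (E x)" by metis
  define A where "A = (\<lambda>s x z. E x s x z)"
  have A_eq: "A s x z = E x1 s x z" if "x \<in> ball x1 R" "s \<in> ball (of_real s0) R" "z \<in> ball 0 R" for s x z x1
    unfolding A_def by (rule complexifies_unique[OF E _ E]) (use that R in auto)
  have "continuous_on (\<Union>x1. ball (of_real s0) R \<times> ball x1 R \<times> ball 0 R) (\<lambda>(s, x, z). A s x z)"
  proof (rule continuous_on_open_UN)
    fix x1
    have "continuous_on (ball (of_real s0) R \<times> ball x1 R \<times> ball 0 R) (\<lambda>(s, x, z). E x1 s x z)"
      using E by (simp add: complexifies_def)
    then show "continuous_on (ball (of_real s0) R \<times> ball x1 R \<times> ball 0 R) (\<lambda>(s, x, z). A s x z)"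
      by (rule continuous_on_eq) (use A_eq in auto)
  qed (auto intro!: open_Times)
  moreover have "(\<Union>x1. ball (of_real s0) R \<times> ball x1 R \<times> ball 0 R) = ball (complex_of_real s0) R \<times> (UNIV :: (real ^ 'n) set) \<times> ball (0 :: complex) R"
    using R(1) by (auto intro: centre_in_ball[THEN iffD2])
  moreover have "x \<in> ball x R" for x :: "real ^ 'n" using R(1) by simp
  ultimately have "complexifies f w s0 UNIV R A"
    using E unfolding complexifies_def A_def by auto
  then show ?thesis using R by blast
qed

definition complex_matrix :: "real ^ 2 ^ 2 \<Rightarrow> real ^ 2 ^ 2 \<Rightarrow> complex ^ 2 ^ 2" where
  "complex_matrix P Q = (\<chi> i j. Complex (P $ i $ j) (Q $ i $ j))"

lemma complex_matrix_entry [simp]: "complex_matrix P Q $ i $ j = Complex (P $ i $ j) (Q $ i $ j)"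
  by (simp add: complex_matrix_def)

lemma det_complex_matrix_real: "det (complex_matrix P 0) = of_real (det P)"
  by (simp add: det_2 complex_eq_iff)

lemma complex_matrix_mult:
  "complex_matrix P Q ** complex_matrix P' Q' = complex_matrix (P ** P' - Q ** Q') (P ** Q' + Q ** P')"
  by (simp add: vec_eq_iff matrix_mult_entry2 complex_eq_iff)

lemma complex_iter_real:
  "complex_iter \<alpha> (\<lambda>x. complex_matrix (A x) 0) n x = complex_matrix (cocycle_iter \<alpha> A n x) 0"
  by (induction n) (simp_all add: complex_matrix_mult, simp add: vec_eq_iff mat_def complex_eq_iff)

definition matrix_complexification ::
    "(real \<Rightarrow> real ^ 'n \<Rightarrow> real ^ 2 ^ 2) \<Rightarrow> real ^ 'n \<Rightarrow> real \<Rightarrow> real \<Rightarrow>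
      (complex \<Rightarrow> real ^ 'n \<Rightarrow> complex \<Rightarrow> complex ^ 2 ^ 2) \<Rightarrow> bool" where
  "matrix_complexification A w s0 R E \<longleftrightarrow>
     (\<forall>i j. complexifies (\<lambda>s x. A s x $ i $ j) w s0 UNIV R (\<lambda>s x z. E s x z $ i $ j))"

lemma matrix_complexification_exists:
  fixes A :: "real \<Rightarrow> real ^ 'n \<Rightarrow> real ^ 2 ^ 2"
  assumes I: "open I" "s0 \<in> I" and per: "\<And>s. s \<in> I \<Longrightarrow> torus_periodic (A s)"
    and analytic: "(\<lambda>(s, x). A s x) real_analytic_on (I \<times> UNIV)"
  shows "\<exists>R>0. (\<forall>s. \<bar>s - s0\<bar> < R \<longrightarrow> s \<in> I) \<and> (\<exists>E. matrix_complexification A w s0 R E)"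
proof -
  obtain R0 where R0: "R0 > 0" "ball s0 R0 \<subseteq> I" using I openE by blast
  have inI: "s \<in> I" if "\<bar>s - s0\<bar> < R0" for s using R0(2) that by (auto simp: dist_real_def subset_iff)
  have "\<exists>R>0. R \<le> R0 \<and> (\<exists>E. complexifies (\<lambda>s x. A s x $ i $ j) w s0 UNIV R E)" for i j
  proof (rule complexifies_global[OF R0(1)])
    show "torus_periodic (\<lambda>x. A s x $ i $ j)" if "\<bar>s - s0\<bar> < R0" for s
      using per[OF inI[OF that]] by (simp add: torus_periodic_def)
    fix x0 :: "real ^ 'n"
    have "(s0, x0) \<in> I \<times> UNIV" using I by simp
    then obtain r and c :: "(real \<times> (real ^ 'n) \<Rightarrow> nat) \<Rightarrow> real ^ 2 ^ 2" where r: "r > 0"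
      and series: "\<And>q. q \<in> ball (s0, x0) r \<Longrightarrow>
        ((\<lambda>k. (\<Prod>b\<in>Basis. ((q - (s0, x0)) \<bullet> b) ^ k b) *\<^sub>R c k) has_sum (\<lambda>(s, x). A s x) q) (Basis \<rightarrow>\<^sub>E UNIV)"
      using analytic unfolding real_analytic_on_def by meson
    show "\<exists>\<rho>>0. \<exists>E. complexifies (\<lambda>s x. A s x $ i $ j) w s0 (ball x0 \<rho>) \<rho> E"
    proof (rule power_series_complexifies[OF r])
      fix q assume q: "q \<in> ball (s0, x0) r"
      have bl: "bounded_linear (\<lambda>M :: real ^ 2 ^ 2. M $ i $ j)"
        by (rule bounded_linear_compose[OF bounded_linear_vec_nth bounded_linear_vec_nth])
      show "((\<lambda>k. (\<Prod>b\<in>Basis. ((q - (s0, x0)) \<bullet> b) ^ k b) * (c k $ i $ j)) has_sum A (fst q) (snd q) $ i $ j) (Basis \<rightarrow>\<^sub>E UNIV)"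
        using has_sum_bounded_linear[OF bl series[OF q]] by (simp add: o_def case_prod_beta)
    qed
  qed
  then obtain R E where R: "\<And>i j. R i j > 0" "\<And>i j. R i j \<le> R0"
    and E: "\<And>i j. complexifies (\<lambda>s x. A s x $ i $ j) w s0 UNIV (R i j) (E i j)" by metis
  define r where "r = Min (range (\<lambda>(i, j). R i j))"
  have r_le: "r \<le> R i j" for i j unfolding r_def by (rule Min_le) (auto intro: image_eqI[of _ _ "(i, j)"])
  have r0: "r > 0" unfolding r_def using R(1) by (subst Min_gr_iff) auto
  have "matrix_complexification A w s0 r (\<lambda>s x z. \<chi> i j. E i j s x z)"
    unfolding matrix_complexification_def using complexifies_subset[OF E _ r_le] by auto
  moreover have "s \<in> I" if "\<bar>s - s0\<bar> < r" for s
    using that r_le[of 1 1] R(2)[of 1 1] by (intro inI) linarith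
  ultimately show ?thesis using r0 by blast
qed

context
  fixes A :: "real \<Rightarrow> real ^ 'n \<Rightarrow> real ^ 2 ^ 2" and w :: "real ^ 'n" and s0 R :: real
    and E :: "complex \<Rightarrow> real ^ 'n \<Rightarrow> complex \<Rightarrow> complex ^ 2 ^ 2"
  assumes E: "matrix_complexification A w s0 R E"
begin

lemma complexification_continuous:
  "continuous_on (ball (of_real s0) R \<times> UNIV \<times> ball 0 R) (\<lambda>(s, x, z). E s x z)"
proof -
  have "continuous_on (ball (of_real s0) R \<times> UNIV \<times> ball 0 R) (\<lambda>y. \<chi> i j. (\<lambda>(s, x, z). E s x z $ i $ j) y)"
    by (intro continuous_on_vec_lambda) (use E in \<open>auto simp: matrix_complexification_def complexifies_def\<close>)
  moreover have "(\<lambda>y. \<chi> i j. (\<lambda>(s, x, z). E s x z $ i $ j) y) = (\<lambda>(s, x, z). E s x z)"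
    by (auto simp: fun_eq_iff vec_eq_iff)
  ultimately show ?thesis by (simp only:)
qed

lemma complexification_holomorphic_parameter:
  "z \<in> ball 0 R \<Longrightarrow> (\<lambda>s. E s x z $ i $ j) holomorphic_on ball (of_real s0) R"
  using E by (simp add: matrix_complexification_def complexifies_def)

lemma complexification_holomorphic_time:
  "s \<in> ball (of_real s0) R \<Longrightarrow> (\<lambda>z. E s x z $ i $ j) holomorphic_on ball 0 R"
  using E by (simp add: matrix_complexification_def complexifies_def)

lemma complexification_real:
  "\<bar>s - s0\<bar> < R \<Longrightarrow> \<bar>t\<bar> < R \<Longrightarrow> E (of_real s) x (of_real t) = complex_matrix (A s (x + t *\<^sub>R w)) 0"
  using E by (simp add: matrix_complexification_def complexifies_def vec_eq_iff complex_eq_iff)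

lemma complexification_torus_cocycle:
  assumes SL2: "\<And>s. \<bar>s - s0\<bar> < R \<Longrightarrow> torus_SL2 (A s)"
    and s: "s \<in> ball (of_real s0) R" and z: "z \<in> ball 0 R"
  shows "torus_cocycle (\<lambda>x. E s x z)"
proof -
  have "continuous_on UNIV (\<lambda>x. (\<lambda>(s, x, z). E s x z) (s, x, z))"
    by (rule continuous_on_compose2[OF complexification_continuous]) (use s z in \<open>auto intro!: continuous_intros\<close>)
  moreover have "E s (x + k) z = E s x z" if k: "\<forall>i. k $ i \<in> \<int>" for x k
  proof -
    have "E s x z $ i $ j = E s (x + k) z $ i $ j" for i j
    proof (rule complexifies_unique[of "\<lambda>s x. A s x $ i $ j" w s0 UNIV R "\<lambda>s x z. E s x z $ i $ j" x
          "(\<lambda>x. x - k) ` UNIV" "\<lambda>s x z. E s (x + k) z $ i $ j"])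
      show c: "complexifies (\<lambda>s x. A s x $ i $ j) w s0 UNIV R (\<lambda>s x z. E s x z $ i $ j)"
        using E by (simp add: matrix_complexification_def)
      show "complexifies (\<lambda>s x. A s x $ i $ j) w s0 ((\<lambda>x. x - k) ` UNIV) R (\<lambda>s x z. E s (x + k) z $ i $ j)"
        using complexifies_translate[OF c, of k] SL2 k by (auto simp: torus_SL2_def torus_periodic_def)
      show "x \<in> (\<lambda>x. x - k) ` UNIV" by (rule image_eqI[of _ _ "x + k"]) auto
    qed (use s z in auto)
    then show ?thesis by (simp add: vec_eq_iff)
  qed
  moreover have "det (E s x z) = 1" for x
  proof (rule complexifies_unique[of "\<lambda>_ _. 1" w s0 UNIV R "\<lambda>s x z. det (E s x z)" x UNIV "\<lambda>_ _ _. 1"])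
    show "complexifies (\<lambda>_ _. 1) w s0 UNIV R (\<lambda>s x z. det (E s x z))"
      unfolding complexifies_def
    proof (intro conjI ballI allI impI)
      show "continuous_on (ball (of_real s0) R \<times> UNIV \<times> ball 0 R) (\<lambda>(s, x, z). det (E s x z))"
        using complexification_continuous unfolding det_2 case_prod_beta by (intro continuous_intros)
      show "(\<lambda>s. det (E s x z)) holomorphic_on ball (of_real s0) R" if "z \<in> ball 0 R" for x z
        unfolding det_2 by (intro holomorphic_intros complexification_holomorphic_parameter that)
      show "(\<lambda>z. det (E s x z)) holomorphic_on ball 0 R" if "s \<in> ball (of_real s0) R" for x s
        unfolding det_2 by (intro holomorphic_intros complexification_holomorphic_time that)
      show "det (E (of_real s) x (of_real t)) = of_real 1" if "\<bar>s - s0\<bar> < R" "\<bar>t\<bar> < R" for x s t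
        using SL2[OF that(1)] by (simp add: complexification_real[OF that] det_complex_matrix_real torus_SL2_def)
    qed
    show "complexifies (\<lambda>_ _. 1) w s0 UNIV R (\<lambda>_ _ _. 1)" by (simp add: complexifies_def)
  qed (use s z in auto)
  ultimately show ?thesis by (simp add: torus_cocycle_def torus_periodic_def)
qed

text \<open>
Real time is the same as translation of the base point; this makes exponents independent of \<open>Re z\<close>.
\<close>

lemma complexification_shift:
  assumes s: "\<bar>s - s0\<bar> < R" and z: "z \<in> ball 0 R" "z + of_real t \<in> ball 0 R"
  shows "E (of_real s) x (z + of_real t) = E (of_real s) (x + t *\<^sub>R w) z"
proof -
  have sb: "complex_of_real s \<in> ball (of_real s0) R"
    using s by (simp add: dist_norm abs_minus_commute flip: of_real_diff)
  \<comment> \<open>the convex domain on which both sides are defined; it contains the real point \<open>- t / 2\<close>\<close>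
  define S where "S = ball (0 :: complex) R \<inter> ball (- of_real t) R"
  have conv: "convex S" unfolding S_def by (intro convex_Int convex_ball)
  have ball_shift: "u \<in> ball (- of_real t) R \<longleftrightarrow> cmod (u + of_real t) < R" for u :: complex
    using dist_norm[of u "- of_real t"] by (simp add: dist_commute)
  have in2: "u + of_real t \<in> ball 0 R" if "u \<in> S" for u
    using that ball_shift[of u] unfolding S_def Int_iff mem_ball_0 by blast
  have zS: "z \<in> S" using z ball_shift[of z] unfolding S_def Int_iff mem_ball_0 by blast
  have "cmod (of_real t) < 2 * R"
    using norm_triangle_ineq4[of "z + of_real t" z] z by simp
  then have half: "\<bar>t\<bar> / 2 < R" by simp
  have mid: "complex_of_real (- t / 2) \<in> S"
  proof -
    have "cmod (complex_of_real (- t / 2)) < R" using half by (simp add: norm_divide)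
    moreover have "complex_of_real (- t / 2) + of_real t = of_real (t / 2)" by (simp flip: of_real_add)
    then have "cmod (complex_of_real (- t / 2) + of_real t) < R" using half by (simp add: norm_divide)
    ultimately show ?thesis using ball_shift unfolding S_def Int_iff mem_ball_0 by blast
  qed
  have "E (of_real s) x (z + of_real t) $ i $ j = E (of_real s) (x + t *\<^sub>R w) z $ i $ j" for i j
  proof (rule holomorphic_eq_if_eq_on_reals[of "\<lambda>z. E (of_real s) x (z + of_real t) $ i $ j" S
        "\<lambda>z. E (of_real s) (x + t *\<^sub>R w) z $ i $ j" "- t / 2"])
    show "(\<lambda>z. E (of_real s) x (z + of_real t) $ i $ j) holomorphic_on S"
      by (rule holomorphic_on_compose_gen[OF _ complexification_holomorphic_time[OF sb], unfolded o_def])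
         (use in2 in \<open>auto intro!: holomorphic_intros\<close>)
    show "(\<lambda>z. E (of_real s) (x + t *\<^sub>R w) z $ i $ j) holomorphic_on S"
      by (rule holomorphic_on_subset[OF complexification_holomorphic_time[OF sb]]) (auto simp: S_def)
    show "E (of_real s) x (of_real u + of_real t) $ i $ j = E (of_real s) (x + t *\<^sub>R w) (of_real u) $ i $ j"
      if u: "complex_of_real u \<in> S" for u
    proof -
      have "\<bar>u\<bar> < R" "\<bar>u + t\<bar> < R" using u in2[OF u] by (auto simp: S_def simp flip: of_real_add)
      then show ?thesis
        using complexification_real[OF s, of "u + t" x] complexification_real[OF s, of u "x + t *\<^sub>R w"]
        by (simp add: algebra_simps)
    qed
  qed (use conv mid zS in \<open>auto simp: S_def convex_connected\<close>)
  then show ?thesis by (simp add: vec_eq_iff)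
qed

text \<open>
The cocycle is real at real arguments; this makes exponents even in \<open>Im z\<close>.
\<close>

lemma complexification_cnj:
  assumes s: "\<bar>s - s0\<bar> < R" and z: "z \<in> ball 0 R"
  shows "E (of_real s) x (cnj z) = (\<chi> i j. cnj (E (of_real s) x z $ i $ j))"
proof -
  have sb: "complex_of_real s \<in> ball (of_real s0) R"
    using s by (simp add: dist_norm abs_minus_commute flip: of_real_diff)
  have R: "R > 0" using z by (metis ball_empty empty_iff not_le)
  have "cnj (E (of_real s) x (cnj z) $ i $ j) = E (of_real s) x z $ i $ j" for i j
  proof (rule holomorphic_eq_if_eq_on_reals[of "\<lambda>z. cnj (E (of_real s) x (cnj z) $ i $ j)" "ball 0 R"
        "\<lambda>z. E (of_real s) x z $ i $ j" 0])
    have "(cnj \<circ> (\<lambda>z. E (of_real s) x z $ i $ j) \<circ> cnj) holomorphic_on ball 0 R"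
    proof (rule holomorphic_on_compose_cnj_cnj)
      have "cnj ` ball 0 R = ball 0 R"
      proof
        show "ball 0 R \<subseteq> cnj ` ball 0 R"
          by (intro subsetI image_eqI[of _ cnj "cnj _"]) auto
      qed auto
      then show "(\<lambda>z. E (of_real s) x z $ i $ j) holomorphic_on cnj ` ball 0 R"
        using complexification_holomorphic_time[OF sb] by simp
    qed simp
    then show "(\<lambda>z. cnj (E (of_real s) x (cnj z) $ i $ j)) holomorphic_on ball 0 R" by (simp add: o_def)
    show "cnj (E (of_real s) x (cnj (of_real t)) $ i $ j) = E (of_real s) x (of_real t) $ i $ j"
      if "complex_of_real t \<in> ball 0 R" for t
      using that complexification_real[OF s, of t x] by (simp add: complex_eq_iff)
  qed (use R z complexification_holomorphic_time[OF sb] in auto)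
  then show ?thesis by (metis (no_types, lifting) complex_cnj_cnj vec_eq_iff vec_lambda_beta)
qed

end

section \<open>Monotonicity as contraction of the cone\<close>

definition cross2 :: "real ^ 2 \<Rightarrow> real ^ 2 \<Rightarrow> real" where
  "cross2 u v = u $ 1 * v $ 2 - u $ 2 * v $ 1"

lemma cross2_matrix: "cross2 (M *v u) (M *v v) = det M * cross2 u v"
  by (simp add: cross2_def matrix_vector_entry2 det_2 algebra_simps)

lemma cross2_add_right: "cross2 u (v + v') = cross2 u v + cross2 u v'"
  by (simp add: cross2_def algebra_simps)

lemma cross2_scaleR: "cross2 (c *\<^sub>R u) (c *\<^sub>R v) = c\<^sup>2 * cross2 u v"
  by (simp add: cross2_def power2_eq_square algebra_simps)

lemma norm_real_mat2:
  "(norm (M :: real ^ 2 ^ 2))\<^sup>2 = (M $ 1 $ 1)\<^sup>2 + (M $ 1 $ 2)\<^sup>2 + (M $ 2 $ 1)\<^sup>2 + (M $ 2 $ 2)\<^sup>2"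
proof -
  have "(norm M)\<^sup>2 = (norm (M $ 1))\<^sup>2 + (norm (M $ 2))\<^sup>2" by (simp add: norm_vec_def[of M] L2_set_def sum_2)
  then show ?thesis by (simp add: norm_vec_def L2_set_def sum_2)
qed

lemma norm_complex_matrix_squared: "(norm (complex_matrix P Q))\<^sup>2 = (norm P)\<^sup>2 + (norm Q)\<^sup>2"
  unfolding norm_complex_mat2 norm_real_mat2 by (simp add: cmod_power2)

lemma norm_complex_matrix_real: "norm (complex_matrix P 0) = norm P"
  using norm_complex_matrix_squared[of P 0] by (simp add: power2_eq_iff_nonneg)

lemma norm_complex_matrix_le: "norm (complex_matrix P Q) \<le> norm P + norm Q"
proof (rule power2_le_imp_le)
  show "(norm (complex_matrix P Q))\<^sup>2 \<le> (norm P + norm Q)\<^sup>2"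
    unfolding norm_complex_matrix_squared by (simp add: power2_sum)
qed simp

lemma norm_real_matrix_mult_le: "norm ((P :: real ^ 2 ^ 2) ** (Q :: real ^ 2 ^ 2)) \<le> norm P * norm Q"
  using norm_matrix_mult_le[of "complex_matrix P 0" "complex_matrix Q 0"]
  by (simp add: complex_matrix_mult norm_complex_matrix_real)

lemma abs_det2_le: "\<bar>det (M :: real ^ 2 ^ 2)\<bar> \<le> (norm M)\<^sup>2"
proof -
  have sq: "\<bar>x * y\<bar> \<le> x\<^sup>2 + y\<^sup>2" for x y :: real
    using sum_squares_bound[of "\<bar>x\<bar>" "\<bar>y\<bar>"] mult_nonneg_nonneg[OF abs_ge_zero[of x] abs_ge_zero[of y]]
    unfolding abs_mult power2_abs by linarith
  show ?thesis using sq[of "M$1$1" "M$2$2"] sq[of "M$1$2" "M$2$1"] unfolding norm_real_mat2 det_2 by linarith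
qed

definition Re_vec :: "complex ^ 2 \<Rightarrow> real ^ 2" where "Re_vec v = (\<chi> i. Re (v $ i))"
definition Im_vec :: "complex ^ 2 \<Rightarrow> real ^ 2" where "Im_vec v = (\<chi> i. Im (v $ i))"

lemma norm_Re_Im_vec: "(norm v)\<^sup>2 = (norm (Re_vec v))\<^sup>2 + (norm (Im_vec v))\<^sup>2"
  by (simp add: norm_complex_vec2 cmod_power2 Re_vec_def Im_vec_def norm_vec_def[where 'a=real] L2_set_def sum_2)

text \<open>
For \<open>e = 0\<close> a real matrix multiplies the form by its determinant. The first-order term is
the rotation speed of the images of the real and the imaginary part of \<open>v\<close>.
\<close>

lemma cone_form_expansion:
  "cone_form (complex_matrix N (e *\<^sub>R N') *v v) =
     det N * cone_form v
     + e * (cross2 (N *v Re_vec v) (N' *v Re_vec v) + cross2 (N *v Im_vec v) (N' *v Im_vec v))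
     + e\<^sup>2 * det N' * cone_form v"
  by (simp add: cone_form_def cross2_def matrix_vector_entry2 Re_vec_def Im_vec_def det_2 power2_eq_square algebra_simps)

lemma abs_cone_form_le: "\<bar>cone_form v\<bar> \<le> (norm v)\<^sup>2"
  using cone_form_perturb[of 0 v] by (simp add: cone_form_def)

text \<open>
\<open>C + e i C' + Rm\<close> is the complexified cocycle at time \<open>i e\<close>, and \<open>B + e i B'\<close> is the frame, taken at
both ends of the step. By the expansion above the first-order gain is \<open>e \<kappa>\<close>; the product of the two imaginary parts,
the determinants of the derivatives and the remainder \<open>Rm\<close> all cost \<open>O(e\<^sup>2)\<close>.
\<close>

lemma cone_form_gain:
  fixes B0 B0' B1 B1' C C' :: "real ^ 2 ^ 2"
  assumes det: "det B0 = 1" "det (B1 ** C) = 1"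
    and gain: "\<And>v. cross2 (B0 *v v) (B0' *v v) + \<kappa> * (norm v)\<^sup>2
        \<le> cross2 ((B1 ** C) *v v) ((B1' ** C + B1 ** C') *v v)"
    and bounds: "norm B0' \<le> \<Gamma>" "norm B1 \<le> \<Gamma>" "norm B1' \<le> \<Gamma>" "norm C \<le> \<Gamma>" "norm C' \<le> \<Gamma>"
    and rest: "norm Rm \<le> K * e\<^sup>2" and e: "0 < e" "e \<le> 1"
    and H: "H = \<Gamma>\<^sup>2 + 2 * \<Gamma> * K" and L: "L = 4 * \<Gamma> ^ 4 + \<Gamma>\<^sup>2 + 6 * \<Gamma>\<^sup>2 * H + H\<^sup>2"
  shows "cone_form (complex_matrix B0 (e *\<^sub>R B0') *v v) + (e * \<kappa> - L * e\<^sup>2) * (norm v)\<^sup>2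
     \<le> cone_form (complex_matrix B1 (e *\<^sub>R B1') *v ((complex_matrix C (e *\<^sub>R C') + Rm) *v v))"
proof -
  have \<Gamma>: "0 \<le> \<Gamma>" using bounds(1) norm_ge_zero order_trans by blast
  have K: "0 \<le> K" using order_trans[OF norm_ge_zero rest] e by (simp add: zero_le_mult_iff)
  define N where "N = B1 ** C"
  define N' where "N' = B1' ** C + B1 ** C'"
  define U where "U = complex_matrix N (e *\<^sub>R N')"
  define R2 where "R2 = complex_matrix (- (e\<^sup>2 *\<^sub>R (B1' ** C'))) 0 + complex_matrix B1 (e *\<^sub>R B1') ** Rm"
  \<comment> \<open>\<open>U\<close> is the first-order part, \<open>R2\<close> collects everything of order \<open>e\<^sup>2\<close>\<close>
  have prod: "complex_matrix B1 (e *\<^sub>R B1') ** (complex_matrix C (e *\<^sub>R C') + Rm) = U + R2"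
    unfolding U_def R2_def N_def N'_def
    by (simp add: vec_eq_iff matrix_mult_entry2 complex_eq_iff power2_eq_square algebra_simps)
  have b_norm: "norm (complex_matrix B1 (e *\<^sub>R B1')) \<le> 2 * \<Gamma>"
  proof -
    have "norm (e *\<^sub>R B1') \<le> 1 * \<Gamma>" using e bounds by (simp only: norm_scaleR) (intro mult_mono, auto)
    then show ?thesis using norm_complex_matrix_le[of B1 "e *\<^sub>R B1'"] bounds by linarith
  qed
  have NN': "norm N \<le> \<Gamma>\<^sup>2" "norm N' \<le> 2 * \<Gamma>\<^sup>2"
  proof -
    have mult: "norm (P ** Q) \<le> \<Gamma>\<^sup>2" if "norm P \<le> \<Gamma>" "norm Q \<le> \<Gamma>" for P Q :: "real ^ 2 ^ 2"
      unfolding power2_eq_square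
      by (rule order_trans[OF norm_real_matrix_mult_le mult_mono[OF that]]) (use \<Gamma> in auto)
    show "norm N \<le> \<Gamma>\<^sup>2" unfolding N_def by (intro mult bounds)
    show "norm N' \<le> 2 * \<Gamma>\<^sup>2"
      unfolding N'_def using mult[OF bounds(3,4)] mult[OF bounds(2,5)] norm_triangle_ineq[of "B1' ** C" "B1 ** C'"] by linarith
  qed
  have U_norm: "norm U \<le> 3 * \<Gamma>\<^sup>2"
  proof -
    have "norm (e *\<^sub>R N') \<le> 1 * (2 * \<Gamma>\<^sup>2)" using e NN' by (simp only: norm_scaleR) (intro mult_mono, auto)
    then show ?thesis unfolding U_def using norm_complex_matrix_le[of N "e *\<^sub>R N'"] NN' by linarith
  qed
  have R2_norm: "norm R2 \<le> H * e\<^sup>2"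
  proof -
    have "norm (B1' ** C') \<le> \<Gamma> * \<Gamma>"
      by (rule order_trans[OF norm_real_matrix_mult_le mult_mono]) (use bounds \<Gamma> in auto)
    then have "norm (complex_matrix (- (e\<^sup>2 *\<^sub>R (B1' ** C'))) 0) \<le> e\<^sup>2 * (\<Gamma> * \<Gamma>)"
      by (simp add: norm_complex_matrix_real mult_left_mono)
    moreover have "norm (complex_matrix B1 (e *\<^sub>R B1') ** Rm) \<le> (2 * \<Gamma>) * (K * e\<^sup>2)"
      by (rule order_trans[OF norm_matrix_mult_le mult_mono]) (use b_norm rest \<Gamma> in auto)
    ultimately have "norm R2 \<le> e\<^sup>2 * (\<Gamma> * \<Gamma>) + (2 * \<Gamma>) * (K * e\<^sup>2)"
      unfolding R2_def
      using norm_triangle_ineq[of "complex_matrix (- (e\<^sup>2 *\<^sub>R (B1' ** C'))) 0" "complex_matrix B1 (e *\<^sub>R B1') ** Rm"]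
      by linarith
    then show ?thesis by (simp add: H power2_eq_square algebra_simps)
  qed
  have H0: "0 \<le> H" using \<Gamma> K by (simp add: H)
  define q where "q = (norm v)\<^sup>2"
  have q0: "0 \<le> q" by (simp add: q_def)
  have Uv: "norm (U *v v) \<le> 3 * \<Gamma>\<^sup>2 * norm v"
    by (rule order_trans[OF norm_matrix_vector_le mult_right_mono[OF U_norm]]) simp
  have R2v: "norm (R2 *v v) \<le> H * e\<^sup>2 * norm v"
    by (rule order_trans[OF norm_matrix_vector_le mult_right_mono[OF R2_norm]]) simp
  have "2 * norm (U *v v) * norm (R2 *v v) + (norm (R2 *v v))\<^sup>2
      \<le> 2 * (3 * \<Gamma>\<^sup>2 * norm v) * (H * e\<^sup>2 * norm v) + (H * e\<^sup>2 * norm v)\<^sup>2"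
    using Uv R2v H0 \<Gamma> by (intro add_mono mult_mono power_mono) auto
  also have "\<dots> = (6 * \<Gamma>\<^sup>2 * H) * e\<^sup>2 * q + H\<^sup>2 * (e\<^sup>2 * e\<^sup>2) * q"
    by (simp add: q_def power2_eq_square algebra_simps)
  also have "\<dots> \<le> (6 * \<Gamma>\<^sup>2 * H) * e\<^sup>2 * q + H\<^sup>2 * (e\<^sup>2 * 1) * q"
    using e q0 by (intro add_left_mono mult_right_mono mult_left_mono) (auto simp: power_le_one)
  finally have pert: "cone_form (U *v v) - (6 * \<Gamma>\<^sup>2 * H) * e\<^sup>2 * q - H\<^sup>2 * e\<^sup>2 * q \<le> cone_form (U *v v + R2 *v v)"
    using cone_form_perturb[of "U *v v" "R2 *v v"] by simp
  have det_bound: "\<bar>e\<^sup>2 * d * cone_form v\<bar> \<le> D * e\<^sup>2 * q" if "\<bar>d\<bar> \<le> D" for d D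
  proof -
    have "\<bar>d\<bar> * \<bar>cone_form v\<bar> \<le> D * q" using that abs_cone_form_le[of v] by (intro mult_mono) (auto simp: q_def)
    then have "e\<^sup>2 * (\<bar>d\<bar> * \<bar>cone_form v\<bar>) \<le> e\<^sup>2 * (D * q)" by (intro mult_left_mono) auto
    then show ?thesis by (simp add: abs_mult mult_ac)
  qed
  have d1: "\<bar>det N'\<bar> \<le> 4 * \<Gamma> ^ 4"
  proof -
    have "(norm N')\<^sup>2 \<le> (2 * \<Gamma>\<^sup>2)\<^sup>2" using NN' by (intro power_mono) auto
    then show ?thesis using abs_det2_le[of N'] by (simp add: power_mult_distrib)
  qed
  have d0: "\<bar>det B0'\<bar> \<le> \<Gamma>\<^sup>2"
    using abs_det2_le[of B0'] power_mono[OF bounds(1) norm_ge_zero, of 2] by linarith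
  define g0 where "g0 = cross2 (B0 *v Re_vec v) (B0' *v Re_vec v) + cross2 (B0 *v Im_vec v) (B0' *v Im_vec v)"
  define g1 where "g1 = cross2 (N *v Re_vec v) (N' *v Re_vec v) + cross2 (N *v Im_vec v) (N' *v Im_vec v)"
  have g: "g0 + \<kappa> * q \<le> g1"
    using gain[of "Re_vec v"] gain[of "Im_vec v"] unfolding g0_def g1_def q_def norm_Re_Im_vec N_def N'_def
    by (simp add: algebra_simps)
  have eg: "e * g0 + e * \<kappa> * q \<le> e * g1"
    using mult_left_mono[OF g, of e] e by (simp add: algebra_simps)
  have c0: "cone_form (complex_matrix B0 (e *\<^sub>R B0') *v v) \<le> cone_form v + e * g0 + \<Gamma>\<^sup>2 * e\<^sup>2 * q"
    using det_bound[OF d0] by (simp add: cone_form_expansion det(1) g0_def)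
  have c1: "cone_form v + e * g1 - 4 * \<Gamma> ^ 4 * e\<^sup>2 * q \<le> cone_form (U *v v)"
    using det_bound[OF d1] det(2) by (simp add: U_def cone_form_expansion N_def[symmetric] g1_def)
  have "cone_form (complex_matrix B0 (e *\<^sub>R B0') *v v) + (e * \<kappa> - L * e\<^sup>2) * q \<le> cone_form (U *v v + R2 *v v)"
    using pert c0 c1 eg unfolding L by (simp add: algebra_simps)
  moreover have "complex_matrix B1 (e *\<^sub>R B1') *v ((complex_matrix C (e *\<^sub>R C') + Rm) *v v) = U *v v + R2 *v v"
    unfolding matrix_vector_mul_assoc prod by (rule matrix_vector_mult_add_rdistrib)
  ultimately show ?thesis by (simp only: q_def)
qed

lemma has_vector_derivative_along:
  assumes "(f has_derivative f') (at x)"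
  shows "((\<lambda>t. f (x + t *\<^sub>R w)) has_vector_derivative f' w) (at 0)"
proof -
  have "((\<lambda>t. x + t *\<^sub>R w) has_derivative (\<lambda>t. t *\<^sub>R w)) (at 0)" by (auto intro!: derivative_eq_intros)
  moreover have "(f has_derivative f') (at (x + 0 *\<^sub>R w))" using assms by simp
  ultimately have "((\<lambda>t. f (x + t *\<^sub>R w)) has_derivative (\<lambda>t. f' (t *\<^sub>R w))) (at 0)"
    by (rule has_derivative_compose)
  moreover have "f' (t *\<^sub>R w) = t *\<^sub>R f' w" for t
    using has_derivative_linear[OF assms] by (simp add: linear_cmul)
  ultimately show ?thesis by (simp add: has_vector_derivative_def)
qed

lemma bounded_bilinear_real_matrix_mult2: "bounded_bilinear ((**) :: real ^ 2 ^ 2 \<Rightarrow> real ^ 2 ^ 2 \<Rightarrow> real ^ 2 ^ 2)"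
proof (rule bilinear_conv_bounded_bilinear[THEN iffD1])
  show "bilinear ((**) :: real ^ 2 ^ 2 \<Rightarrow> real ^ 2 ^ 2 \<Rightarrow> real ^ 2 ^ 2)"
    unfolding bilinear_def by (auto intro!: linearI simp: vec_eq_iff matrix_mult_entry2 algebra_simps)
qed

lemma has_vector_derivative_matrix_mult2:
  fixes f g :: "real \<Rightarrow> real ^ 2 ^ 2"
  assumes "(f has_vector_derivative f') (at t)" "(g has_vector_derivative g') (at t)"
  shows "((\<lambda>t. f t ** g t) has_vector_derivative f t ** g' + f' ** g t) (at t)"
  using bounded_bilinear.has_vector_derivative[OF bounded_bilinear_real_matrix_mult2 assms] .

text \<open>
Differentiating \<open>v\<^sub>1 sin \<theta> = v\<^sub>2 cos \<theta>\<close> for the curve \<open>v t = M (x + t w) y\<close> shows that its cross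
product with its velocity is the square of its length times the derivative of the argument. A continuous argument exists because the line is contractible.
\<close>

lemma monotonic_cross2_pos:
  fixes M :: "real ^ 'n \<Rightarrow> real ^ 2 ^ 2"
  assumes mono: "\<And>\<theta>. is_continuous_argument \<theta> (\<lambda>t. M (x + t *\<^sub>R w) *v y) \<Longrightarrow> \<exists>D>0. (\<theta> has_real_derivative D) (at 0)"
    and cont: "continuous_on UNIV M" and det: "\<And>x. det (M x) = 1"
    and deriv: "((\<lambda>t. M (x + t *\<^sub>R w)) has_vector_derivative M') (at 0)" and y: "y \<noteq> 0"
  shows "0 < cross2 (M x *v y) (M' *v y)"
proof -
  define v where "v = (\<lambda>t. M (x + t *\<^sub>R w) *v y)"
  define g where "g = (\<lambda>t. Complex (v t $ 1) (v t $ 2))"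
  have v_nz: "v t \<noteq> 0" for t
  proof
    assume "v t = 0"
    then have "adjugate2 (M (x + t *\<^sub>R w)) *v v t = 0" by simp
    then show False using y det by (simp add: v_def adjugate2_mult_matrix_vector)
  qed
  have norm_v: "norm (v t) = cmod (g t)" for t
    by (simp add: norm_vec_def L2_set_def sum_2 g_def cmod_def)
  have v_cont: "continuous_on UNIV v"
    unfolding v_def by (intro continuous_intros continuous_on_compose2[OF cont]) auto
  have "continuous_on UNIV g"
    unfolding g_def Complex_eq by (intro continuous_intros v_cont)
  moreover have "contractible (UNIV :: real set)" by (simp add: convex_imp_contractible)
  moreover have "g t \<noteq> 0" for t using norm_v[of t] v_nz[of t] by auto
  ultimately obtain h where h: "continuous_on UNIV h" "\<And>t. g t = exp (h t)"
    using continuous_logarithm_on_contractible[of UNIV g] by auto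
  define \<theta> where "\<theta> = (\<lambda>t. Im (h t))"
  have polar: "v t $ 1 = norm (v t) * cos (\<theta> t)" "v t $ 2 = norm (v t) * sin (\<theta> t)" for t
  proof -
    have "Re (g t) = cmod (g t) * cos (\<theta> t)" "Im (g t) = cmod (g t) * sin (\<theta> t)"
      unfolding h(2) \<theta>_def by (simp_all add: Re_exp Im_exp)
    then show "v t $ 1 = norm (v t) * cos (\<theta> t)" "v t $ 2 = norm (v t) * sin (\<theta> t)"
      unfolding norm_v by (simp_all add: g_def)
  qed
  have "is_continuous_argument \<theta> v"
    using polar h(1) unfolding is_continuous_argument_def \<theta>_def by (auto intro!: continuous_intros)
  then obtain D where D: "D > 0" "(\<theta> has_real_derivative D) (at 0)" using mono[of \<theta>] by (auto simp: v_def)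
  define v' where "v' = M' *v y"
  have comp_deriv: "((\<lambda>t. v t $ i) has_real_derivative v' $ i) (at 0)" for i
  proof -
    have "bounded_linear (\<lambda>N :: real ^ 2 ^ 2. (N *v y) $ i)"
      unfolding matrix_vector_entry2
      by (intro bounded_linear_add bounded_linear_mult_const bounded_linear_compose[OF bounded_linear_vec_nth bounded_linear_vec_nth])
    from bounded_linear.has_vector_derivative[OF this deriv]
    show ?thesis by (simp add: v_def v'_def has_real_derivative_iff_has_vector_derivative)
  qed
  define \<rho> c s where "\<rho> = norm (v 0)" and "c = cos (\<theta> 0)" and "s = sin (\<theta> 0)"
  have "((\<lambda>t. v t $ 1 * sin (\<theta> t) - v t $ 2 * cos (\<theta> t)) has_real_derivative
      (v' $ 1 * s + c * D * v 0 $ 1) - (v' $ 2 * c + - s * D * v 0 $ 2)) (at 0)"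
    unfolding c_def s_def by (auto intro!: derivative_eq_intros comp_deriv D(2))
  moreover have "(\<lambda>t. v t $ 1 * sin (\<theta> t) - v t $ 2 * cos (\<theta> t)) = (\<lambda>t. 0)"
    by (simp add: polar)
  ultimately have "(v' $ 1 * s + c * D * v 0 $ 1) - (v' $ 2 * c + - s * D * v 0 $ 2) = 0"
    using DERIV_unique[OF _ DERIV_const] by fastforce
  then have "v' $ 2 * c - v' $ 1 * s = D * (c * v 0 $ 1 + s * v 0 $ 2)"
    by (simp add: algebra_simps)
  then have "\<rho> * (v' $ 2 * c - v' $ 1 * s) = \<rho> * (D * (c * v 0 $ 1 + s * v 0 $ 2))"
    by (simp only:)
  also have "c * v 0 $ 1 + s * v 0 $ 2 = \<rho> * (c\<^sup>2 + s\<^sup>2)"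
    unfolding polar[of 0] \<rho>_def[symmetric] c_def[symmetric] s_def[symmetric] by algebra
  also have "\<dots> = \<rho>" by (simp add: c_def s_def)
  finally have "cross2 (v 0) v' = \<rho> * (D * \<rho>)"
    unfolding cross2_def polar[of 0] \<rho>_def[symmetric] c_def[symmetric] s_def[symmetric]
    by (simp add: algebra_simps)
  moreover have "\<rho> > 0" using v_nz by (simp add: \<rho>_def)
  ultimately show ?thesis using D(1) by (simp add: v_def v'_def)
qed

text \<open>
Only the derivative in the direction \<open>w\<close> is kept from now on.
\<close>

lemma torus_C1_SL2_along:
  fixes B :: "real ^ 'n \<Rightarrow> real ^ 2 ^ 2"
  assumes "torus_C1_SL2 B"
  obtains B' where "continuous_on UNIV B" "torus_periodic B" "\<And>x. det (B x) = 1"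
    "continuous_on UNIV B'" "torus_periodic B'"
    "\<And>x. ((\<lambda>t. B (x + t *\<^sub>R w)) has_vector_derivative B' x) (at 0)"
proof -
  obtain D :: "real ^ 'n \<Rightarrow> (real ^ 'n) \<Rightarrow>\<^sub>L (real ^ 2 ^ 2)" where
    D: "\<And>x. (B has_derivative blinfun_apply (D x)) (at x)" "continuous_on UNIV D"
    using assms by (auto simp: torus_C1_SL2_def)
  have SL2: "torus_periodic B" "\<And>x. det (B x) = 1" using assms by (auto simp: torus_C1_SL2_def torus_SL2_def)
  define B' where "B' = (\<lambda>x. blinfun_apply (D x) w)"
  have deriv: "((\<lambda>t. B (x + t *\<^sub>R w)) has_vector_derivative B' x) (at 0)" for x
    unfolding B'_def by (rule has_vector_derivative_along[OF D(1)])
  have "continuous_on UNIV B"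
    using D(1) by (meson continuous_at_imp_continuous_on has_derivative_continuous)
  moreover have "continuous_on UNIV B'" unfolding B'_def by (intro continuous_intros D(2))
  moreover have "B' (x + k) = B' x" if k: "\<forall>i. k $ i \<in> \<int>" for x k
  proof -
    have "B (x + k + t *\<^sub>R w) = B (x + t *\<^sub>R w)" for t
      using SL2(1) k unfolding torus_periodic_def by (metis add.assoc add.commute)
    then show ?thesis using vector_derivative_unique_at[OF deriv[of "x + k"]] deriv[of x] by simp
  qed
  ultimately show ?thesis using that[of B'] SL2 deriv by (auto simp: torus_periodic_def)
qed

text \<open>
With \<open>N = B(x + n \<alpha>) A\<^sub>n(x) = M(x) B(x)\<close> and \<open>M\<close> monotonic, the product rule gives
\<open>N' = M' B + M B'\<close>, and \<open>M\<close> preserves the cross product since its determinant is \<open>1\<close>. So the rotation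
speed of \<open>N v\<close> exceeds that of \<open>B v\<close> by the rotation speed of \<open>M\<close> at \<open>B v\<close>, which is positive.
\<close>

lemma premonotonic_twist_gain:
  fixes A :: "real ^ 'n \<Rightarrow> real ^ 2 ^ 2"
  assumes "premonotonic \<alpha> A"
  obtains n w B B' where "n \<ge> 1" "continuous_on UNIV B" "torus_periodic B" "\<And>x. det (B x) = 1"
    "continuous_on UNIV B'" "torus_periodic B'"
    "\<And>x v C'. ((\<lambda>t. cocycle_iter \<alpha> A n (x + t *\<^sub>R w)) has_vector_derivative C') (at 0) \<Longrightarrow> v \<noteq> 0 \<Longrightarrow>
       cross2 (B x *v v) (B' x *v v)
         < cross2 ((B (x + real n *\<^sub>R \<alpha>) ** cocycle_iter \<alpha> A n x) *v v)
             ((B' (x + real n *\<^sub>R \<alpha>) ** cocycle_iter \<alpha> A n x + B (x + real n *\<^sub>R \<alpha>) ** C') *v v)"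
proof -
  obtain n B where n: "n \<ge> 1" and B: "torus_C1_SL2 B"
    and mono: "monotonic (\<lambda>x. B (x + real n *\<^sub>R \<alpha>) ** cocycle_iter \<alpha> A n x ** matrix_inv (B x))"
    using assms by (auto simp: premonotonic_def)
  define M where "M = (\<lambda>x. B (x + real n *\<^sub>R \<alpha>) ** cocycle_iter \<alpha> A n x ** matrix_inv (B x))"
  obtain w where M_C1: "torus_C1_SL2 M" and w: "\<And>x y \<theta> t. y \<noteq> 0 \<Longrightarrow> is_continuous_argument \<theta> (\<lambda>t. M (x + t *\<^sub>R w) *v y)
      \<Longrightarrow> \<exists>D>0. (\<theta> has_real_derivative D) (at t)"
    using mono unfolding monotonic_def M_def[symmetric] by blast
  obtain B' where B': "continuous_on UNIV B" "torus_periodic B" "\<And>x. det (B x) = 1"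
    "continuous_on UNIV B'" "torus_periodic B'"
    "\<And>x. ((\<lambda>t. B (x + t *\<^sub>R w)) has_vector_derivative B' x) (at 0)"
    by (rule torus_C1_SL2_along[OF B, of w]) blast
  obtain M' where M': "continuous_on UNIV M" "\<And>x. det (M x) = 1"
    "\<And>x. ((\<lambda>t. M (x + t *\<^sub>R w)) has_vector_derivative M' x) (at 0)"
    by (rule torus_C1_SL2_along[OF M_C1, of w]) blast
  have MB: "M x ** B x = B (x + real n *\<^sub>R \<alpha>) ** cocycle_iter \<alpha> A n x" for x
  proof -
    have "invertible (B x)" using B'(3)[of x] by (simp add: invertible_det_nz)
    then have "matrix_inv (B x) ** B x = mat 1"
      unfolding invertible_def matrix_inv_def by (rule someI2_ex) blast
    then show ?thesis by (simp add: M_def matrix_mul_assoc[symmetric])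
  qed
  have "cross2 (B x *v v) (B' x *v v)
         < cross2 ((B (x + real n *\<^sub>R \<alpha>) ** cocycle_iter \<alpha> A n x) *v v)
             ((B' (x + real n *\<^sub>R \<alpha>) ** cocycle_iter \<alpha> A n x + B (x + real n *\<^sub>R \<alpha>) ** C') *v v)"
    if C': "((\<lambda>t. cocycle_iter \<alpha> A n (x + t *\<^sub>R w)) has_vector_derivative C') (at 0)" and v: "v \<noteq> 0" for x v C'
  proof -
    have "((\<lambda>t. B (x + real n *\<^sub>R \<alpha> + t *\<^sub>R w) ** cocycle_iter \<alpha> A n (x + t *\<^sub>R w)) has_vector_derivative
        B (x + real n *\<^sub>R \<alpha>) ** C' + B' (x + real n *\<^sub>R \<alpha>) ** cocycle_iter \<alpha> A n x) (at 0)"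
      using has_vector_derivative_matrix_mult2[OF B'(6)[of "x + real n *\<^sub>R \<alpha>"] C'] by simp
    moreover have "B (x + real n *\<^sub>R \<alpha> + t *\<^sub>R w) ** cocycle_iter \<alpha> A n (x + t *\<^sub>R w) = M (x + t *\<^sub>R w) ** B (x + t *\<^sub>R w)" for t
      using MB[of "x + t *\<^sub>R w"] by (simp add: algebra_simps)
    moreover have "((\<lambda>t. M (x + t *\<^sub>R w) ** B (x + t *\<^sub>R w)) has_vector_derivative M x ** B' x + M' x ** B x) (at 0)"
      using has_vector_derivative_matrix_mult2[OF M'(3)[of x] B'(6)[of x]] by simp
    ultimately have N': "B' (x + real n *\<^sub>R \<alpha>) ** cocycle_iter \<alpha> A n x + B (x + real n *\<^sub>R \<alpha>) ** C' = M' x ** B x + M x ** B' x"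
      using vector_derivative_unique_at by (metis (no_types, lifting) add.commute ext)
    have Bv: "B x *v v \<noteq> 0"
    proof
      assume "B x *v v = 0"
      then have "adjugate2 (B x) *v (B x *v v) = 0" by simp
      then show False using v B'(3) by (simp add: adjugate2_mult_matrix_vector)
    qed
    have "0 < cross2 (M x *v (B x *v v)) (M' x *v (B x *v v))"
      by (rule monotonic_cross2_pos[OF w M'(1,2,3) Bv]) (use Bv in auto)
    moreover have "cross2 (M x *v (B x *v v)) (M x *v (B' x *v v)) = cross2 (B x *v v) (B' x *v v)"
      by (simp add: cross2_matrix M'(2))
    ultimately show ?thesis
      unfolding N' MB[symmetric]
      by (simp add: matrix_vector_mult_add_rdistrib cross2_add_right matrix_vector_mul_assoc)
  qed
  then show ?thesis using that[OF n B'(1-5)] by blast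
qed

lemma deriv_of_function_real_on_reals:
  assumes hol: "f holomorphic_on ball 0 R" and R: "R > 0"
    and real: "\<And>t. \<bar>t\<bar> < R \<Longrightarrow> f (of_real t) = complex_of_real (g t)"
  shows "(g has_real_derivative Re (deriv f 0)) (at 0)" and "Im (deriv f 0) = 0"
proof -
  have "(f has_field_derivative deriv f 0) (at (of_real 0))"
    using holomorphic_derivI[OF hol] R by simp
  then have "((\<lambda>t. f (of_real t)) has_vector_derivative deriv f 0) (at (0 :: real))"
    by (rule has_vector_derivative_real_field)
  then have v: "((\<lambda>t. complex_of_real (g t)) has_vector_derivative deriv f 0) (at 0)"
    by (rule has_vector_derivative_transform_within_open[where S="{- R<..<R}"]) (use R real in auto)
  show "(g has_real_derivative Re (deriv f 0)) (at 0)"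
    using bounded_linear.has_vector_derivative[OF bounded_linear_Re v]
    by (simp add: has_real_derivative_iff_has_vector_derivative)
  have "((\<lambda>t :: real. 0 :: real) has_vector_derivative Im (deriv f 0)) (at 0)"
    using bounded_linear.has_vector_derivative[OF bounded_linear_Im v] by simp
  then show "Im (deriv f 0) = 0"
    using vector_derivative_unique_at has_vector_derivative_const by blast
qed

lemma holomorphic_quadratic_remainder:
  assumes hol: "f holomorphic_on ball 0 R" and \<rho>: "0 < \<rho>" "\<rho> < R"
    and bound: "\<And>z. cmod z \<le> \<rho> \<Longrightarrow> cmod (f z) \<le> M" and z: "cmod z \<le> \<rho> / 2"
  shows "cmod (f z - f 0 - z * deriv f 0) \<le> 8 * M / \<rho>\<^sup>2 * (cmod z)\<^sup>2"
proof -
  have "cmod ((deriv ^^ 0) f z - (\<Sum>i\<le>1. (deriv ^^ i) f 0 * (z - 0) ^ i / fact i)) \<le> 8 * M / \<rho>\<^sup>2 * cmod (z - 0) ^ Suc 1 / fact 1"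
  proof (rule complex_Taylor[of "cball 0 (\<rho> / 2)" 1 "\<lambda>i. (deriv ^^ i) f"])
    fix i x assume x: "x \<in> cball (0 :: complex) (\<rho> / 2)"
    then have "x \<in> ball 0 R" using \<rho> by simp
    then have "((deriv ^^ i) f has_field_derivative deriv ((deriv ^^ i) f) x) (at x)"
      using holomorphic_derivI[OF holomorphic_higher_deriv[OF hol]] by simp
    then show "((deriv ^^ i) f has_field_derivative (deriv ^^ Suc i) f x) (at x within cball 0 (\<rho> / 2))"
      by (simp add: has_field_derivative_at_within)
  next
    fix x assume x: "x \<in> cball (0 :: complex) (\<rho> / 2)"
    have near: "cmod y \<le> \<rho>" if "cmod (x - y) \<le> \<rho> / 2" for y
      using norm_triangle_ineq4[of x "x - y"] that x by simp
    have sub: "cball x (\<rho> / 2) \<subseteq> ball 0 R"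
    proof
      fix y assume "y \<in> cball x (\<rho> / 2)"
      then show "y \<in> ball 0 R" using near[of y] \<rho> by (simp add: dist_norm)
    qed
    then have sub': "ball x (\<rho> / 2) \<subseteq> ball 0 R" using ball_subset_cball by blast
    have "cmod ((deriv ^^ 2) f x) \<le> fact 2 * M / (\<rho> / 2) ^ 2"
    proof (rule Cauchy_inequality)
      show "f holomorphic_on ball x (\<rho> / 2)"
        by (rule holomorphic_on_subset[OF hol sub'])
      show "continuous_on (cball x (\<rho> / 2)) f"
        by (rule continuous_on_subset[OF holomorphic_on_imp_continuous_on[OF hol] sub])
      show "cmod (f y) \<le> M" if "cmod (x - y) = \<rho> / 2" for y using near[of y] bound that by simp
    qed (use \<rho> in simp)
    then show "cmod ((deriv ^^ Suc 1) f x) \<le> 8 * M / \<rho>\<^sup>2"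
      by (simp add: numeral_2_eq_2 power2_eq_square field_simps)
  qed (use z \<rho> in auto)
  then show ?thesis by (simp add: power2_eq_square algebra_simps)
qed

text \<open>
On a compact disc the functions depend uniformly continuously on the parameter; Cauchy's estimate transfers this to the derivative.
\<close>

lemma continuous_on_deriv_at_zero:
  fixes f :: "'p::topological_space \<Rightarrow> complex \<Rightarrow> complex"
  assumes cont: "continuous_on (P \<times> ball 0 R) (\<lambda>(p, z). f p z)"
    and hol: "\<And>p. p \<in> P \<Longrightarrow> f p holomorphic_on ball 0 R" and R: "R > 0"
  shows "continuous_on P (\<lambda>p. deriv (f p) 0)"
  unfolding continuous_on_def
proof (intro ballI tendstoI)
  fix p0 and e :: real assume p0: "p0 \<in> P" and e: "e > 0"
  define \<rho> where "\<rho> = R / 2"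
  have \<rho>: "0 < \<rho>" "\<rho> < R" using R by (auto simp: \<rho>_def)
  have c: "continuous_on (P \<times> cball 0 \<rho>) (\<lambda>(p, z). f p z)"
    by (rule continuous_on_subset[OF cont]) (use \<rho> in auto)
  have e': "e * \<rho> / 2 > 0" using e \<rho> by simp
  obtain X0 where X0: "p0 \<in> X0" "open X0"
    "\<forall>p\<in>X0 \<inter> P. \<forall>z\<in>cball 0 \<rho>. dist ((\<lambda>(p, z). f p z) (p, z)) ((\<lambda>(p, z). f p z) (p0, z)) \<le> e * \<rho> / 2"
    by (rule continuous_on_prod_compactE[OF c _ p0 e']) auto
  have "dist (deriv (f p) 0) (deriv (f p0) 0) < e" if p: "p \<in> X0" "p \<in> P" for p
  proof -
    define h where "h = (\<lambda>z. f p z - f p0 z)"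
    have hol_h: "h holomorphic_on ball 0 R" unfolding h_def by (intro holomorphic_intros hol p p0)
    have "cmod ((deriv ^^ 1) h 0) \<le> fact 1 * (e * \<rho> / 2) / \<rho> ^ 1"
    proof (rule Cauchy_inequality)
      show "h holomorphic_on ball 0 \<rho>" by (rule holomorphic_on_subset[OF hol_h]) (use \<rho> in auto)
      show "continuous_on (cball 0 \<rho>) h"
        by (rule continuous_on_subset[OF holomorphic_on_imp_continuous_on[OF hol_h]]) (use \<rho> in auto)
      show "cmod (h z) \<le> e * \<rho> / 2" if "cmod (0 - z) = \<rho>" for z
        using X0(3) p that by (auto simp: h_def dist_norm)
    qed (use \<rho> in auto)
    then have "cmod (deriv h 0) \<le> e / 2" using \<rho> by simp
    moreover have "deriv h 0 = deriv (f p) 0 - deriv (f p0) 0"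
      unfolding h_def using hol[OF p(2)] hol[OF p0] R
      by (intro deriv_diff) (auto intro!: holomorphic_on_imp_differentiable_at[of _ "ball 0 R"])
    ultimately show ?thesis using e by (simp add: dist_norm)
  qed
  then show "\<forall>\<^sub>F p in at p0 within P. dist (deriv (f p) 0) (deriv (f p0) 0) < e"
    unfolding eventually_at_topological using X0 by blast
qed

lemma norm_complex_mat2_le_entries:
  assumes "\<And>i j. cmod ((M :: complex ^ 2 ^ 2) $ i $ j) \<le> c"
  shows "norm M \<le> 2 * c"
proof (rule power2_le_imp_le)
  have c: "0 \<le> c" using order_trans[OF norm_ge_zero assms] .
  have sq: "(cmod (M $ i $ j))\<^sup>2 \<le> c\<^sup>2" for i j using assms by (intro power_mono) auto
  show "(norm M)\<^sup>2 \<le> (2 * c)\<^sup>2"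
    unfolding norm_complex_mat2 using sq[of 1 1] sq[of 1 2] sq[of 2 1] sq[of 2 2] by (simp add: power_mult_distrib)
  show "0 \<le> 2 * c" using c by simp
qed

lemma has_vector_derivative_matrix_entries:
  fixes f :: "real \<Rightarrow> real ^ 2 ^ 2"
  assumes "\<And>i j. ((\<lambda>t. f t $ i $ j) has_real_derivative f' $ i $ j) (at x)"
  shows "(f has_vector_derivative f') (at x)"
  unfolding has_vector_derivative_def
proof (subst has_derivative_componentwise_within, intro ballI)
  fix b :: "real ^ 2 ^ 2" assume "b \<in> Basis"
  then obtain i j where b: "b = axis i (axis j 1)" by (auto simp: Basis_vec_def)
  show "((\<lambda>t. f t \<bullet> b) has_derivative (\<lambda>t. (t *\<^sub>R f') \<bullet> b)) (at x)"
    using assms[of i j] unfolding b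
    by (simp add: inner_axis has_field_derivative_def mult_commute_abs)
qed

lemma continuous_on_real_matrix_entries:
  fixes f :: "'a::topological_space \<Rightarrow> real ^ 2 ^ 2"
  assumes "\<And>i j. continuous_on S (\<lambda>x. f x $ i $ j)"
  shows "continuous_on S f"
proof -
  have "continuous_on S (\<lambda>x. \<chi> i j. f x $ i $ j)" by (intro continuous_on_vec_lambda assms)
  then show ?thesis by simp
qed

text \<open>
The gain \<open>p s x v\<close> of rotation speed is positive at \<open>s0\<close>, so by compactness it is at least \<open>\<kappa> |v|\<^sup>2\<close> for all
\<open>s\<close> near \<open>s0\<close>. The complexified cocycle at time \<open>i e\<close> is its first-order Taylor polynomial up to a
remainder of order \<open>e\<^sup>2\<close>, uniformly in \<open>s\<close> and \<open>x\<close>. All radii can therefore be chosen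
independently of \<open>e\<close>; only the amount of contraction \<open>\<delta>\<close> depends on it.
\<close>

lemma uniform_cone_contraction:
  fixes A :: "real \<Rightarrow> real ^ 'n \<Rightarrow> real ^ 2 ^ 2"
  assumes E: "matrix_complexification A w s0 R E" and R: "R > 0"
    and SL2: "\<And>s. \<bar>s - s0\<bar> < R \<Longrightarrow> torus_SL2 (A s)"
    and B_cont: "continuous_on UNIV B" and B_per: "torus_periodic B" and B_det: "\<And>x. det (B x) = 1"
    and B'_cont: "continuous_on UNIV B'" and B'_per: "torus_periodic B'"
    and gain: "\<And>x v C'. ((\<lambda>t. cocycle_iter \<alpha> (A s0) n (x + t *\<^sub>R w)) has_vector_derivative C') (at 0) \<Longrightarrow> v \<noteq> 0 \<Longrightarrow>
       cross2 (B x *v v) (B' x *v v)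
         < cross2 ((B (x + real n *\<^sub>R \<alpha>) ** cocycle_iter \<alpha> (A s0) n x) *v v)
             ((B' (x + real n *\<^sub>R \<alpha>) ** cocycle_iter \<alpha> (A s0) n x + B (x + real n *\<^sub>R \<alpha>) ** C') *v v)"
  shows "\<exists>\<eta>>0. \<exists>e0>0. \<eta> \<le> R \<and> e0 \<le> R \<and> (\<forall>s e. \<bar>s - s0\<bar> < \<eta> \<longrightarrow> 0 < e \<longrightarrow> e < e0 \<longrightarrow>
      (\<forall>x. det (complex_matrix (B x) (e *\<^sub>R B' x)) \<noteq> 0) \<and>
      contracts_cone \<alpha> (\<lambda>x. E (of_real s) x (\<i> * of_real e)) n (\<lambda>x. complex_matrix (B x) (e *\<^sub>R B' x)))"
proof -
  define Ct where "Ct = (\<lambda>s x z. complex_iter \<alpha> (\<lambda>x. E s x z) n x)"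
  define C where "C = (\<lambda>s. cocycle_iter \<alpha> (A s) n)"
  define C' where "C' = (\<lambda>s x. \<chi> i j. Re (deriv (\<lambda>z. Ct (of_real s) x z $ i $ j) 0))"
  have sb: "complex_of_real s \<in> ball (of_real s0) R" if "\<bar>s - s0\<bar> < R" for s
    using that by (simp add: dist_norm abs_minus_commute flip: of_real_diff)
  have Ct_cont: "continuous_on (ball (of_real s0) R \<times> UNIV \<times> ball 0 R) (\<lambda>(s, x, z). Ct s x z)"
  proof -
    have "continuous_on ((ball (of_real s0) R \<times> ball 0 R) \<times> UNIV) (\<lambda>y. (\<lambda>(s, x, z). E s x z) (fst (fst y), snd y, snd (fst y)))"
      by (rule continuous_on_compose2[OF complexification_continuous[OF E]]) (auto intro!: continuous_intros)
    then have "continuous_on ((ball (of_real s0) R \<times> ball 0 R) \<times> UNIV) (\<lambda>(p, x). (\<lambda>p x. E (fst p) x (snd p)) p x)"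
      by (simp add: case_prod_beta)
    then have c: "continuous_on ((ball (of_real s0) R \<times> ball 0 R) \<times> UNIV) (\<lambda>(p, x). complex_iter \<alpha> ((\<lambda>p x. E (fst p) x (snd p)) p) n x)"
      by (rule complex_iter_continuous)
    have "continuous_on (ball (of_real s0) R \<times> UNIV \<times> ball 0 R)
        (\<lambda>y. (\<lambda>(p, x). complex_iter \<alpha> ((\<lambda>p x. E (fst p) x (snd p)) p) n x) ((fst y, snd (snd y)), fst (snd y)))"
      by (rule continuous_on_compose2[OF c]) (auto intro!: continuous_intros)
    then show ?thesis by (simp add: case_prod_beta Ct_def)
  qed
  have Ct_hol: "(\<lambda>z. Ct s x z $ i $ j) holomorphic_on ball 0 R" if "s \<in> ball (of_real s0) R" for s x i j
    unfolding Ct_def by (rule complex_iter_entry_holomorphic) (rule complexification_holomorphic_time[OF E that])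
  have Ct_coc: "torus_cocycle (\<lambda>x. Ct s x z)" if "s \<in> ball (of_real s0) R" "z \<in> ball 0 R" for s z
    unfolding Ct_def by (rule torus_cocycle_iter[OF complexification_torus_cocycle[OF E SL2 that]])
  have Ct_real: "Ct (of_real s) x (of_real t) = complex_matrix (C s (x + t *\<^sub>R w)) 0" if "\<bar>s - s0\<bar> < R" "\<bar>t\<bar> < R" for s x t
  proof -
    have "Ct (of_real s) x (of_real t) = complex_iter \<alpha> (\<lambda>x. complex_matrix (A s (x + t *\<^sub>R w)) 0) n x"
      by (simp only: Ct_def complexification_real[OF E that])
    also have "\<dots> = complex_iter \<alpha> (\<lambda>x. complex_matrix (A s x) 0) n (x + t *\<^sub>R w)"
      by (simp only: complex_iter_translate)
    finally show ?thesis by (simp add: complex_iter_real C_def)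
  qed
  have Ct_real0: "Ct (of_real s) x 0 = complex_matrix (C s x) 0" if "\<bar>s - s0\<bar> < R" for s x
    using Ct_real[OF that, of 0 x] R by simp
  have entry_real: "((\<lambda>t. C s (x + t *\<^sub>R w) $ i $ j) has_real_derivative C' s x $ i $ j) (at 0)"
    "deriv (\<lambda>z. Ct (of_real s) x z $ i $ j) 0 = of_real (C' s x $ i $ j)" if s: "\<bar>s - s0\<bar> < R" for s x i j
  proof -
    have r: "Ct (of_real s) x (of_real t) $ i $ j = of_real (C s (x + t *\<^sub>R w) $ i $ j)" if "\<bar>t\<bar> < R" for t
      by (simp add: Ct_real[OF s that] complex_eq_iff)
    note d = deriv_of_function_real_on_reals[OF Ct_hol[of "of_real s" x i j, OF sb[OF s]] R r]
    show "((\<lambda>t. C s (x + t *\<^sub>R w) $ i $ j) has_real_derivative C' s x $ i $ j) (at 0)"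
      using d(1) by (simp add: C'_def)
    show "deriv (\<lambda>z. Ct (of_real s) x z $ i $ j) 0 = of_real (C' s x $ i $ j)"
      using d(2) by (simp add: C'_def complex_eq_iff)
  qed
  define P where "P = cball s0 (R / 2)"
  have P: "compact P" "s0 \<in> P" "\<And>s. s \<in> P \<Longrightarrow> \<bar>s - s0\<bar> < R"
  proof -
    show "compact P" "s0 \<in> P" using R by (auto simp: P_def)
    show "\<bar>s - s0\<bar> < R" if "s \<in> P" for s using that R unfolding P_def mem_cball dist_real_def by linarith
  qed
  have C_cont: "continuous_on (P \<times> UNIV) (\<lambda>(s, x). C s x)"
  proof (rule continuous_on_real_matrix_entries)
    fix i j
    have "continuous_on (P \<times> UNIV) (\<lambda>y. (\<lambda>(s, x, z). Ct s x z) (of_real (fst y), snd y, 0))"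
      by (rule continuous_on_compose2[OF Ct_cont]) (use P sb R in \<open>auto intro!: continuous_intros\<close>)
    then have "continuous_on (P \<times> UNIV) (\<lambda>y. Re ((\<lambda>(s, x, z). Ct s x z) (of_real (fst y), snd y, 0) $ i $ j))"
      by (intro continuous_intros)
    then show "continuous_on (P \<times> UNIV) (\<lambda>y. (case y of (s, x) \<Rightarrow> C s x) $ i $ j)"
      by (rule continuous_on_eq) (use P(3) Ct_real0 in auto)
  qed
  have C'_cont: "continuous_on (P \<times> UNIV) (\<lambda>(s, x). C' s x)"
  proof (rule continuous_on_real_matrix_entries)
    fix i j
    have "continuous_on ((P \<times> UNIV) \<times> ball 0 R) (\<lambda>y. (\<lambda>(s, x, z). Ct s x z) (of_real (fst (fst y)), snd (fst y), snd y))"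
      by (rule continuous_on_compose2[OF Ct_cont]) (use P sb R in \<open>auto intro!: continuous_intros\<close>)
    then have "continuous_on ((P \<times> UNIV) \<times> ball 0 R) (\<lambda>y. (\<lambda>(s, x, z). Ct s x z) (of_real (fst (fst y)), snd (fst y), snd y) $ i $ j)"
      by (intro continuous_intros)
    then have c: "continuous_on ((P \<times> UNIV) \<times> ball 0 R) (\<lambda>(p, z). (\<lambda>p z. Ct (of_real (fst p)) (snd p) z $ i $ j) p z)"
      by (simp add: case_prod_beta)
    have "continuous_on (P \<times> UNIV) (\<lambda>p. deriv ((\<lambda>p z. Ct (of_real (fst p)) (snd p) z $ i $ j) p) 0)"
      by (rule continuous_on_deriv_at_zero[OF c _ R]) (use P(3) sb Ct_hol in auto)
    then have "continuous_on (P \<times> UNIV) (\<lambda>p. Re (deriv ((\<lambda>p z. Ct (of_real (fst p)) (snd p) z $ i $ j) p) 0))"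
      by (intro continuous_intros)
    then show "continuous_on (P \<times> UNIV) (\<lambda>y. (case y of (s, x) \<Rightarrow> C' s x) $ i $ j)"
      by (simp add: case_prod_beta C'_def)
  qed
  have Ct_per: "Ct s (x + k) z = Ct s x z" if "s \<in> ball (of_real s0) R" "z \<in> ball 0 R" "\<forall>i. k $ i \<in> \<int>" for s x k z
    using Ct_coc[OF that(1,2)] that(3) by (simp add: torus_cocycle_def torus_periodic_def)
  have C_per: "torus_periodic (C s)" if "\<bar>s - s0\<bar> < R" for s
    unfolding torus_periodic_def
  proof (intro allI impI)
    fix x k :: "real ^ 'n" assume k: "\<forall>i. k $ i \<in> \<int>"
    have "complex_matrix (C s (x + k)) 0 = complex_matrix (C s x) 0"
      using Ct_per[OF sb[OF that] _ k, of 0 x] R Ct_real0[OF that] by simp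
    then show "C s (x + k) = C s x" by (simp add: vec_eq_iff)
  qed
  have C'_per: "torus_periodic (C' s)" if s: "\<bar>s - s0\<bar> < R" for s
    unfolding torus_periodic_def
  proof (intro allI impI)
    fix x k :: "real ^ 'n" assume k: "\<forall>i. k $ i \<in> \<int>"
    have "deriv (\<lambda>z. Ct (of_real s) (x + k) z $ i $ j) 0 = deriv (\<lambda>z. Ct (of_real s) x z $ i $ j) 0" for i j
    proof (rule complex_derivative_transform_within_open[of _ "ball 0 R"])
      show "Ct (of_real s) (x + k) z $ i $ j = Ct (of_real s) x z $ i $ j" if "z \<in> ball 0 R" for z
        by (simp add: Ct_per[OF sb[OF s] that k])
    qed (use R Ct_hol[OF sb[OF s]] in auto)
    then show "C' s (x + k) = C' s x" by (simp add: C'_def)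
  qed
  have C_det: "det (C s x) = 1" if "\<bar>s - s0\<bar> < R" for s x
  proof -
    have "det (Ct (of_real s) x 0) = 1" using Ct_coc[OF sb[OF that], of 0] R by (simp add: torus_cocycle_def)
    then have "complex_of_real (det (C s x)) = 1" by (simp only: Ct_real0[OF that] det_complex_matrix_real)
    then show ?thesis by (simp only: of_real_eq_1_iff)
  qed
  define N where "N = (\<lambda>s x. B (x + real n *\<^sub>R \<alpha>) ** C s x)"
  define N' where "N' = (\<lambda>s x. B' (x + real n *\<^sub>R \<alpha>) ** C s x + B (x + real n *\<^sub>R \<alpha>) ** C' s x)"
  define p where "p = (\<lambda>s x v. cross2 (N s x *v v) (N' s x *v v) - cross2 (B x *v v) (B' x *v v))"
  have p_pos: "0 < p s0 x v" if "v \<noteq> 0" for x v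
  proof -
    have "((\<lambda>t. cocycle_iter \<alpha> (A s0) n (x + t *\<^sub>R w)) has_vector_derivative C' s0 x) (at 0)"
      by (rule has_vector_derivative_matrix_entries) (use entry_real(1)[of s0 x] R in \<open>simp add: C_def\<close>)
    from gain[OF this that] show ?thesis by (simp add: p_def N_def N'_def C_def)
  qed
  define K where "K = cbox (0 :: real ^ 'n) 1 \<times> sphere (0 :: real ^ 2) 1"
  have K: "compact K" "K \<noteq> {}"
  proof -
    show "compact K" unfolding K_def by (intro compact_Times) auto
    have "(0 :: real ^ 'n, axis 1 1 :: real ^ 2) \<in> K" by (simp add: K_def mem_box_cart)
    then show "K \<noteq> {}" by blast
  qed
  have p_cont: "continuous_on (P \<times> K) (\<lambda>(s, x, v). p s x v)"
  proof -
    have "continuous_on (P \<times> K) (\<lambda>y. (\<lambda>(s, x). C s x) (fst y, fst (snd y)))"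
      by (rule continuous_on_compose2[OF C_cont]) (auto intro!: continuous_intros)
    moreover have "continuous_on (P \<times> K) (\<lambda>y. (\<lambda>(s, x). C' s x) (fst y, fst (snd y)))"
      by (rule continuous_on_compose2[OF C'_cont]) (auto intro!: continuous_intros)
    moreover have "continuous_on (P \<times> K) (\<lambda>y. B (fst (snd y) + a))" "continuous_on (P \<times> K) (\<lambda>y. B' (fst (snd y) + a))" for a
      by (rule continuous_on_compose2[OF B_cont] continuous_on_compose2[OF B'_cont], auto intro!: continuous_intros)+
    note bb = this[of "real n *\<^sub>R \<alpha>"] this[of 0, simplified]
    ultimately show ?thesis
      unfolding p_def N_def N'_def cross2_def case_prod_beta fst_conv snd_conv
      by (intro continuous_intros bb)
  qed
  have "continuous_on K (\<lambda>q. (\<lambda>(s, x, v). p s x v) (s0, q))"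
    by (rule continuous_on_compose2[OF p_cont]) (use P(2) in \<open>auto intro!: continuous_intros\<close>)
  then obtain q0 where q0: "q0 \<in> K" "\<And>q. q \<in> K \<Longrightarrow> (\<lambda>(s, x, v). p s x v) (s0, q0) \<le> (\<lambda>(s, x, v). p s x v) (s0, q)"
    using continuous_attains_inf[OF K] by blast
  define \<kappa> where "\<kappa> = (\<lambda>(s, x, v). p s x v) (s0, q0) / 2"
  have \<kappa>: "\<kappa> > 0"
  proof -
    obtain x v where q0_eq: "q0 = (x, v)" by (cases q0)
    then have "norm v = 1" using q0(1) by (simp add: K_def)
    then have "v \<noteq> 0" by auto
    then show ?thesis using p_pos[of v x] by (simp add: \<kappa>_def q0_eq)
  qed
  obtain X0 where X0: "s0 \<in> X0" "open X0"
    "\<forall>s\<in>X0 \<inter> P. \<forall>q\<in>K. dist ((\<lambda>(s, x, v). p s x v) (s, q)) ((\<lambda>(s, x, v). p s x v) (s0, q)) \<le> \<kappa>"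
    by (rule continuous_on_prod_compactE[OF p_cont K(1) P(2) \<kappa>])
  obtain \<eta>0 where \<eta>0: "\<eta>0 > 0" "ball s0 \<eta>0 \<subseteq> X0" using X0(1,2) openE by blast
  define \<eta> where "\<eta> = min \<eta>0 (R / 2)"
  have \<eta>: "\<eta> > 0" "\<eta> \<le> R" using \<eta>0 R by (auto simp: \<eta>_def)
  have \<eta>P: "s \<in> P" "s \<in> X0" if "\<bar>s - s0\<bar> < \<eta>" for s
  proof -
    have "\<bar>s - s0\<bar> < \<eta>0" "\<bar>s - s0\<bar> \<le> R / 2" using that by (auto simp: \<eta>_def)
    then have "dist s0 s \<le> R / 2" "s \<in> ball s0 \<eta>0" unfolding mem_ball dist_real_def by linarith+
    then show "s \<in> P" "s \<in> X0" using \<eta>0(2) by (auto simp: P_def)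
  qed
  have p_ge: "\<kappa> * (norm v)\<^sup>2 \<le> p s x v" if s: "\<bar>s - s0\<bar> < \<eta>" for s x v
  proof (cases "v = 0")
    case False
    have unit: "\<kappa> \<le> p s x u" if u: "norm u = 1" for u
    proof -
      obtain k where k: "\<forall>i. k $ i \<in> \<int>" "x + k \<in> cbox 0 1" by (rule integer_translate_into_cube)
      have in_K: "(x + k, u) \<in> K" using k(2) u by (simp add: K_def)
      have "\<bar>p s (x + k) u - p s0 (x + k) u\<bar> \<le> \<kappa>"
        using X0(3) \<eta>P[OF s] in_K by (auto simp: dist_real_def)
      moreover have "2 * \<kappa> \<le> p s0 (x + k) u" using q0(2)[OF in_K] by (simp add: \<kappa>_def)
      ultimately have "\<kappa> \<le> p s (x + k) u" by linarith
      moreover have "p s (x + k) u = p s x u"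
      proof -
        have sR: "\<bar>s - s0\<bar> < R" using s \<eta>(2) by linarith
        have sh: "x + k + real n *\<^sub>R \<alpha> = x + real n *\<^sub>R \<alpha> + k" by simp
        have "B (y + k) = B y" "B' (y + k) = B' y" "C s (y + k) = C s y" "C' s (y + k) = C' s y" for y
          using B_per B'_per C_per[OF sR] C'_per[OF sR] k(1) by (auto simp: torus_periodic_def)
        then show ?thesis unfolding p_def N_def N'_def sh by simp
      qed
      ultimately show ?thesis by simp
    qed
    define u where "u = (1 / norm v) *\<^sub>R v"
    have u: "norm u = 1" "v = norm v *\<^sub>R u" using False by (auto simp: u_def)
    have "p s x v = (norm v)\<^sup>2 * p s x u"
    proof -
      have "p s x (c *\<^sub>R u) = c\<^sup>2 * p s x u" for c
        by (simp add: p_def matrix_vector_mult_scaleR cross2_scaleR right_diff_distrib)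
      from this[of "norm v"] show ?thesis using u(2) by simp
    qed
    then show ?thesis using mult_left_mono[OF unit[OF u(1)], of "(norm v)\<^sup>2"] by (simp add: mult.commute)
  qed (simp add: p_def cross2_def)
  obtain \<Gamma>1 where \<Gamma>1: "\<Gamma>1 > 0" "\<And>x. norm (B x) \<le> \<Gamma>1" using torus_periodic_bounded[OF B_cont B_per] by blast
  obtain \<Gamma>2 where \<Gamma>2: "\<Gamma>2 > 0" "\<And>x. norm (B' x) \<le> \<Gamma>2" using torus_periodic_bounded[OF B'_cont B'_per] by blast
  obtain \<Gamma>3 where \<Gamma>3: "\<Gamma>3 > 0" "\<forall>s\<in>P. \<forall>x. norm (C s x) \<le> \<Gamma>3"
    using torus_periodic_family_bounded[OF P(1) C_cont C_per[OF P(3)]] by blast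
  obtain \<Gamma>4 where \<Gamma>4: "\<Gamma>4 > 0" "\<forall>s\<in>P. \<forall>x. norm (C' s x) \<le> \<Gamma>4"
    using torus_periodic_family_bounded[OF P(1) C'_cont C'_per[OF P(3)]] by blast
  define \<Gamma> where "\<Gamma> = max (max \<Gamma>1 \<Gamma>2) (max \<Gamma>3 \<Gamma>4)"
  have \<Gamma>: "\<Gamma> > 0" "\<Gamma>1 \<le> \<Gamma>" "\<Gamma>2 \<le> \<Gamma>" "\<Gamma>3 \<le> \<Gamma>" "\<Gamma>4 \<le> \<Gamma>" using \<Gamma>1 by (auto simp: \<Gamma>_def)
  define Q where "Q = cball (complex_of_real s0) (R / 2) \<times> cball (0 :: complex) (R / 2)"
  obtain M where M: "M > 0" "\<forall>q\<in>Q. \<forall>x. norm (Ct (fst q) x (snd q)) \<le> M"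
  proof -
    have sub: "fst q \<in> ball (of_real s0) R" "snd q \<in> ball 0 R" if "q \<in> Q" for q
      using that R by (auto simp: Q_def)
    have cQ: "compact Q" unfolding Q_def by (intro compact_Times) auto
    have "continuous_on (Q \<times> UNIV) (\<lambda>y. (\<lambda>(s, x, z). Ct s x z) (fst (fst y), snd y, snd (fst y)))"
      by (rule continuous_on_compose2[OF Ct_cont]) (use sub in \<open>force intro!: continuous_intros\<close>)+
    then have c: "continuous_on (Q \<times> UNIV) (\<lambda>(q, x). (\<lambda>q x. Ct (fst q) x (snd q)) q x)" by (simp add: case_prod_beta)
    have per: "torus_periodic ((\<lambda>q x. Ct (fst q) x (snd q)) q)" if "q \<in> Q" for q
      using Ct_coc[OF sub[OF that]] by (simp add: torus_cocycle_def)
    show ?thesis using torus_periodic_family_bounded[OF cQ c per] that by blast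
  qed
  \<comment> \<open>the Taylor remainder of each entry on the disc of radius \<open>R / 2\<close>, and a factor \<open>2\<close> for the norm of the matrix\<close>
  define k where "k = 2 * (8 * M / (R / 2)\<^sup>2)"
  define H where "H = \<Gamma>\<^sup>2 + 2 * \<Gamma> * k"
  define L where "L = 4 * \<Gamma> ^ 4 + \<Gamma>\<^sup>2 + 6 * \<Gamma>\<^sup>2 * H + H\<^sup>2"
  have k0: "k \<ge> 0" using M(1) by (simp add: k_def)
  have H0: "H \<ge> 0" unfolding H_def using k0 \<Gamma>(1) by (intro add_nonneg_nonneg mult_nonneg_nonneg) auto
  have L0: "L \<ge> 0" unfolding L_def using H0 \<Gamma>(1) by (intro add_nonneg_nonneg mult_nonneg_nonneg) auto
  \<comment> \<open>the bounds ensure, in this order: the hypothesis of the gain estimate, the range of the Taylor estimate,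
    a positive net gain \<open>e \<kappa> - L e\<^sup>2\<close>, and invertibility of the frame\<close>
  define e0 where "e0 = min (min 1 (R / 4)) (min (\<kappa> / (L + 1)) (1 / (\<Gamma> + 1)))"
  have e0: "e0 > 0" "e0 \<le> 1" "e0 \<le> R / 4" "e0 \<le> \<kappa> / (L + 1)" "e0 \<le> 1 / (\<Gamma> + 1)"
  proof -
    show "e0 > 0" using R \<kappa> L0 \<Gamma>(1) by (auto simp: e0_def)
    show "e0 \<le> 1" "e0 \<le> R / 4" "e0 \<le> \<kappa> / (L + 1)" "e0 \<le> 1 / (\<Gamma> + 1)" unfolding e0_def by linarith+
  qed
  have e0R: "e0 \<le> R" using e0(3) R by linarith
  have det_nz: "det (complex_matrix (B x) (e *\<^sub>R B' x)) \<noteq> 0" if e: "0 < e" "e < e0" for e x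
  proof -
    have "e * \<Gamma> < 1"
    proof -
      have "e < 1 / (\<Gamma> + 1)" using e e0(5) by linarith
      then have "e * (\<Gamma> + 1) < 1" using \<Gamma>(1) by (simp add: pos_less_divide_eq)
      then show ?thesis using e(1) by (simp add: algebra_simps)
    qed
    then have "(e * \<Gamma>)\<^sup>2 < 1" using e \<Gamma>(1) by (simp add: power_less_one_iff abs_square_less_1)
    moreover have "\<bar>det (B' x)\<bar> \<le> \<Gamma>\<^sup>2"
    proof -
      have "(norm (B' x))\<^sup>2 \<le> \<Gamma>\<^sup>2" using \<Gamma>2(2)[of x] \<Gamma>(3) by (intro power_mono) auto
      then show ?thesis using abs_det2_le[of "B' x"] by linarith
    qed
    then have "e\<^sup>2 * \<bar>det (B' x)\<bar> \<le> (e * \<Gamma>)\<^sup>2" by (simp add: power_mult_distrib mult_left_mono)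
    ultimately have "\<bar>e\<^sup>2 * det (B' x)\<bar> < 1" by (simp add: abs_mult)
    moreover have "Re (det (complex_matrix (B x) (e *\<^sub>R B' x))) = det (B x) - e\<^sup>2 * det (B' x)"
      by (simp add: det_2 power2_eq_square algebra_simps)
    ultimately have "0 < Re (det (complex_matrix (B x) (e *\<^sub>R B' x)))" using B_det[of x] by linarith
    then show ?thesis by auto
  qed
  have cone: "contracts_cone \<alpha> (\<lambda>x. E (of_real s) x (\<i> * of_real e)) n (\<lambda>x. complex_matrix (B x) (e *\<^sub>R B' x))"
    if s: "\<bar>s - s0\<bar> < \<eta>" and e: "0 < e" "e < e0" for s e
  proof -
    have sP: "s \<in> P" using \<eta>P[OF s] by blast
    have sR: "\<bar>s - s0\<bar> < R" using P(3)[OF sP] .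
    define \<delta> where "\<delta> = e * \<kappa> - L * e\<^sup>2"
    have "\<delta> > 0"
    proof -
      have "e < \<kappa> / (L + 1)" using e e0(4) by linarith
      then have "e * (L + 1) < \<kappa>" using L0 by (simp add: pos_less_divide_eq)
      then have "L * e < \<kappa>" using e(1) by (simp add: algebra_simps)
      then have "e * (L * e) < e * \<kappa>" using e(1) by (rule mult_strict_left_mono)
      then show ?thesis by (simp add: \<delta>_def power2_eq_square algebra_simps)
    qed
    moreover have "cone_form (complex_matrix (B x) (e *\<^sub>R B' x) *v v) + \<delta> * (norm v)\<^sup>2
         \<le> cone_form (complex_matrix (B (x + real n *\<^sub>R \<alpha>)) (e *\<^sub>R B' (x + real n *\<^sub>R \<alpha>)) *v
              (complex_iter \<alpha> (\<lambda>x. E (of_real s) x (\<i> * of_real e)) n x *v v))" for x v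
    proof -
      define Rm where "Rm = Ct (of_real s) x (\<i> * of_real e) - complex_matrix (C s x) (e *\<^sub>R C' s x)"
      have Rm_bound: "norm Rm \<le> k * e\<^sup>2"
      proof -
        have "cmod (Rm $ i $ j) \<le> 8 * M / (R / 2)\<^sup>2 * e\<^sup>2" for i j
        proof -
          define f where "f = (\<lambda>z. Ct (of_real s) x z $ i $ j)"
          have "cmod (f (\<i> * of_real e) - f 0 - (\<i> * of_real e) * deriv f 0) \<le> 8 * M / (R / 2)\<^sup>2 * (cmod (\<i> * of_real e))\<^sup>2"
          proof (rule holomorphic_quadratic_remainder)
            show "f holomorphic_on ball 0 R" unfolding f_def by (rule Ct_hol[OF sb[OF sR]])
            show "cmod (f z) \<le> M" if "cmod z \<le> R / 2" for z
            proof -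
              have "complex_of_real s \<in> cball (of_real s0) (R / 2)"
                using sP by (simp add: P_def dist_norm flip: of_real_diff)
              then have "(complex_of_real s, z) \<in> Q" using that by (simp add: Q_def)
              then have "norm (Ct (of_real s) x z) \<le> M" using M(2) by fastforce
              moreover have "cmod (f z) \<le> norm (Ct (of_real s) x z)"
                unfolding f_def by (rule order_trans[OF Finite_Cartesian_Product.norm_nth_le Finite_Cartesian_Product.norm_nth_le])
              ultimately show ?thesis by linarith
            qed
            show "cmod (\<i> * complex_of_real e) \<le> R / 2 / 2" using e e0(3) by (simp add: norm_mult)
          qed (use R in auto)
          moreover have "f (\<i> * of_real e) - f 0 - (\<i> * of_real e) * deriv f 0 = Rm $ i $ j"
            unfolding f_def entry_real(2)[OF sR] Rm_def by (simp add: Ct_real0[OF sR] complex_eq_iff)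
          ultimately show ?thesis using e by (simp add: norm_mult)
        qed
        then have "norm Rm \<le> 2 * (8 * M / (R / 2)\<^sup>2 * e\<^sup>2)" by (rule norm_complex_mat2_le_entries)
        then show ?thesis by (simp add: k_def)
      qed
      have "cone_form (complex_matrix (B x) (e *\<^sub>R B' x) *v v) + (e * \<kappa> - L * e\<^sup>2) * (norm v)\<^sup>2
          \<le> cone_form (complex_matrix (B (x + real n *\<^sub>R \<alpha>)) (e *\<^sub>R B' (x + real n *\<^sub>R \<alpha>)) *v
              ((complex_matrix (C s x) (e *\<^sub>R C' s x) + Rm) *v v))"
      proof (rule cone_form_gain[OF _ _ _ _ _ _ _ _ Rm_bound _ _ H_def L_def])
        show "det (B x) = 1" by (rule B_det)
        show "det (B (x + real n *\<^sub>R \<alpha>) ** C s x) = 1" by (simp add: det_mul B_det C_det[OF sR])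
        show "cross2 (B x *v v) (B' x *v v) + \<kappa> * (norm v)\<^sup>2
            \<le> cross2 ((B (x + real n *\<^sub>R \<alpha>) ** C s x) *v v) ((B' (x + real n *\<^sub>R \<alpha>) ** C s x + B (x + real n *\<^sub>R \<alpha>) ** C' s x) *v v)" for v
          using p_ge[OF s, of v x] by (simp add: p_def N_def N'_def)
        show "norm (B' x) \<le> \<Gamma>" "norm (B' (x + real n *\<^sub>R \<alpha>)) \<le> \<Gamma>" using \<Gamma>2(2) \<Gamma>(3) order_trans by blast+
        show "norm (B (x + real n *\<^sub>R \<alpha>)) \<le> \<Gamma>" using \<Gamma>1(2) \<Gamma>(2) order_trans by blast
        show "norm (C s x) \<le> \<Gamma>" using \<Gamma>3(2) sP \<Gamma>(4) order_trans by blast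
        show "norm (C' s x) \<le> \<Gamma>" using \<Gamma>4(2) sP \<Gamma>(5) order_trans by blast
        show "0 < e" "e \<le> 1" using e e0(2) by auto
      qed
      then show ?thesis by (simp add: Rm_def \<delta>_def Ct_def)
    qed
    ultimately show ?thesis unfolding contracts_cone_def by blast
  qed
  show ?thesis
    by (rule exI[of _ \<eta>], rule conjI[OF \<eta>(1)], rule exI[of _ e0])
       (use e0(1) e0R \<eta>(2) det_nz cone in blast)
qed

section \<open>The Lyapunov exponent on the boundary of the half plane\<close>

lemma locally_affine_on_interval:
  fixes U :: "real \<Rightarrow> real"
  assumes loc: "\<And>x. x \<in> {a<..<b} \<Longrightarrow> \<exists>\<rho>>0. \<exists>p q. \<forall>y. \<bar>y - x\<bar> < \<rho> \<longrightarrow> U y = p + q * y"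
  shows "\<exists>p q. \<forall>x\<in>{a<..<b}. U x = p + q * x"
proof -
  have "\<exists>\<rho>>0. \<exists>q. \<forall>y. \<bar>y - x\<bar> < \<rho> \<longrightarrow> (U has_real_derivative q) (at y)" if x: "x \<in> {a<..<b}" for x
  proof -
    obtain \<rho> p q where \<rho>: "\<rho> > 0" and U: "\<And>y. \<bar>y - x\<bar> < \<rho> \<Longrightarrow> U y = p + q * y" using loc[OF x] by blast
    have "(U has_real_derivative q) (at y)" if y: "\<bar>y - x\<bar> < \<rho>" for y
    proof (rule has_field_derivative_transform_within_open)
      show "((\<lambda>y. p + q * y) has_real_derivative q) (at y)" by (auto intro!: derivative_eq_intros)
      show "open (ball x \<rho>)" by simp
      show "y \<in> ball x \<rho>" using y by (simp add: dist_real_def abs_minus_commute)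
      show "p + q * u = U u" if "u \<in> ball x \<rho>" for u using that U[of u] by (simp add: dist_real_def abs_minus_commute)
    qed
    then show ?thesis using \<rho> by blast
  qed
  then have D: "\<exists>\<rho>>0. \<exists>q. \<forall>y. \<bar>y - x\<bar> < \<rho> \<longrightarrow> (U has_real_derivative q) (at y)" if "x \<in> {a<..<b}" for x using that by blast
  have "(deriv U has_real_derivative 0) (at x)" if x: "x \<in> {a<..<b}" for x
  proof -
    obtain \<rho> q where \<rho>: "\<rho> > 0" and q: "\<And>y. \<bar>y - x\<bar> < \<rho> \<Longrightarrow> (U has_real_derivative q) (at y)" using D[OF x] by blast
    show ?thesis
    proof (rule has_field_derivative_transform_within_open)
      show "((\<lambda>y. q) has_real_derivative 0) (at x)" by simp
      show "q = deriv U u" if "u \<in> ball x \<rho>" for u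
        using that q[of u] by (intro DERIV_imp_deriv[symmetric]) (simp add: dist_real_def abs_minus_commute)
    qed (use \<rho> in auto)
  qed
  then have "\<exists>c. \<forall>x\<in>{a<..<b}. deriv U x = c"
    by (intro has_field_derivative_zero_constant) (auto intro: has_field_derivative_at_within)
  then obtain q where q: "\<And>x. x \<in> {a<..<b} \<Longrightarrow> deriv U x = q" by blast
  have "((\<lambda>x. U x - q * x) has_real_derivative 0) (at x)" if x: "x \<in> {a<..<b}" for x
  proof -
    obtain \<rho> q' where "\<rho> > 0" "\<And>y. \<bar>y - x\<bar> < \<rho> \<Longrightarrow> (U has_real_derivative q') (at y)" using D[OF x] by blast
    then have d: "(U has_real_derivative q') (at x)" by simp
    then have "q' = q" using q[OF x] DERIV_imp_deriv by blast
    then show ?thesis using d by (auto intro!: derivative_eq_intros)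
  qed
  then have "\<exists>c. \<forall>x\<in>{a<..<b}. U x - q * x = c"
    by (intro has_field_derivative_zero_constant) (auto intro: has_field_derivative_at_within)
  then obtain p where "\<And>x. x \<in> {a<..<b} \<Longrightarrow> U x - q * x = p" by blast
  then show ?thesis by (intro exI[of _ p] exI[of _ q]) (auto simp: algebra_simps)
qed

text \<open>
The derivative of \<open>G\<close> has vanishing real part, hence is constant by the open mapping theorem.
\<close>

lemma Re_depending_on_Im_affine:
  fixes G :: "complex \<Rightarrow> complex" and U :: "real \<Rightarrow> real"
  assumes hol: "G holomorphic_on ball z0 \<rho>" and \<rho>: "\<rho> > 0"
    and Re_G: "\<And>z. z \<in> ball z0 \<rho> \<Longrightarrow> Re (G z) = U (Im z)"
  shows "\<exists>p q. \<forall>z\<in>ball z0 \<rho>. Re (G z) = p + q * Im z"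
proof -
  have Re_deriv: "Re (deriv G z) = 0" if z: "z \<in> ball z0 \<rho>" for z
  proof -
    obtain e where e: "e > 0" "ball z e \<subseteq> ball z0 \<rho>" using z openE[OF open_ball] by blast
    have "((\<lambda>w. G (z + w)) has_field_derivative deriv G z) (at (of_real 0))"
      using holomorphic_derivI[OF hol open_ball z] by (simp add: DERIV_shift[symmetric] add.commute)
    then have "((\<lambda>t. G (z + of_real t)) has_vector_derivative deriv G z) (at (0 :: real))"
      by (rule has_vector_derivative_real_field)
    then have "((\<lambda>t. Re (G (z + of_real t))) has_vector_derivative Re (deriv G z)) (at (0 :: real))"
      by (rule bounded_linear.has_vector_derivative[OF bounded_linear_Re])
    then have "((\<lambda>t :: real. U (Im z)) has_vector_derivative Re (deriv G z)) (at 0)"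
    proof (rule has_vector_derivative_transform_within_open)
      show "open {- e<..<e}" "0 \<in> {- e<..<e}" using e by auto
      show "Re (G (z + of_real t)) = U (Im z)" if "t \<in> {- e<..<e}" for t
      proof -
        have "z + of_real t \<in> ball z e" using that by (simp add: dist_norm abs_less_iff)
        then show ?thesis using e(2) Re_G[of "z + of_real t"] by auto
      qed
    qed
    then show ?thesis using vector_derivative_unique_at has_vector_derivative_const by blast
  qed
  have "deriv G constant_on ball z0 \<rho>"
  proof (rule ccontr)
    assume "\<not> deriv G constant_on ball z0 \<rho>"
    then have op: "open (deriv G ` ball z0 \<rho>)"
      by (intro open_mapping_thm[OF holomorphic_deriv[OF hol]]) auto
    have "deriv G z0 \<in> deriv G ` ball z0 \<rho>" using \<rho> by simp
    then obtain e where e: "e > 0" "ball (deriv G z0) e \<subseteq> deriv G ` ball z0 \<rho>" using op openE by blast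
    have "deriv G z0 + of_real (e / 2) \<in> ball (deriv G z0) e" using e(1) by (simp add: dist_norm)
    then have "deriv G z0 + of_real (e / 2) \<in> deriv G ` ball z0 \<rho>" using e(2) by blast
    then obtain z where z: "z \<in> ball z0 \<rho>" "deriv G z0 + of_real (e / 2) = deriv G z" by (rule imageE)
    have "Re (deriv G z0 + of_real (e / 2)) = 0" unfolding z(2) by (rule Re_deriv[OF z(1)])
    then show False using Re_deriv[of z0] \<rho> e(1) by simp
  qed
  then obtain k where k: "\<And>z. z \<in> ball z0 \<rho> \<Longrightarrow> deriv G z = k" by (auto simp: constant_on_def)
  have "((\<lambda>z. G z - k * z) has_field_derivative 0) (at z within ball z0 \<rho>)" if z: "z \<in> ball z0 \<rho>" for z
  proof -
    have "(G has_field_derivative k) (at z)" using holomorphic_derivI[OF hol open_ball z] k[OF z] by simp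
    then have "((\<lambda>z. G z - k * z) has_field_derivative 0) (at z)" by (auto intro!: derivative_eq_intros)
    then show ?thesis by (rule has_field_derivative_at_within)
  qed
  then have "\<exists>c. \<forall>z\<in>ball z0 \<rho>. G z - k * z = c"
    by (rule has_field_derivative_zero_constant[OF convex_ball])
  then obtain c where c: "\<And>z. z \<in> ball z0 \<rho> \<Longrightarrow> G z - k * z = c" by blast
  have "Re k = 0" using Re_deriv[of z0] k[of z0] \<rho> by simp
  have "Re (G z) = Re c + (- Im k) * Im z" if "z \<in> ball z0 \<rho>" for z
  proof -
    have "G z = c + k * z" using c[OF that] by (simp add: algebra_simps)
    then show ?thesis using \<open>Re k = 0\<close> by simp
  qed
  then show ?thesis by blast
qed

definition conj_matrix :: "complex ^ 2 ^ 2 \<Rightarrow> complex ^ 2 ^ 2" where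
  "conj_matrix M = (\<chi> i j. cnj (M $ i $ j))"

lemma conj_matrix_mult: "conj_matrix (M ** N) = conj_matrix M ** conj_matrix N"
  by (simp add: conj_matrix_def vec_eq_iff matrix_mult_entry2)

lemma norm_conj_matrix: "norm (conj_matrix M) = norm M"
proof -
  have "(norm (conj_matrix M))\<^sup>2 = (norm M)\<^sup>2" unfolding norm_complex_mat2 by (simp add: conj_matrix_def)
  then show ?thesis by (simp add: power2_eq_iff_nonneg)
qed

lemma complex_iter_conj: "complex_iter \<alpha> (\<lambda>x. conj_matrix (F x)) n x = conj_matrix (complex_iter \<alpha> F n x)"
proof (induction n)
  case 0
  show ?case by (simp add: conj_matrix_def vec_eq_iff mat_def)
qed (simp add: conj_matrix_mult)

lemma mean_log_norm_conj: "mean_log_norm \<alpha> (\<lambda>x. conj_matrix (F x)) = mean_log_norm \<alpha> F"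
  by (simp add: mean_log_norm_def complex_iter_conj norm_conj_matrix fun_eq_iff)

lemma mean_log_norm_le:
  assumes F: "torus_cocycle F" and bound: "\<And>x. norm (F x) \<le> \<Gamma>" "1 \<le> \<Gamma>" and N: "N \<ge> 1"
  shows "mean_log_norm \<alpha> F N \<le> ln 2 + ln \<Gamma>"
proof -
  have "\<bar>integral (cbox 0 1) (\<lambda>x. ln (norm (complex_iter \<alpha> F N x)))\<bar> \<le> ln 2 + real N * ln \<Gamma>"
  proof (rule torus_integral_abs_le[OF continuous_log_norm_iter[OF F]])
    fix x
    have ge1: "1 \<le> norm (complex_iter \<alpha> F N x)" by (rule torus_cocycle_norm_ge_1[OF F])
    have "ln (norm (complex_iter \<alpha> F N x)) \<le> ln (2 * \<Gamma> ^ N)"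
      using ge1 complex_iter_norm_le[of F \<Gamma> \<alpha> N x] bound by (intro ln_mono) auto
    also have "\<dots> = ln 2 + real N * ln \<Gamma>" using bound(2) by (simp add: ln_mult ln_realpow)
    finally show "\<bar>ln (norm (complex_iter \<alpha> F N x))\<bar> \<le> ln 2 + real N * ln \<Gamma>" using ge1 by simp
  qed
  then have "mean_log_norm \<alpha> F N \<le> (ln 2 + real N * ln \<Gamma>) / real N"
    unfolding mean_log_norm_def by (intro divide_right_mono) auto
  also have "\<dots> = ln 2 / real N + ln \<Gamma>" using N by (simp add: field_simps)
  also have "\<dots> \<le> ln 2 + ln \<Gamma>" using N by (simp add: divide_le_eq)
  finally show ?thesis .
qed

text \<open>
Write \<open>U e\<close> for the exponent at time \<open>i e\<close>. On \<open>0 < e < e0\<close> it is \<open>a + c e\<close>, and the claim amounts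
to \<open>U 0 = a\<close>. The inequality \<open>a \<le> U 0\<close> is upper semicontinuity; \<open>U 0 \<le> a\<close> follows from the sub-mean value
property on circles of radius \<open>\<rho>\<close> around \<open>0\<close>, which meet the line \<open>e = 0\<close> in a null set only.
\<close>

theorem lyapunov_at_boundary:
  fixes F :: "complex \<Rightarrow> real ^ 'n \<Rightarrow> complex ^ 2 ^ 2"
  assumes cont: "continuous_on (ball 0 R \<times> UNIV) (\<lambda>(z, x). F z x)"
    and hol: "\<And>x i j. (\<lambda>z. F z x $ i $ j) holomorphic_on ball 0 R"
    and coc: "\<And>z. z \<in> ball 0 R \<Longrightarrow> torus_cocycle (F z)"
    and shift: "\<And>z t x. z \<in> ball 0 R \<Longrightarrow> z + of_real t \<in> ball 0 R \<Longrightarrow> F (z + of_real t) x = F z (x + t *\<^sub>R w)"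
    and conj: "\<And>z x. z \<in> ball 0 R \<Longrightarrow> F (cnj z) x = conj_matrix (F z x)"
    and e0: "0 < e0" "e0 \<le> R"
    and harmonic: "\<And>e. 0 < e \<Longrightarrow> e < e0 \<Longrightarrow> \<exists>\<rho>>0. ball (\<i> * of_real e) \<rho> \<subseteq> ball 0 R \<and>
        (\<exists>G. G holomorphic_on ball (\<i> * of_real e) \<rho> \<and>
          (\<forall>z\<in>ball (\<i> * of_real e) \<rho>. Re (G z) = complex_lyapunov \<alpha> (F z)))"
    and e1: "0 < e1" "2 * e1 < e0"
  shows "complex_lyapunov \<alpha> (F 0) =
     2 * complex_lyapunov \<alpha> (F (\<i> * of_real e1)) - complex_lyapunov \<alpha> (F (\<i> * of_real (2 * e1)))"
proof -
  have R: "R > 0" using e0 by linarith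
  define m where "m = (\<lambda>N e. mean_log_norm \<alpha> (F (\<i> * of_real e)) N)"
  define U where "U = (\<lambda>e. complex_lyapunov \<alpha> (F (\<i> * of_real e)))"
  have vert: "\<i> * of_real (Im z) \<in> ball 0 R" if "z \<in> ball 0 R" for z
    using that abs_Im_le_cmod[of z] by (simp add: norm_mult)
  have mean_Im: "mean_log_norm \<alpha> (F z) N = m N (Im z)" and lyap_Im: "complex_lyapunov \<alpha> (F z) = U (Im z)"
    if z: "z \<in> ball 0 R" for z N
  proof -
    have z_eq: "z = \<i> * of_real (Im z) + of_real (Re z)" by (simp add: complex_eq_iff)
    have "F z x = F (\<i> * of_real (Im z)) (x + Re z *\<^sub>R w)" for x
      using shift[OF vert[OF z], of "Re z" x] z z_eq by simp
    then have "F z = (\<lambda>x. F (\<i> * of_real (Im z)) (x + Re z *\<^sub>R w))" by blast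
    then show "mean_log_norm \<alpha> (F z) N = m N (Im z)" "complex_lyapunov \<alpha> (F z) = U (Im z)"
      using complex_lyapunov_translate[OF coc[OF vert[OF z]], of \<alpha> "Re z *\<^sub>R w"] by (simp_all add: m_def U_def)
  qed
  have vb: "\<i> * of_real e \<in> ball 0 R" if "\<bar>e\<bar> < R" for e using that by (simp add: norm_mult)
  have U_even: "U (- e) = U e" if e: "\<bar>e\<bar> < R" for e
  proof -
    have "F (cnj (\<i> * of_real e)) = (\<lambda>x. conj_matrix (F (\<i> * of_real e) x))" using conj[OF vb[OF e]] by blast
    moreover have "cnj (\<i> * of_real e) = \<i> * of_real (- e)" by simp
    ultimately show ?thesis by (simp add: U_def complex_lyapunov_def mean_log_norm_conj)
  qed
  have "\<exists>p q. \<forall>x\<in>{0<..<e0}. U x = p + q * x"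
  proof (rule locally_affine_on_interval)
    fix x assume x: "x \<in> {0<..<e0}"
    then obtain \<rho> G where \<rho>: "\<rho> > 0" "ball (\<i> * of_real x) \<rho> \<subseteq> ball 0 R" and G: "G holomorphic_on ball (\<i> * of_real x) \<rho>"
      "\<And>z. z \<in> ball (\<i> * of_real x) \<rho> \<Longrightarrow> Re (G z) = complex_lyapunov \<alpha> (F z)"
      using harmonic[of x] by auto
    have "Re (G z) = U (Im z)" if "z \<in> ball (\<i> * of_real x) \<rho>" for z
      using G(2)[OF that] lyap_Im[of z] that \<rho>(2) by auto
    from Re_depending_on_Im_affine[OF G(1) \<rho>(1) this] obtain p q where
      pq: "\<And>z. z \<in> ball (\<i> * of_real x) \<rho> \<Longrightarrow> Re (G z) = p + q * Im z" by blast
    have "U y = p + q * y" if "\<bar>y - x\<bar> < \<rho>" for y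
    proof -
      have "dist (\<i> * complex_of_real x) (\<i> * of_real y) = \<bar>x - y\<bar>"
        by (simp add: dist_norm norm_mult flip: right_diff_distrib of_real_diff)
      then have "\<i> * complex_of_real y \<in> ball (\<i> * of_real x) \<rho>" using that by simp
      then show ?thesis using pq[of "\<i> * of_real y"] G(2)[of "\<i> * of_real y"] by (simp add: U_def)
    qed
    then show "\<exists>\<rho>>0. \<exists>p q. \<forall>y. \<bar>y - x\<bar> < \<rho> \<longrightarrow> U y = p + q * y" using \<rho>(1) by blast
  qed
  then obtain a c where affine: "\<And>x. 0 < x \<Longrightarrow> x < e0 \<Longrightarrow> U x = a + c * x" by auto
  have iter_cont: "continuous_on (ball 0 R \<times> UNIV) (\<lambda>(z, x). complex_iter \<alpha> (F z) N x)" for N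
    by (rule complex_iter_continuous[OF cont])
  have iter_ge1: "1 \<le> norm (complex_iter \<alpha> (F z) N x)" if "z \<in> ball 0 R" for z N x
    by (rule torus_cocycle_norm_ge_1[OF coc[OF that]])
  have log_cont: "continuous_on (ball 0 R \<times> UNIV) (\<lambda>(z, x). ln (norm (complex_iter \<alpha> (F z) N x)))" for N
  proof -
    have "norm (complex_iter \<alpha> (F (fst y)) N (snd y)) \<noteq> 0" if "y \<in> ball 0 R \<times> UNIV" for y
      using iter_ge1[of "fst y" N "snd y"] that by auto
    then show ?thesis
      using iter_cont[of N] unfolding case_prod_beta by (intro continuous_intros) auto
  qed
  have mean_cont: "continuous_on (ball 0 R) (\<lambda>z. mean_log_norm \<alpha> (F z) N)" for N
  proof -
    have "continuous_on (ball 0 R) (\<lambda>z. integral (cbox 0 1) (\<lambda>x. ln (norm (complex_iter \<alpha> (F z) N x))))"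
      by (rule integral_continuous_on_param) (rule continuous_on_subset[OF log_cont], auto)
    then show ?thesis
      unfolding mean_log_norm_def divide_inverse by (intro continuous_on_mult continuous_on_const)
  qed
  have m_tendsto: "((\<lambda>e. m N e) \<longlongrightarrow> m N 0) (at_right 0)" for N
  proof -
    have "isCont (\<lambda>z. mean_log_norm \<alpha> (F z) N) 0"
      using mean_cont[of N] R by (simp add: continuous_on_eq_continuous_at)
    moreover have "((\<lambda>e. \<i> * complex_of_real e) \<longlongrightarrow> \<i> * of_real 0) (at_right 0)"
      by (intro tendsto_intros)
    ultimately show ?thesis unfolding m_def using isCont_tendsto_compose[of _ "\<lambda>z. mean_log_norm \<alpha> (F z) N"] by force
  qed
  have upper: "a \<le> U 0"
  proof -
    have "a \<le> m N 0" if N: "N \<ge> 1" for N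
    proof (rule tendsto_le[OF _ m_tendsto])
      have "((\<lambda>e. a + c * e) \<longlongrightarrow> a + c * 0) (at_right 0)" by (intro tendsto_intros)
      then show "((\<lambda>e. a + c * e) \<longlongrightarrow> a) (at_right 0)" by simp
      have "a + c * e \<le> m N e" if "0 < e" "e < e0" for e
        using complex_lyapunov_limit(2)[OF coc[OF vb] N, of e \<alpha>] affine[OF that] that e0 by (simp add: U_def m_def)
      then show "\<forall>\<^sub>F e in at_right 0. a + c * e \<le> m N e"
        using e0(1) by (auto simp: eventually_at_right_field intro!: exI[of _ e0])
    qed simp
    moreover have "(\<lambda>N. m N 0) \<longlonglongrightarrow> U 0"
      using complex_lyapunov_limit(1)[OF coc[OF vb[of 0]], of \<alpha>] R by (simp add: m_def U_def)
    ultimately show ?thesis by (intro LIMSEQ_le_const) auto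
  qed
  have lower: "U 0 \<le> a + \<bar>c\<bar> * \<rho>" if \<rho>: "0 < \<rho>" "\<rho> < e0" for \<rho>
  proof -
    have \<rho>R: "\<rho> < R" using \<rho> e0 by linarith
    have circ: "complex_of_real \<rho> * cis \<theta> \<in> ball 0 R" for \<theta> using \<rho> \<rho>R by (simp add: norm_mult)
    have Im_circ: "Im (complex_of_real \<rho> * cis \<theta>) = \<rho> * sin \<theta>" for \<theta> by simp
    have sin_small: "\<bar>\<rho> * sin \<theta>\<bar> \<le> \<rho>" for \<theta> using \<rho>(1) mult_left_mono[OF abs_sin_le_one[of \<theta>], of \<rho>] by (simp add: abs_mult)
    have m_circ: "mean_log_norm \<alpha> (F (\<rho> * cis \<theta>)) N = m N (\<rho> * sin \<theta>)" for N \<theta>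
      using mean_Im[OF circ] by (simp add: Im_circ)
    have circ_cont: "continuous_on UNIV (\<lambda>\<theta>. complex_of_real \<rho> * cis \<theta>)" by (intro continuous_intros continuous_on_cis)
    have m_cont: "continuous_on S (\<lambda>\<theta>. m N (\<rho> * sin \<theta>))" for N S
    proof -
      have "continuous_on S (\<lambda>\<theta>. mean_log_norm \<alpha> (F (\<rho> * cis \<theta>)) N)"
        by (rule continuous_on_compose2[OF mean_cont continuous_on_subset[OF circ_cont]]) (use circ in auto)
      then show ?thesis by (simp add: m_circ)
    qed
    have sub_mean: "m N 0 \<le> integral {0..2 * pi} (\<lambda>\<theta>. m N (\<rho> * sin \<theta>)) / (2 * pi)" for N
    proof -
      define f where "f = (\<lambda>x \<theta>. ln (norm (complex_iter \<alpha> (F (\<rho> * cis \<theta>)) N x)))"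
      have f_cont: "continuous_on S (\<lambda>(x, \<theta>). f x \<theta>)" for S
      proof -
        have "continuous_on S (\<lambda>y. (\<lambda>(z, x). ln (norm (complex_iter \<alpha> (F z) N x))) (\<rho> * cis (snd y), fst y))"
          by (rule continuous_on_compose2[OF log_cont]) (use circ in \<open>auto intro!: continuous_intros continuous_on_compose2[OF circ_cont]\<close>)
        then show ?thesis by (simp add: f_def case_prod_beta)
      qed
      have inner_cont: "continuous_on (cbox 0 1) (\<lambda>x. integral (cbox 0 (2 * pi)) (f x))"
        by (rule integral_continuous_on_param) (rule f_cont)
      have "integral (cbox 0 1) (\<lambda>x. ln (norm (complex_iter \<alpha> (F 0) N x)))
          \<le> integral (cbox 0 1) (\<lambda>x. integral (cbox 0 (2 * pi)) (f x) / (2 * pi))"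
      proof (rule integral_le)
        show "(\<lambda>x. ln (norm (complex_iter \<alpha> (F 0) N x))) integrable_on cbox 0 1"
          by (intro integrable_continuous continuous_log_norm_iter coc) (use R in simp)
        show "(\<lambda>x. integral (cbox 0 (2 * pi)) (f x) / (2 * pi)) integrable_on cbox 0 1"
          by (intro integrable_continuous continuous_on_divide inner_cont continuous_intros) simp
        fix x
        show "ln (norm (complex_iter \<alpha> (F 0) N x)) \<le> integral (cbox 0 (2 * pi)) (f x) / (2 * pi)"
          unfolding f_def cbox_interval
        proof (rule log_norm_sub_mean_value[OF _ \<rho>(1) \<rho>R])
          show "(\<lambda>z. complex_iter \<alpha> (F z) N x $ i $ j) holomorphic_on ball 0 R" for i j
            by (rule complex_iter_entry_holomorphic[OF hol])
          show "complex_iter \<alpha> (F z) N x \<noteq> 0" if "z \<in> ball 0 R" for z using iter_ge1[OF that, of N x] by auto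
        qed
      qed
      also have "\<dots> = integral (cbox 0 1) (\<lambda>x. integral (cbox 0 (2 * pi)) (f x)) / (2 * pi)" by simp
      also have "integral (cbox 0 1) (\<lambda>x. integral (cbox 0 (2 * pi)) (f x)) =
          integral (cbox 0 (2 * pi)) (\<lambda>\<theta>. integral (cbox 0 1) (\<lambda>x. f x \<theta>))"
        by (rule integral_swap_continuous[OF f_cont])
      finally have "integral (cbox 0 1) (\<lambda>x. ln (norm (complex_iter \<alpha> (F 0) N x))) / real N
          \<le> integral (cbox 0 (2 * pi)) (\<lambda>\<theta>. integral (cbox 0 1) (\<lambda>x. f x \<theta>)) / (2 * pi) / real N"
        by (intro divide_right_mono) auto
      also have "\<dots> = integral (cbox 0 (2 * pi)) (\<lambda>\<theta>. m N (\<rho> * sin \<theta>)) / (2 * pi)"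
      proof -
        have "m N (\<rho> * sin \<theta>) = integral (cbox 0 1) (\<lambda>x. f x \<theta>) / real N" for \<theta>
          unfolding m_circ[symmetric] by (simp add: mean_log_norm_def f_def)
        then show ?thesis by simp
      qed
      finally show ?thesis by (simp add: m_def mean_log_norm_def)
    qed
    obtain \<Gamma> where \<Gamma>: "1 \<le> \<Gamma>" "\<And>z x. cmod z \<le> \<rho> \<Longrightarrow> norm (F z x) \<le> \<Gamma>"
    proof -
      have sub: "cball (0 :: complex) \<rho> \<subseteq> ball 0 R" using \<rho>R by auto
      have c: "continuous_on (cball 0 \<rho> \<times> UNIV) (\<lambda>(z, x). F z x)"
        by (rule continuous_on_subset[OF cont]) (use sub in auto)
      have p: "torus_periodic (F z)" if "z \<in> cball 0 \<rho>" for z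
        using coc[of z] that sub by (auto simp: torus_cocycle_def)
      obtain B where B: "\<forall>z\<in>cball 0 \<rho>. \<forall>x. norm (F z x) \<le> B"
        using torus_periodic_family_bounded[OF compact_cball c p] by blast
      show ?thesis
      proof (rule that[of "max 1 B"])
        fix z :: complex and x assume "cmod z \<le> \<rho>"
        then have "norm (F z x) \<le> B" using B by simp
        then show "norm (F z x) \<le> max 1 B" by linarith
      qed simp
    qed
    have m_bound: "norm (m (Suc N) (\<rho> * sin \<theta>)) \<le> ln 2 + ln \<Gamma>" for N \<theta>
    proof -
      have "\<bar>\<rho> * sin \<theta>\<bar> < R" using sin_small[of \<theta>] \<rho>R by linarith
      note v = coc[OF vb[OF this]]
      have "norm (F (\<i> * of_real (\<rho> * sin \<theta>)) x) \<le> \<Gamma>" for x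
        by (rule \<Gamma>(2)) (use sin_small[of \<theta>] in \<open>simp add: norm_mult abs_mult\<close>)
      from mean_log_norm_le[OF v this \<Gamma>(1), of "Suc N" \<alpha>] mean_log_norm_nonneg[OF v, of \<alpha> "Suc N"]
      show ?thesis by (simp add: m_def)
    qed
    have m_lim: "(\<lambda>N. m (Suc N) (\<rho> * sin \<theta>)) \<longlonglongrightarrow> U (\<rho> * sin \<theta>)" for \<theta>
    proof -
      have "\<bar>\<rho> * sin \<theta>\<bar> < R" using sin_small[of \<theta>] \<rho>R by linarith
      from complex_lyapunov_limit(1)[OF coc[OF vb[OF this]], of \<alpha>]
      show ?thesis unfolding m_def U_def by (rule LIMSEQ_Suc)
    qed
    have dom: "(\<lambda>\<theta>. U (\<rho> * sin \<theta>)) integrable_on {0..2 * pi}"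
       "(\<lambda>N. integral {0..2 * pi} (\<lambda>\<theta>. m (Suc N) (\<rho> * sin \<theta>))) \<longlonglongrightarrow> integral {0..2 * pi} (\<lambda>\<theta>. U (\<rho> * sin \<theta>))"
      by (rule dominated_convergence[where f="\<lambda>N \<theta>. m (Suc N) (\<rho> * sin \<theta>)" and h="\<lambda>_. ln 2 + ln \<Gamma>"];
          use m_bound m_lim in \<open>auto intro!: integrable_continuous_real m_cont\<close>)+
    have lim: "(\<lambda>N. integral {0..2 * pi} (\<lambda>\<theta>. m (Suc N) (\<rho> * sin \<theta>)) / (2 * pi)) \<longlonglongrightarrow> integral {0..2 * pi} (\<lambda>\<theta>. U (\<rho> * sin \<theta>)) / (2 * pi)"
      by (intro tendsto_divide dom tendsto_const) simp
    have lim0: "(\<lambda>N. m (Suc N) 0) \<longlonglongrightarrow> U 0" using m_lim[of 0] by simp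
    have "U 0 \<le> integral {0..2 * pi} (\<lambda>\<theta>. U (\<rho> * sin \<theta>)) / (2 * pi)"
      by (rule LIMSEQ_le[OF lim0 lim]) (use sub_mean in blast)
    also have "integral {0..2 * pi} (\<lambda>\<theta>. U (\<rho> * sin \<theta>)) \<le> (a + \<bar>c\<bar> * \<rho>) * (2 * pi)"
    proof -
      define Z where "Z = {\<theta> \<in> {0..2 * pi}. sin \<theta> = 0}"
      have "Z \<subseteq> (\<lambda>i :: int. of_int i * pi) ` {0..2}"
      proof
        fix \<theta> assume "\<theta> \<in> Z"
        then have \<theta>: "0 \<le> \<theta>" "\<theta> \<le> 2 * pi" "sin \<theta> = 0" by (auto simp: Z_def)
        then obtain i :: int where i: "\<theta> = of_int i * pi" using sin_zero_iff_int2 by blast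
        then have "0 * pi \<le> of_int i * pi" "of_int i * pi \<le> 2 * pi" using \<theta> by auto
        then have "0 \<le> real_of_int i" "real_of_int i \<le> 2" using pi_gt_zero mult_right_le_imp_le by blast+
        then have "0 \<le> i" "i \<le> 2" by auto
        then show "\<theta> \<in> (\<lambda>i :: int. of_int i * pi) ` {0..2}" using i by auto
      qed
      then have negl: "negligible Z" by (meson finite_atLeastAtMost_int finite_imageI finite_subset negligible_finite)
      \<comment> \<open>on \<open>Z\<close> the integrand is \<open>U 0\<close>, for which no upper bound is known yet\<close>
      define g where "g = (\<lambda>\<theta>. if \<theta> \<in> Z then a else U (\<rho> * sin \<theta>))"
      have int_g: "g integrable_on {0..2 * pi}"
        by (rule integrable_spike[OF dom(1) negl]) (auto simp: g_def)
      have "integral {0..2 * pi} (\<lambda>\<theta>. U (\<rho> * sin \<theta>)) = integral {0..2 * pi} g"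
        by (rule integral_spike[OF negl]) (auto simp: g_def)
      also have "\<dots> \<le> integral {0..2 * pi} (\<lambda>_. a + \<bar>c\<bar> * \<rho>)"
      proof (rule integral_le[OF int_g])
        fix \<theta> assume \<theta>: "\<theta> \<in> {0..2 * pi}"
        show "g \<theta> \<le> a + \<bar>c\<bar> * \<rho>"
        proof (cases "\<theta> \<in> Z")
          case True
          then show ?thesis using \<rho>(1) by (simp add: g_def)
        next
          case False
          define y where "y = \<bar>\<rho> * sin \<theta>\<bar>"
          have y: "0 < y" "y \<le> \<rho>" using False \<theta> \<rho>(1) sin_small[of \<theta>] by (auto simp: Z_def y_def)
          have "U (\<rho> * sin \<theta>) = U y"
            using U_even[of y] y \<rho>R by (auto simp: y_def abs_if)
          also have "\<dots> = a + c * y" by (rule affine) (use y \<rho> in auto)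
          also have "c * y \<le> \<bar>c\<bar> * \<rho>" using y by (intro order_trans[OF mult_right_mono[OF abs_ge_self] mult_left_mono]) auto
          finally show ?thesis using False by (simp add: g_def)
        qed
      qed auto
      finally show ?thesis by (simp add: mult.commute)
    qed
    finally show ?thesis by (simp add: divide_right_mono)
  qed
  have "U 0 \<le> a"
  proof (rule field_le_epsilon)
    fix e :: real assume e: "e > 0"
    define \<rho> where "\<rho> = min (e0 / 2) (e / (\<bar>c\<bar> + 1))"
    have \<rho>: "0 < \<rho>" "\<rho> < e0" using e e0(1) by (auto simp: \<rho>_def min_less_iff_disj)
    have "\<bar>c\<bar> * \<rho> \<le> \<bar>c\<bar> * (e / (\<bar>c\<bar> + 1))" by (intro mult_left_mono) (auto simp: \<rho>_def)
    also have "\<dots> \<le> e" using e by (simp add: field_simps)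
    finally show "U 0 \<le> a + e" using lower[OF \<rho>] by linarith
  qed
  with upper have "U 0 = a" by linarith
  moreover have "U e1 = a + c * e1" "U (2 * e1) = a + c * (2 * e1)" using affine e1 by auto
  ultimately show ?thesis by (simp add: U_def)
qed

section \<open>Analyticity of the Lyapunov exponent\<close>

lemma norm_real_matrix_vector_le: "norm ((M :: real ^ 2 ^ 2) *v v) \<le> norm M * norm v"
proof -
  have vec: "(norm (u :: real ^ 2))\<^sup>2 = (u $ 1)\<^sup>2 + (u $ 2)\<^sup>2" for u
    by (simp add: norm_vec_def L2_set_def sum_2)
  have cs: "(a * c + b * d)\<^sup>2 \<le> (a\<^sup>2 + b\<^sup>2) * (c\<^sup>2 + d\<^sup>2)" for a b c d :: real
    using zero_le_power2[of "a * d - b * c"] by (simp add: power2_eq_square algebra_simps)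
  have "(norm (M *v v))\<^sup>2 \<le> (norm M * norm v)\<^sup>2"
    unfolding power_mult_distrib norm_real_mat2 vec matrix_vector_entry2
    using cs[of "M$1$1" "v$1" "M$1$2" "v$2"] cs[of "M$2$1" "v$1" "M$2$2" "v$2"]
    by (simp add: algebra_simps)
  then show ?thesis by (rule power2_le_imp_le) auto
qed

lemma onorm_le_norm_mat2: "onorm (\<lambda>v. (M :: real ^ 2 ^ 2) *v v) \<le> norm M"
  by (rule onorm_le) (rule norm_real_matrix_vector_le)

lemma norm_mat2_le_onorm: "norm (M :: real ^ 2 ^ 2) \<le> 2 * onorm (\<lambda>v. M *v v)"
proof -
  have col: "norm (M *v axis i 1) \<le> onorm (\<lambda>v. M *v v)" for i :: 2
    using onorm[OF matrix_vector_mul_bounded_linear, of M "axis i 1"] by simp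
  have "(norm M)\<^sup>2 = (norm (M *v axis 1 1))\<^sup>2 + (norm (M *v axis 2 1))\<^sup>2"
    unfolding norm_real_mat2 by (simp add: norm_vec_def L2_set_def sum_2 matrix_vector_entry2 axis_def)
  also have "\<dots> \<le> (norm (M *v axis 1 1) + norm (M *v axis 2 1))\<^sup>2" by (simp add: power2_sum)
  finally have "norm M \<le> norm (M *v axis 1 1) + norm (M *v axis 2 1)" by (rule power2_le_imp_le) auto
  then show ?thesis using col[of 1] col[of 2] by linarith
qed

lemma continuous_on_onorm_mat2:
  fixes f :: "'a::topological_space \<Rightarrow> real ^ 2 ^ 2"
  assumes "continuous_on S f"
  shows "continuous_on S (\<lambda>x. onorm (\<lambda>v. f x *v v))"
proof -
  have le: "onorm (\<lambda>v. M *v v) - onorm (\<lambda>v. N *v v) \<le> norm (M - N)" for M N :: "real ^ 2 ^ 2"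
  proof -
    have "onorm (\<lambda>v. N *v v + (M - N) *v v) \<le> onorm (\<lambda>v. N *v v) + onorm (\<lambda>v. (M - N) *v v)"
      by (intro onorm_triangle matrix_vector_mul_bounded_linear)
    moreover have "N *v v + (M - N) *v v = M *v v" for v by (simp add: matrix_vector_mult_diff_rdistrib)
    ultimately show ?thesis using onorm_le_norm_mat2[of "M - N"] by simp
  qed
  have "1-lipschitz_on UNIV (\<lambda>M :: real ^ 2 ^ 2. onorm (\<lambda>v. M *v v))"
  proof (rule lipschitz_onI)
    fix M N :: "real ^ 2 ^ 2"
    show "dist (onorm (\<lambda>v. M *v v)) (onorm (\<lambda>v. N *v v)) \<le> 1 * dist M N"
      using le[of M N] le[of N M] by (simp add: dist_real_def dist_norm norm_minus_commute abs_le_iff)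
  qed simp
  then show ?thesis
    using continuous_on_compose2[OF lipschitz_on_continuous_on assms] by blast
qed

text \<open>
The operator norm and the Frobenius norm differ by a factor of at most \<open>2\<close>, which is lost in the limit.
\<close>

lemma lyapunov_exponent_eq_complex:
  fixes A :: "real ^ 'n \<Rightarrow> real ^ 2 ^ 2"
  assumes coc: "torus_cocycle (\<lambda>x. complex_matrix (A x) 0)"
  shows "lyapunov_exponent \<alpha> A = complex_lyapunov \<alpha> (\<lambda>x. complex_matrix (A x) 0)"
proof -
  define F where "F = (\<lambda>x. complex_matrix (A x) 0)"
  define C where "C = cocycle_iter \<alpha> A"
  have iter: "complex_iter \<alpha> F N x = complex_matrix (C N x) 0" for N x
    unfolding F_def C_def by (rule complex_iter_real)
  have iter_norm: "norm (complex_iter \<alpha> F N x) = norm (C N x)" for N x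
    by (simp add: iter norm_complex_matrix_real)
  have cF: "torus_cocycle F" using coc by (simp add: F_def)
  have C_cont: "continuous_on S (C N)" for S N
  proof (rule continuous_on_real_matrix_entries)
    fix i j
    have "continuous_on S (complex_iter \<alpha> F N)"
      using torus_cocycle_iter[OF cF, of \<alpha> N] by (auto simp: torus_cocycle_def intro: continuous_on_subset)
    then have "continuous_on S (\<lambda>x. Re (complex_iter \<alpha> F N x $ i $ j))" by (intro continuous_intros)
    then show "continuous_on S (\<lambda>x. C N x $ i $ j)" by (simp add: iter)
  qed
  have ge1: "1 \<le> norm (C N x)" for N x using torus_cocycle_norm_ge_1[OF cF, of \<alpha> N x] by (simp add: iter_norm)
  have onorm_pos: "0 < onorm (\<lambda>v. C N x *v v)" for N x
    using norm_mat2_le_onorm[of "C N x"] ge1[of N x] by linarith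
  define l where "l = (\<lambda>N x. ln (onorm (\<lambda>v. C N x *v v)))"
  have l_cont: "continuous_on S (l N)" for S N
    unfolding l_def using onorm_pos by (intro continuous_on_ln continuous_on_onorm_mat2 C_cont) (metis less_irrefl)
  have LINT: "(LINT x:cbox 0 1|lborel. l N x) = integral (cbox 0 1) (l N)" for N
  proof (rule set_borel_integral_eq_integral(2))
    show "set_integrable lborel (cbox 0 1) (l N)"
      unfolding set_integrable_def by (rule borel_integrable_compact[OF _ l_cont]) simp
  qed
  define a where "a = (\<lambda>N. 1 / real N * (LINT x:cbox 0 1|lborel. l N x))"
  have close: "\<bar>a N - mean_log_norm \<alpha> F N\<bar> \<le> ln 2 / real N" for N
  proof -
    have log: "\<bar>l N x - ln (norm (complex_iter \<alpha> F N x))\<bar> \<le> ln 2" for x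
    proof -
      have "l N x \<le> ln (norm (C N x))" unfolding l_def using onorm_pos onorm_le_norm_mat2 by (intro ln_mono) auto
      moreover have "ln (norm (C N x)) \<le> ln (2 * onorm (\<lambda>v. C N x *v v))"
        using norm_mat2_le_onorm[of "C N x"] ge1[of N x] by (intro ln_mono) auto
      moreover have "ln (2 * onorm (\<lambda>v. C N x *v v)) = ln 2 + l N x"
        unfolding l_def using onorm_pos[of N x] by (simp add: ln_mult)
      ultimately show ?thesis by (simp add: iter_norm abs_le_iff)
    qed
    have cont2: "continuous_on (cbox 0 1) (\<lambda>x. ln (norm (complex_iter \<alpha> F N x)))" by (rule continuous_log_norm_iter[OF cF])
    have "\<bar>integral (cbox 0 1) (\<lambda>x. l N x - ln (norm (complex_iter \<alpha> F N x)))\<bar> \<le> ln 2"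
      by (intro torus_integral_abs_le continuous_on_diff l_cont cont2 log)
    then have "\<bar>integral (cbox 0 1) (l N) - integral (cbox 0 1) (\<lambda>x. ln (norm (complex_iter \<alpha> F N x)))\<bar> \<le> ln 2"
      using integral_diff[OF integrable_continuous[OF l_cont] integrable_continuous[OF cont2], of N] by simp
    then have "\<bar>integral (cbox 0 1) (l N) - integral (cbox 0 1) (\<lambda>x. ln (norm (complex_iter \<alpha> F N x)))\<bar> / real N \<le> ln 2 / real N"
      by (rule divide_right_mono) simp
    then show ?thesis by (simp add: a_def LINT mean_log_norm_def abs_divide flip: diff_divide_distrib)
  qed
  have "(\<lambda>N. ln 2 / real N) \<longlonglongrightarrow> 0" by (rule lim_const_over_n)
  then have "(\<lambda>N. a N - mean_log_norm \<alpha> F N) \<longlonglongrightarrow> 0"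
    by (rule Lim_null_comparison[rotated]) (use close in auto)
  from tendsto_add[OF this complex_lyapunov_limit(1)[OF cF, of \<alpha>]]
  have "a \<longlonglongrightarrow> complex_lyapunov \<alpha> F" by simp
  then have "lim a = complex_lyapunov \<alpha> F" by (rule limI)
  then show ?thesis by (simp add: lyapunov_exponent_def a_def l_def C_def F_def)
qed

text \<open>
Multi-indices on the one-element basis of the reals are just natural numbers.
\<close>

lemma Re_holomorphic_power_series_real:
  fixes u :: "real \<Rightarrow> real" and H :: "complex \<Rightarrow> complex"
  assumes hol: "H holomorphic_on ball (of_real p) \<rho>" and \<rho>: "\<rho> > 0"
    and u: "\<And>x. \<bar>x - p\<bar> < \<rho> \<Longrightarrow> u x = Re (H (of_real x))"
  shows "\<exists>r>0. \<exists>c :: (real \<Rightarrow> nat) \<Rightarrow> real. \<forall>x\<in>ball p r.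
        ((\<lambda>k. (\<Prod>b\<in>Basis. ((x - p) \<bullet> b) ^ k b) *\<^sub>R c k) has_sum u x) (Basis \<rightarrow>\<^sub>E UNIV)"
proof -
  define a where "a = (\<lambda>n. (deriv ^^ n) H (of_real p) / fact n)"
  have sums: "(\<lambda>n. a n * (z - of_real p) ^ n) sums H z" if "z \<in> ball (of_real p) \<rho>" for z
    unfolding a_def by (rule holomorphic_power_series[OF hol that])
  have "of_real (p + \<rho> / 2) \<in> ball (complex_of_real p) \<rho>" using \<rho> by (simp add: dist_norm)
  from sums_summable[OF sums[OF this]] have summ: "summable (\<lambda>n. a n * complex_of_real (\<rho> / 2) ^ n)" by simp
  have has_sum: "((\<lambda>n. (x - p) ^ n * Re (a n)) has_sum u x) UNIV" if x: "x \<in> ball p (\<rho> / 2)" for x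
  proof -
    have xp: "\<bar>x - p\<bar> < \<rho> / 2" using x by (simp add: dist_real_def abs_minus_commute)
    have "complex_of_real x \<in> ball (of_real p) \<rho>"
      using xp \<rho> by (simp add: dist_norm abs_minus_commute flip: of_real_diff)
    from sums[OF this] have s: "(\<lambda>n. a n * of_real (x - p) ^ n) sums H (of_real x)" by simp
    have "summable (\<lambda>n. norm (a n * of_real (x - p) ^ n))"
      by (rule powser_insidea[OF summ]) (use xp \<rho> in \<open>simp flip: of_real_diff\<close>)
    then have "((\<lambda>n. a n * of_real (x - p) ^ n) has_sum H (of_real x)) UNIV"
      by (rule norm_summable_imp_has_sum[OF _ s])
    from has_sum_bounded_linear[OF bounded_linear_Re this]
    have "((\<lambda>n. Re (a n * of_real (x - p) ^ n)) has_sum Re (H (of_real x))) UNIV" by (simp add: o_def)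
    moreover have "Re (a n * of_real (x - p) ^ n) = (x - p) ^ n * Re (a n)" for n
      by (simp flip: of_real_power add: mult.commute)
    moreover have "u x = Re (H (of_real x))" using u[of x] xp \<rho> by simp
    ultimately show ?thesis by (simp add: mult.commute)
  qed
  have "((\<lambda>k. (\<Prod>b\<in>Basis. ((x - p) \<bullet> b) ^ k b) *\<^sub>R Re (a (k 1))) has_sum u x) (Basis \<rightarrow>\<^sub>E UNIV)"
    if x: "x \<in> ball p (\<rho> / 2)" for x
  proof (rule has_sum_reindex_bij_witness[where i="\<lambda>n. restrict (\<lambda>_. n) {1}" and j="\<lambda>k. k 1", THEN iffD2, OF _ _ _ _ _ refl has_sum[OF x]])
    fix k :: "real \<Rightarrow> nat" assume "k \<in> Basis \<rightarrow>\<^sub>E UNIV"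
    then show "restrict (\<lambda>_. k 1) {1} = k"
      by (auto simp: fun_eq_iff PiE_def extensional_def)
  qed auto
  then show ?thesis using \<rho> by (intro exI[of _ "\<rho> / 2"] conjI exI[of _ "\<lambda>k. Re (a (k 1))"]) auto
qed

theorem theorem1p3:
  fixes \<alpha> :: "real ^ 'n"
    and I :: "real set"
    and A :: "real \<Rightarrow> real ^ 'n \<Rightarrow> real ^ 2 ^ 2"
  assumes "open I" and "is_interval I"
    and "\<And>s. s \<in> I \<Longrightarrow> torus_SL2 (A s)"
    and "(\<lambda>(s, x). A s x) real_analytic_on (I \<times> UNIV)"
    and "\<And>s. s \<in> I \<Longrightarrow> premonotonic \<alpha> (A s)"
  shows "(\<lambda>s. lyapunov_exponent \<alpha> (A s)) real_analytic_on I"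
  unfolding real_analytic_on_def
proof (intro ballI)
  fix s0 assume s0: "s0 \<in> I"
  obtain n w B B' where n: "n \<ge> 1" and B: "continuous_on UNIV B" "torus_periodic B" "\<And>x. det (B x) = 1"
    and B': "continuous_on UNIV B'" "torus_periodic B'"
    and gain: "\<And>x v C'. ((\<lambda>t. cocycle_iter \<alpha> (A s0) n (x + t *\<^sub>R w)) has_vector_derivative C') (at 0) \<Longrightarrow> v \<noteq> 0 \<Longrightarrow>
       cross2 (B x *v v) (B' x *v v)
         < cross2 ((B (x + real n *\<^sub>R \<alpha>) ** cocycle_iter \<alpha> (A s0) n x) *v v)
             ((B' (x + real n *\<^sub>R \<alpha>) ** cocycle_iter \<alpha> (A s0) n x + B (x + real n *\<^sub>R \<alpha>) ** C') *v v)"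
    using premonotonic_twist_gain[OF assms(5)[OF s0]] by metis
  have per: "torus_periodic (A s)" if "s \<in> I" for s using assms(3)[OF that] by (simp add: torus_SL2_def)
  obtain R E where R: "R > 0" "\<And>s. \<bar>s - s0\<bar> < R \<Longrightarrow> s \<in> I" and E: "matrix_complexification A w s0 R E"
    using matrix_complexification_exists[OF assms(1) s0 per assms(4)] by blast
  have SL2: "torus_SL2 (A s)" if "\<bar>s - s0\<bar> < R" for s using assms(3) R(2)[OF that] .
  have sb: "complex_of_real s \<in> ball (of_real s0) R" if "\<bar>s - s0\<bar> < R" for s
    using that by (simp add: dist_norm abs_minus_commute flip: of_real_diff)
  define b where "b = (\<lambda>e x. complex_matrix (B x) (e *\<^sub>R B' x))"
  have b_cont: "continuous_on UNIV (b e)" for e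
    unfolding b_def complex_matrix_def Complex_eq
    by (intro continuous_on_vec_lambda continuous_intros B(1) B'(1))
  have b_per: "torus_periodic (b e)" for e
    using B(2) B'(2) by (simp add: b_def torus_periodic_def)
  obtain \<eta> e0 where \<eta>: "\<eta> > 0" "\<eta> \<le> R" and e0: "e0 > 0" "e0 \<le> R"
    and b_det: "\<And>e x. 0 < e \<Longrightarrow> e < e0 \<Longrightarrow> det (b e x) \<noteq> 0"
    and cone: "\<And>s e. \<bar>s - s0\<bar> < \<eta> \<Longrightarrow> 0 < e \<Longrightarrow> e < e0 \<Longrightarrow>
      contracts_cone \<alpha> (\<lambda>x. E (of_real s) x (\<i> * of_real e)) n (b e)"
  proof -
    obtain \<eta> e0 where h: "\<eta> > 0" "e0 > 0" "\<eta> \<le> R" "e0 \<le> R" "\<And>s e. \<bar>s - s0\<bar> < \<eta> \<Longrightarrow> 0 < e \<Longrightarrow> e < e0 \<Longrightarrow>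
      (\<forall>x. det (b e x) \<noteq> 0) \<and> contracts_cone \<alpha> (\<lambda>x. E (of_real s) x (\<i> * of_real e)) n (b e)"
      using uniform_cone_contraction[OF E R(1) SL2 B B' gain] unfolding b_def by blast
    show ?thesis
      using that[OF h(1,3,2,4)] h(5) h(5)[of s0] h(1) by simp
  qed
  have vert: "\<i> * complex_of_real e \<in> ball 0 R" if "\<bar>e\<bar> < R" for e using that by (simp add: norm_mult)
  have coc: "torus_cocycle (\<lambda>x. E s x z)" if "s \<in> ball (of_real s0) R" "z \<in> ball 0 R" for s z
    by (rule complexification_torus_cocycle[OF E SL2 that])

  \<comment> \<open>any \<open>e1\<close> such that both \<open>e1\<close> and \<open>2 e1\<close> lie strictly between \<open>0\<close> and \<open>e0\<close>\<close>
  define e1 where "e1 = e0 / 3"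
  have e1: "0 < e1" "2 * e1 < e0" using e0 by (auto simp: e1_def)
  define \<Lambda> where "\<Lambda> = (\<lambda>e s. complex_lyapunov \<alpha> (\<lambda>x. E s x (\<i> * of_real e)))"
  \<comment> \<open>at a fixed height \<open>e > 0\<close> the exponent is harmonic in the parameter\<close>
  have parameter: "\<exists>\<rho>>0. \<rho> \<le> R \<and> (\<exists>G. G holomorphic_on ball (of_real s0) \<rho> \<and>
      (\<forall>s\<in>ball (of_real s0) \<rho>. Re (G s) = \<Lambda> e s))" if e: "0 < e" "e < e0" for e
  proof -
    have eb: "\<i> * complex_of_real e \<in> ball 0 R" using e e0 by (intro vert) auto
    have contracts: "contracts_cone \<alpha> (\<lambda>x. E (of_real s0) x (\<i> * of_real e)) n (b e)"
      using cone[of s0, OF _ e] \<eta> by simp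
    have c: "continuous_on (ball (of_real s0) R \<times> UNIV) (\<lambda>(s, x). E s x (\<i> * of_real e))"
    proof -
      have "continuous_on (ball (of_real s0) R \<times> UNIV) (\<lambda>y. (\<lambda>(s, x, z). E s x z) (fst y, snd y, \<i> * of_real e))"
        by (rule continuous_on_compose2[OF complexification_continuous[OF E]]) (use eb in \<open>auto intro!: continuous_intros\<close>)
      then show ?thesis by (simp add: case_prod_beta)
    qed
    show ?thesis
      unfolding \<Lambda>_def
      by (rule lyapunov_harmonic_near_cone_contraction[OF R(1) c complexification_holomorphic_parameter[OF E eb] coc[OF _ eb]
            n b_cont b_per b_det[OF e] contracts])
  qed
  obtain \<rho>1 G1 where \<rho>1: "\<rho>1 > 0" "\<rho>1 \<le> R" and G1: "G1 holomorphic_on ball (of_real s0) \<rho>1"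
    "\<And>s. s \<in> ball (of_real s0) \<rho>1 \<Longrightarrow> Re (G1 s) = \<Lambda> e1 s" using parameter[of e1] e1 by auto
  obtain \<rho>2 G2 where \<rho>2: "\<rho>2 > 0" "\<rho>2 \<le> R" and G2: "G2 holomorphic_on ball (of_real s0) \<rho>2"
    "\<And>s. s \<in> ball (of_real s0) \<rho>2 \<Longrightarrow> Re (G2 s) = \<Lambda> (2 * e1) s" using parameter[of "2 * e1"] e1 by auto
  define \<rho> where "\<rho> = min \<eta> (min \<rho>1 \<rho>2)"
  have \<rho>: "\<rho> > 0" "\<rho> \<le> \<eta>" "\<rho> \<le> \<rho>1" "\<rho> \<le> \<rho>2" using \<eta> \<rho>1 \<rho>2 by (auto simp: \<rho>_def)

  \<comment> \<open>for a fixed parameter the exponent is affine in the height, down to the real cocycle\<close>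
  have extrapolation: "lyapunov_exponent \<alpha> (A s) = 2 * \<Lambda> e1 (of_real s) - \<Lambda> (2 * e1) (of_real s)" if s: "\<bar>s - s0\<bar> < \<eta>" for s
  proof -
    have sR: "\<bar>s - s0\<bar> < R" using s \<eta> by linarith
    define F where "F = (\<lambda>z x. E (of_real s) x z)"
    have F_cont: "continuous_on (ball 0 R \<times> UNIV) (\<lambda>(z, x). F z x)"
    proof -
      have "continuous_on (ball 0 R \<times> UNIV) (\<lambda>y. (\<lambda>(s, x, z). E s x z) (of_real s, snd y, fst y))"
        by (rule continuous_on_compose2[OF complexification_continuous[OF E]]) (use sb[OF sR] in \<open>auto intro!: continuous_intros\<close>)
      then show ?thesis by (simp add: case_prod_beta F_def)
    qed
    have F_hol: "(\<lambda>z. F z x $ i $ j) holomorphic_on ball 0 R" for x i j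
      unfolding F_def by (rule complexification_holomorphic_time[OF E sb[OF sR]])
    have F_coc: "torus_cocycle (F z)" if "z \<in> ball 0 R" for z
      unfolding F_def by (rule coc[OF sb[OF sR] that])
    have "complex_lyapunov \<alpha> (F 0) =
       2 * complex_lyapunov \<alpha> (F (\<i> * of_real e1)) - complex_lyapunov \<alpha> (F (\<i> * of_real (2 * e1)))"
    proof (rule lyapunov_at_boundary[OF F_cont F_hol F_coc _ _ e0 _ e1])
      show "F (z + of_real t) x = F z (x + t *\<^sub>R w)" if "z \<in> ball 0 R" "z + of_real t \<in> ball 0 R" for z t x
        unfolding F_def by (rule complexification_shift[OF E sR that])
      show "F (cnj z) x = conj_matrix (F z x)" if "z \<in> ball 0 R" for z x
        unfolding F_def conj_matrix_def by (rule complexification_cnj[OF E sR that])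
      fix e assume e: "0 < e" "e < e0"
      define R' where "R' = R - e"
      have R': "R' > 0" using e e0 by (simp add: R'_def)
      have sub: "ball (\<i> * complex_of_real e) R' \<subseteq> ball 0 R"
      proof
        fix z assume z: "z \<in> ball (\<i> * complex_of_real e) R'"
        then show "z \<in> ball 0 R"
          using norm_triangle_ineq2[of z "\<i> * complex_of_real e"] e
          by (simp add: R'_def dist_norm norm_minus_commute norm_mult)
      qed
      have contracts: "contracts_cone \<alpha> (F (\<i> * of_real e)) n (b e)" using cone[OF s e] unfolding F_def .
      have c: "continuous_on (ball (\<i> * complex_of_real e) R' \<times> UNIV) (\<lambda>(z, x). F z x)"
        by (rule continuous_on_subset[OF F_cont]) (use sub in auto)
      have h: "(\<lambda>z. F z x $ i $ j) holomorphic_on ball (\<i> * complex_of_real e) R'" for x i j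
        by (rule holomorphic_on_subset[OF F_hol sub])
      have k: "torus_cocycle (F z)" if "z \<in> ball (\<i> * complex_of_real e) R'" for z using F_coc sub that by blast
      obtain \<rho> G where "\<rho> > 0" "\<rho> \<le> R'" "G holomorphic_on ball (\<i> * of_real e) \<rho>"
        "\<forall>z\<in>ball (\<i> * of_real e) \<rho>. Re (G z) = complex_lyapunov \<alpha> (F z)"
        using lyapunov_harmonic_near_cone_contraction[OF R' c h k n b_cont b_per b_det[OF e] contracts] by blast
      moreover from this have "ball (\<i> * complex_of_real e) \<rho> \<subseteq> ball 0 R"
        using sub subset_ball[of \<rho> R'] by blast
      ultimately show "\<exists>\<rho>>0. ball (\<i> * of_real e) \<rho> \<subseteq> ball 0 R \<and>
        (\<exists>G. G holomorphic_on ball (\<i> * of_real e) \<rho> \<and>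
          (\<forall>z\<in>ball (\<i> * of_real e) \<rho>. Re (G z) = complex_lyapunov \<alpha> (F z)))" by blast
    qed
    moreover have "F 0 = (\<lambda>x. complex_matrix (A s x) 0)"
      using complexification_real[OF E sR, of 0] R(1) by (auto simp: F_def)
    moreover have "lyapunov_exponent \<alpha> (A s) = complex_lyapunov \<alpha> (\<lambda>x. complex_matrix (A s x) 0)"
      using F_coc[of 0] R(1) \<open>F 0 = _\<close> by (intro lyapunov_exponent_eq_complex) simp
    ultimately show ?thesis by (simp add: \<Lambda>_def F_def)
  qed
  show "\<exists>r>0. \<exists>c :: (real \<Rightarrow> nat) \<Rightarrow> real. \<forall>s\<in>ball s0 r.
        ((\<lambda>k. (\<Prod>b\<in>Basis. ((s - s0) \<bullet> b) ^ k b) *\<^sub>R c k) has_sum lyapunov_exponent \<alpha> (A s)) (Basis \<rightarrow>\<^sub>E UNIV)"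
  proof (rule Re_holomorphic_power_series_real[OF _ \<rho>(1)])
    show "(\<lambda>s. 2 * G1 s - G2 s) holomorphic_on ball (of_real s0) \<rho>"
      by (intro holomorphic_intros holomorphic_on_subset[OF G1(1)] holomorphic_on_subset[OF G2(1)] subset_ball \<rho>)
    fix s assume s: "\<bar>s - s0\<bar> < \<rho>"
    then have "complex_of_real s \<in> ball (of_real s0) \<rho>"
      by (simp add: dist_norm abs_minus_commute flip: of_real_diff)
    then have "of_real s \<in> ball (complex_of_real s0) \<rho>1" "of_real s \<in> ball (complex_of_real s0) \<rho>2"
      using \<rho> by auto
    then show "lyapunov_exponent \<alpha> (A s) = Re (2 * G1 (of_real s) - G2 (of_real s))"
      using extrapolation[of s] s \<rho>(2) by (simp add: G1(2) G2(2))
  qed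
qed

end
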